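(* Let $P$ be a fundamental polyhedron for a discrete group $G\subset\operatorname{Isom}(\mathbb H^n)$ that is generated by some side-pairing of $P$. Let $H$ be a hyperplane in $\mathbb H^n$ such that the interior of $H\cap P$ relative to $H$ is non-empty, and let $J$ be a subgroup of $G$ that keeps $H$ invariant (i.e. $j(H)=H$ for all $j\in J$). Assume the following three conditions hold. (1) $H\cap P$ is a fundamental polyhedron for the action of $J$ on $H$. (2) If $H$ contains a side $S$ of $P$ and $s$ is the side-pairing isometry corresponding to $S$, then $s(H)\neq H$. (3) Suppose $H$ contains an edge $E$ of $P$. Let $\{(E_i,S_i,R_i,g_i)\}_{i=1,2,\dots}$ be the edge-chase sequence starting with $E_1=E$, let $\alpha$ be the angle between $H$ and $S_1$, and let $\theta_i$ be the dihedral angle of $P$ at the edge $E_i$. If, for some $l\ge 1$, the edge $E_{l+1}$ is also contained in $H$, and $\beta$ is the angle between $H$ and $S_{l+1}$, then $$\theta_1+\dots+\theta_l+\beta-\alpha=k\pi$$ for some integer $k$. Then $H$ is precisely invariant under $J$.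
   Context: A polyhedron in $\mathbb H^n$ is a connected subset with non-empty interior whose boundary is made up of (pieces of) a locally finite collection of hyperplanes. A side (codimension-one side) $S$ of $P$ is a subset of $\partial P$ with $S=P\cap X$ and $S=\mathrm{cl}_X(\mathrm{int}_X S)$, where $X$ is a hyperplane bounding one of the defining half-spaces of $P$; a side is itself an $(n-1)$-dimensional polyhedron in $X$. An edge of $P$ is a side of a side (a codimension-two side); each edge is the intersection of two uniquely determined sides of $P$. The dihedral angle at an edge is the angle subtended in the interior of $P$ by these two sides. A side-pairing of $P$ is a rule which associates to each side $S$ of $P$ a side $S'$ of $P$ and an isometry $s$ of $\mathbb H^n$ with $s(S)=S'$, such that $s(\operatorname{int}P)\cap\operatorname{int}P=\emptyset$, the side associated to $S'$ is $S$, and the isometry associated to $S'$ is $s^{-1}$. Fundamental polyhedron: a polyhedron $D$ in a hyperbolic space $X$ is a fundamental polyhedron for a group $\Gamma$ acting on $X$ by isometries if the translates $\gamma(D)$, $\gamma\in\Gamma$, cover $X$, form a locally finite family, and $\gamma(D)$, $\gamma'(D)$ have disjoint interiors whenever $\gamma,\gamma'$ act differently on $X$. When $P$ is a fundamental polyhedron for the group $G$ generated by a side-pairing of $P$, the translates of $P$ form a tessellation in which they meet along common lower-dimensional sides, and the translate adjacent to $P$ across a side $S$ is $s^{-1}(P)$. Edge chase: given an edge $E_1$ which is the intersection of sides $S_1$ and $R_1$, let $g_1$ be the side-pairing isometry pairing $R_1$ with a side $S_2=g_1(R_1)$. Then $E_2=g_1(E_1)$ is an edge, determined by $S_2$ and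 some other side $R_2$. Let $g_2$ be the isometry pairing $R_2$ with a side $S_3$, and so on. Thus $E_i=S_i\cap R_i$, $g_i(E_i)=E_{i+1}$ and $g_i(R_i)=S_{i+1}$. Angle convention in (3): angles between $H$ and $S_i$ at an edge $E_i\subset H$ are measured in a $2$-plane orthogonal to $E_i$, starting from the ray given by $S_i$ and turning through the interior of $P$ (the direction from $S_i$ towards $R_i$) to the line given by $H$; they are well defined modulo $\pi$. $H$ is precisely invariant under the subgroup $J\subset G$ if $g(H)=H$ for all $g\in J$ and $g(H)\cap H=\emptyset$ for all $g\in G\setminus J$. *)

theory Defs
  imports "HOL-Analysis.Analysis" "HOL-Algebra.Generated_Groups"
begin

section \<open>Hyperbolic space\<close>

text \<open>Hyperbolic \<open>n\<close>-space, \<open>n = CARD('n)\<close>, is the upper sheet of the two-sheeted hyperboloid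
  in Minkowski space \<open>\<real>\<^sup>n \<times> \<real>\<close>.\<close>

definition lor :: "(real ^ 'n) \<times> real \<Rightarrow> (real ^ 'n) \<times> real \<Rightarrow> real" where
  "lor u v = fst u \<bullet> fst v - snd u * snd v"

lemma lor_commute: "lor u v = lor v u"
  by (simp add: lor_def inner_commute mult.commute)

lemma lor_bilinear [simp]:
  "lor (u + u') v = lor u v + lor u' v" "lor u (v + v') = lor u v + lor u v'"
  "lor (u - u') v = lor u v - lor u' v" "lor u (v - v') = lor u v - lor u v'"
  "lor (r *\<^sub>R u) v = r * lor u v" "lor u (r *\<^sub>R v) = r * lor u v"
  by (simp_all add: lor_def algebra_simps)

typedef ('n::finite) hyp = "{p :: (real ^ 'n) \<times> real. lor p p = -1 \<and> 0 < snd p}"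
  morphisms hvec hpoint
proof
  show "(0, 1) \<in> {p :: (real ^ 'n) \<times> real. lor p p = -1 \<and> 0 < snd p}"
    by (simp add: lor_def)
qed

lemma hvec_lor [simp]: "lor (hvec p) (hvec p) = -1" and hvec_pos: "0 < snd (hvec p)"
  using hvec [of p] by auto

lemma lor_orthogonal_pos:
  fixes w :: "(real ^ 'n) \<times> real"
  assumes "lor w (hvec q) = 0"
  shows "0 \<le> lor w w" and "lor w w = 0 \<Longrightarrow> w = 0"
proof -
  define x t y s where d: "x = fst (hvec q)" "t = snd (hvec q)" "y = fst w" "s = snd w"
  have t: "t\<^sup>2 = 1 + (norm x)\<^sup>2"
    using hvec_lor [of q] by (simp add: lor_def d dot_square_norm power2_eq_square)
  have st: "s * t = y \<bullet> x"
    using assms unfolding lor_def d by simp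
  have "(s * t)\<^sup>2 \<le> (norm y * norm x)\<^sup>2"
    unfolding st using Cauchy_Schwarz_ineq2 [of y x] by (metis abs_ge_zero power2_abs power_mono)
  then have *: "s\<^sup>2 * (1 + (norm x)\<^sup>2) \<le> (norm y)\<^sup>2 * (norm x)\<^sup>2"
    by (simp add: power_mult_distrib t)
  have w: "lor w w = (norm y)\<^sup>2 - s\<^sup>2"
    by (simp add: lor_def d dot_square_norm power2_eq_square)
  have **: "s\<^sup>2 \<le> lor w w * (norm x)\<^sup>2"
    using * unfolding w by (simp add: algebra_simps)
  show ge: "0 \<le> lor w w"
  proof (rule ccontr)
    assume "\<not> 0 \<le> lor w w"
    then have "lor w w * (norm x)\<^sup>2 \<le> 0" and "lor w w < 0"
      by (auto simp: mult_nonpos_nonneg)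
    then have "s\<^sup>2 \<le> 0" "(norm y)\<^sup>2 < s\<^sup>2"
      using ** w by linarith+
    then show False using zero_le_power2 [of "norm y"] by linarith
  qed
  show "w = 0" if "lor w w = 0"
  proof -
    have "s = 0" using ** that by simp
    then have "y = 0" using that w by simp
    then show ?thesis using \<open>s = 0\<close> by (simp add: d prod_eq_iff)
  qed
qed

lemma lor_orthogonal_Cauchy_Schwarz:
  fixes u v :: "(real ^ 'n) \<times> real"
  assumes "lor u (hvec q) = 0" "lor v (hvec q) = 0"
  shows "(lor u v)\<^sup>2 \<le> lor u u * lor v v"
proof (cases "lor v v = 0")
  case True
  then have "v = 0" using assms lor_orthogonal_pos(2) by blast
  then show ?thesis by (simp add: lor_def)
next
  case False
  then have pos: "0 < lor v v" using lor_orthogonal_pos(1) [OF assms(2)] by simp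
  define w where "w = lor v v *\<^sub>R u - lor u v *\<^sub>R v"
  have "lor w (hvec q) = 0" using assms by (simp add: w_def)
  then have "0 \<le> lor w w" by (rule lor_orthogonal_pos)
  also have "lor w w = lor v v * (lor u u * lor v v - (lor u v)\<^sup>2)"
    by (simp add: w_def lor_commute [of v u] power2_eq_square algebra_simps)
  finally show ?thesis using pos by (simp add: zero_le_mult_iff)
qed

lemma lor_hvec_le: "lor (hvec p) (hvec q) \<le> -1"
proof -
  define c where "c = lor (hvec p) (hvec q)"
  define w where "w = hvec p + c *\<^sub>R hvec q"
  have "lor w (hvec q) = 0" by (simp add: w_def c_def)
  then have "0 \<le> lor w w" by (rule lor_orthogonal_pos)
  also have "lor w w = c\<^sup>2 - 1"
    by (simp add: w_def c_def lor_commute [of "hvec q" "hvec p"] power2_eq_square)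
  finally have c2: "1 \<le> c\<^sup>2" by simp
  have n: "norm (fst (hvec r)) < snd (hvec r)" for r :: "'a hyp"
  proof -
    have "(norm (fst (hvec r)))\<^sup>2 < (snd (hvec r))\<^sup>2"
      using hvec_lor [of r] by (simp add: lor_def dot_square_norm power2_eq_square)
    then show ?thesis using hvec_pos [of r] by (simp add: power_less_imp_less_base)
  qed
  have "fst (hvec p) \<bullet> fst (hvec q) \<le> norm (fst (hvec p)) * norm (fst (hvec q))"
    by (rule norm_cauchy_schwarz)
  also have "\<dots> < snd (hvec p) * snd (hvec q)"
    using n by (simp add: mult_strict_mono')
  finally have "c < 0" by (simp add: c_def lor_def)
  moreover have "1 \<le> \<bar>c\<bar>" using c2 abs_le_square_iff [of 1 c] by simp
  ultimately show ?thesis by (simp add: c_def)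
qed

instantiation hyp :: (finite) metric_space
begin

definition dist_hyp :: "'a hyp \<Rightarrow> 'a hyp \<Rightarrow> real" where
  "dist_hyp p q = arcosh (- lor (hvec p) (hvec q))"

definition uniformity_hyp :: "('a hyp \<times> 'a hyp) filter" where
  "uniformity_hyp = (INF e\<in>{0 <..}. principal {(x, y). dist x y < e})"

definition open_hyp :: "'a hyp set \<Rightarrow> bool" where
  "open_hyp U \<longleftrightarrow> (\<forall>x\<in>U. \<forall>\<^sub>F (x', y) in uniformity. x' = x \<longrightarrow> y \<in> U)"

instance
proof
  fix p q r :: "'a hyp"
  have cosh_dist: "cosh (dist p q) = - lor (hvec p) (hvec q)" for p q :: "'a hyp"
    unfolding dist_hyp_def using lor_hvec_le [of p q] by (intro cosh_arcosh_real) simp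
  have dist_nonneg: "0 \<le> dist p q" for p q :: "'a hyp"
    unfolding dist_hyp_def using lor_hvec_le [of p q] by (intro arcosh_nonneg_real) simp
  show "uniformity = (INF e\<in>{0 <..}. principal {(x, y :: 'a hyp). dist x y < e})"
    by (rule uniformity_hyp_def)
  show "open U \<longleftrightarrow> (\<forall>x\<in>U. \<forall>\<^sub>F (x', y) in uniformity. x' = x \<longrightarrow> y \<in> U)" for U :: "'a hyp set"
    by (rule open_hyp_def)
  show "dist p q = 0 \<longleftrightarrow> p = q"
  proof
    assume "dist p q = 0"
    then have c: "lor (hvec p) (hvec q) = -1" using cosh_dist [of p q] by simp
    have "hvec p - hvec q = 0"
      by (rule lor_orthogonal_pos(2) [where q = q]) (simp_all add: c lor_commute [of "hvec q" "hvec p"])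
    then show "p = q" by (simp add: hvec_inject)
  next
    assume "p = q"
    then show "dist p q = 0" by (simp add: dist_hyp_def)
  qed
  show "dist p q \<le> dist p r + dist q r"
  proof -
    define c1 c2 where c: "c1 = lor (hvec p) (hvec r)" "c2 = lor (hvec q) (hvec r)"
    define u v where uv: "u = hvec p + c1 *\<^sub>R hvec r" "v = hvec q + c2 *\<^sub>R hvec r"
    have sinh2: "(sinh (dist x y))\<^sup>2 = (lor (hvec x) (hvec y))\<^sup>2 - 1" for x y :: "'a hyp"
      by (simp add: sinh_square_eq cosh_dist)
    have "(lor u v)\<^sup>2 \<le> lor u u * lor v v"
      by (rule lor_orthogonal_Cauchy_Schwarz [where q = r]) (simp_all add: uv c)
    also have "lor u u = (sinh (dist p r))\<^sup>2"
      unfolding sinh2 by (simp add: uv c lor_commute [of "hvec r" "hvec p"] power2_eq_square)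
    also have "lor v v = (sinh (dist q r))\<^sup>2"
      unfolding sinh2 by (simp add: uv c lor_commute [of "hvec r" "hvec q"] power2_eq_square)
    finally have "(lor u v)\<^sup>2 \<le> (sinh (dist p r) * sinh (dist q r))\<^sup>2"
      by (simp add: power_mult_distrib)
    then have "\<bar>lor u v\<bar> \<le> sinh (dist p r) * sinh (dist q r)"
      using dist_nonneg by (simp add: power2_le_iff_abs_le)
    moreover have "lor (hvec p) (hvec q) = lor u v - c1 * c2"
      by (simp add: uv c lor_commute [of "hvec r" "hvec q"])
    ultimately have "cosh (dist p q) \<le> cosh (dist p r + dist q r)"
      by (simp add: cosh_dist cosh_add c)
    then show ?thesis
      using dist_nonneg by (metis add_nonneg_nonneg cosh_real_nonneg_le_iff)
  qed
qed

end

definition isom_group :: "('n::finite hyp \<Rightarrow> 'n hyp) monoid" where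
  "isom_group = \<lparr>carrier = {f. surj f \<and> (\<forall>p q. dist (f p) (f q) = dist p q)},
     mult = (\<circ>), one = id\<rparr>"

lemma group_isom_group: "group isom_group"
proof (rule groupI)
  fix f :: "'a hyp \<Rightarrow> 'a hyp"
  assume "f \<in> carrier isom_group"
  then have f: "surj f" "\<And>p q. dist (f p) (f q) = dist p q"
    by (auto simp: isom_group_def)
  then have "inj f" by (metis dist_eq_0_iff injI)
  have "inv_into UNIV f \<circ> f = id" using \<open>inj f\<close> by simp
  moreover have "inv_into UNIV f \<in> carrier isom_group"
    using f \<open>inj f\<close> by (simp add: isom_group_def inj_imp_surj_inv) (metis surj_f_inv_f)
  ultimately show "\<exists>h\<in>carrier isom_group. h \<otimes>\<^bsub>isom_group\<^esub> f = \<one>\<^bsub>isom_group\<^esub>"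
    by (auto simp: isom_group_def)
next
  fix f g :: "'a hyp \<Rightarrow> 'a hyp"
  assume "f \<in> carrier isom_group" "g \<in> carrier isom_group"
  then show "f \<otimes>\<^bsub>isom_group\<^esub> g \<in> carrier isom_group"
    using comp_surj [of g f] by (simp add: isom_group_def)
qed (simp_all add: isom_group_def comp_assoc)

text \<open>A discrete group of isometries. The topology on the function type is that of pointwise
  convergence, which on the isometry group is the usual (compact-open) topology.\<close>

definition discrete_isom_group :: "('n::finite hyp \<Rightarrow> 'n hyp) set \<Rightarrow> bool" where
  "discrete_isom_group G \<longleftrightarrow> subgroup G isom_group \<and> discrete G"


section \<open>Hyperplanes and polyhedra\<close>

text \<open>Normal vectors of hyperplanes are space-like, i.e. \<open>lor v v > 0\<close>.\<close>

definition hplane :: "(real ^ 'n) \<times> real \<Rightarrow> 'n::finite hyp set" where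
  "hplane v = {p. lor v (hvec p) = 0}"

definition hspace :: "(real ^ 'n) \<times> real \<Rightarrow> 'n::finite hyp set" where
  "hspace v = {p. lor v (hvec p) \<le> 0}"

definition hyperplane :: "'n::finite hyp set \<Rightarrow> bool" where
  "hyperplane H \<longleftrightarrow> (\<exists>v. 0 < lor v v \<and> H = hplane v)"

text \<open>Polyhedra, sides and fundamental polyhedra are needed in \<open>\<bbbH>\<^sup>n\<close>, in a hyperplane, and (for
  sides of sides) in a plane of lower dimension. They are therefore defined relative to a
  hyperbolic subspace \<open>X\<close>, with \<open>X = UNIV\<close> for \<open>\<bbbH>\<^sup>n\<close> itself. The hyperplanes of \<open>X\<close> are exactly
  the non-empty proper intersections of \<open>X\<close> with hyperplanes of \<open>\<bbbH>\<^sup>n\<close>, and likewise for closed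
  half-spaces; for \<open>X = UNIV\<close> every space-like vector is admissible.\<close>

definition hplane_normal_in :: "'n::finite hyp set \<Rightarrow> (real ^ 'n) \<times> real \<Rightarrow> bool" where
  "hplane_normal_in X v \<longleftrightarrow> 0 < lor v v \<and> X \<inter> hplane v \<noteq> {} \<and> \<not> X \<subseteq> hplane v"

text \<open>\<open>P\<close> is the intersection of the half-spaces of \<open>X\<close> with outer normals in \<open>N\<close>, and the
  bounding hyperplanes of these half-spaces are locally finite in \<open>X\<close>. So polyhedra are closed
  and convex, and in particular connected; \<open>N = {}\<close> gives \<open>P = X\<close>.\<close>

definition defining_normals ::
    "'n::finite hyp set \<Rightarrow> 'n hyp set \<Rightarrow> ((real ^ 'n) \<times> real) set \<Rightarrow> bool" where
  "defining_normals X P N \<longleftrightarrow>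
     (\<forall>v\<in>N. hplane_normal_in X v) \<and>
     locally_finite_in (top_of_set X) ((\<lambda>v. X \<inter> hplane v) ` N) \<and>
     P = X \<inter> (\<Inter>v\<in>N. hspace v)"

definition polyhedron_in :: "'n::finite hyp set \<Rightarrow> 'n hyp set \<Rightarrow> bool" where
  "polyhedron_in X P \<longleftrightarrow> (\<exists>N. defining_normals X P N) \<and> top_of_set X interior_of P \<noteq> {}"

text \<open>\<open>side_on X P Y S\<close>: \<open>S\<close> is a side of the polyhedron \<open>P\<close> in \<open>X\<close>, lying on the hyperplane \<open>Y\<close>
  of \<open>X\<close>. The empty set, which satisfies the two equations for \<open>S\<close> whenever \<open>Y\<close> misses \<open>P\<close>, has
  to be excluded explicitly.\<close>

definition side_on ::
    "'n::finite hyp set \<Rightarrow> 'n hyp set \<Rightarrow> 'n hyp set \<Rightarrow> 'n hyp set \<Rightarrow> bool" where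
  "side_on X P Y S \<longleftrightarrow>
     (\<exists>N. defining_normals X P N \<and> (\<exists>v\<in>N. Y = X \<inter> hplane v)) \<and>
     S \<noteq> {} \<and>
     S \<subseteq> top_of_set X frontier_of P \<and>
     S = P \<inter> Y \<and>
     S = top_of_set Y closure_of (top_of_set Y interior_of S)"

definition side :: "'n::finite hyp set \<Rightarrow> 'n hyp set \<Rightarrow> bool" where
  "side P S \<longleftrightarrow> (\<exists>Y. side_on UNIV P Y S)"

definition edge :: "'n::finite hyp set \<Rightarrow> 'n hyp set \<Rightarrow> bool" where
  "edge P E \<longleftrightarrow> (\<exists>Y S Z. side_on UNIV P Y S \<and> side_on Y S Z E)"

definition fundamental_polyhedron ::
    "'n::finite hyp set \<Rightarrow> ('n hyp \<Rightarrow> 'n hyp) set \<Rightarrow> 'n hyp set \<Rightarrow> bool" where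
  "fundamental_polyhedron X \<Gamma> D \<longleftrightarrow>
     polyhedron_in X D \<and>
     (\<Union>\<gamma>\<in>\<Gamma>. \<gamma> ` D) = X \<and>
     locally_finite_in (top_of_set X) ((\<lambda>\<gamma>. \<gamma> ` D) ` \<Gamma>) \<and>
     (\<forall>\<gamma>\<in>\<Gamma>. \<forall>\<gamma>'\<in>\<Gamma>. (\<exists>x\<in>X. \<gamma> x \<noteq> \<gamma>' x) \<longrightarrow>
        (top_of_set X interior_of (\<gamma> ` D)) \<inter> (top_of_set X interior_of (\<gamma>' ` D)) = {})"


section \<open>Angles at an edge\<close>

text \<open>The point at time \<open>t\<close> on the unit speed geodesic that starts at \<open>p\<close> with initial tangent
  vector \<open>w\<close>, where \<open>lor w (hvec p) = 0\<close> and \<open>lor w w = 1\<close>.\<close>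

definition geodesic :: "'n::finite hyp \<Rightarrow> (real ^ 'n) \<times> real \<Rightarrow> real \<Rightarrow> 'n hyp" where
  "geodesic p w t = hpoint (cosh t *\<^sub>R hvec p + sinh t *\<^sub>R w)"

text \<open>The unit vectors that are orthogonal to the linear span of \<open>E\<close>. For an edge \<open>E\<close> this span
  has codimension 2, and at each \<open>p \<in> E\<close> its orthogonal complement is the tangent plane of the
  2-plane through \<open>p\<close> orthogonal to \<open>E\<close>. So this 2-plane is described by the same vectors for
  every \<open>p\<close>, and the form \<open>lor\<close> is a Euclidean inner product on it.\<close>

definition unit_normals :: "'n::finite hyp set \<Rightarrow> ((real ^ 'n) \<times> real) set" where
  "unit_normals E = {w. lor w w = 1 \<and> (\<forall>p\<in>E. lor w (hvec p) = 0)}"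

text \<open>\<open>a\<close> is the direction of the ray in which the side \<open>S\<close> meets a 2-plane orthogonal to its
  edge \<open>E\<close>.\<close>

definition ray_of_side :: "'n::finite hyp set \<Rightarrow> 'n hyp set \<Rightarrow> (real ^ 'n) \<times> real \<Rightarrow> bool" where
  "ray_of_side E S a \<longleftrightarrow>
     a \<in> unit_normals E \<and> (\<exists>p\<in>E. \<exists>\<epsilon>>0. \<forall>t. 0 < t \<and> t < \<epsilon> \<longrightarrow> geodesic p a t \<in> S)"

text \<open>\<open>\<theta>\<close> is the dihedral angle of \<open>P\<close> at \<open>E\<close>. As \<open>P\<close> is convex, the angle subtended in its
  interior is the one in \<open>(0, \<pi>)\<close> between the two rays.\<close>

definition dihedral_angle :: "'n::finite hyp set \<Rightarrow> 'n hyp set \<Rightarrow> real \<Rightarrow> bool" where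
  "dihedral_angle P E \<theta> \<longleftrightarrow>
     (\<exists>S R a b. side P S \<and> side P R \<and> S \<noteq> R \<and> E = S \<inter> R \<and>
        ray_of_side E S a \<and> ray_of_side E R b \<and> \<theta> = arccos (lor a b))"

text \<open>\<open>\<alpha>\<close> is an angle from the side \<open>S\<close> to the hyperplane \<open>H\<close> at the edge \<open>E = S \<inter> R\<close> contained in
  \<open>H\<close>. The orthonormal frame \<open>a, c\<close> of the 2-plane orthogonal to \<open>E\<close> is oriented so that turning
  from the ray \<open>a\<close> of \<open>S\<close> towards \<open>c\<close> is turning towards the ray \<open>b\<close> of \<open>R\<close>, through the interior
  of the polyhedron. The vector obtained by turning \<open>a\<close> by \<open>\<alpha>\<close> has to span the line given by \<open>H\<close>,
  so \<open>\<alpha>\<close> is determined up to multiples of \<open>\<pi>\<close>.\<close>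

definition hyperplane_angle ::
    "'n::finite hyp set \<Rightarrow> 'n hyp set \<Rightarrow> 'n hyp set \<Rightarrow> 'n hyp set \<Rightarrow> real \<Rightarrow> bool" where
  "hyperplane_angle E S R H \<alpha> \<longleftrightarrow>
     (\<exists>a b c. ray_of_side E S a \<and> ray_of_side E R b \<and>
        c \<in> unit_normals E \<and> lor a c = 0 \<and> 0 < lor b c \<and>
        (\<forall>p\<in>E. \<forall>t. geodesic p (cos \<alpha> *\<^sub>R a + sin \<alpha> *\<^sub>R c) t \<in> H))"


section \<open>Side-pairings and edge chases\<close>

text \<open>The side-pairing associates to the side \<open>S\<close> the side \<open>mate S\<close> and the isometry \<open>pr S\<close>.\<close>

definition side_pairing :: "'n::finite hyp set \<Rightarrow> ('n hyp set \<Rightarrow> 'n hyp set) \<Rightarrow>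
    ('n hyp set \<Rightarrow> 'n hyp \<Rightarrow> 'n hyp) \<Rightarrow> bool" where
  "side_pairing P mate pr \<longleftrightarrow>
     (\<forall>S. side P S \<longrightarrow>
        side P (mate S) \<and> pr S \<in> carrier isom_group \<and> pr S ` S = mate S \<and>
        pr S ` interior P \<inter> interior P = {} \<and>
        mate (mate S) = S \<and> pr (mate S) = inv\<^bsub>isom_group\<^esub> (pr S))"

definition side_pairing_group :: "'n::finite hyp set \<Rightarrow>
    ('n hyp set \<Rightarrow> 'n hyp \<Rightarrow> 'n hyp) \<Rightarrow> ('n hyp \<Rightarrow> 'n hyp) set" where
  "side_pairing_group P pr = generate isom_group (pr ` {S. side P S})"

text \<open>Sequences are indexed by \<open>1, 2, \<dots>\<close>; the values at \<open>0\<close> are irrelevant.\<close>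

definition edge_chase :: "'n::finite hyp set \<Rightarrow> ('n hyp set \<Rightarrow> 'n hyp \<Rightarrow> 'n hyp) \<Rightarrow>
    (nat \<Rightarrow> 'n hyp set) \<Rightarrow> (nat \<Rightarrow> 'n hyp set) \<Rightarrow> (nat \<Rightarrow> 'n hyp set) \<Rightarrow>
    (nat \<Rightarrow> 'n hyp \<Rightarrow> 'n hyp) \<Rightarrow> bool" where
  "edge_chase P pr E S R g \<longleftrightarrow>
     (\<forall>i\<ge>1. edge P (E i) \<and> side P (S i) \<and> side P (R i) \<and> S i \<noteq> R i \<and> E i = S i \<inter> R i \<and>
        g i = pr (R i) \<and> S (i + 1) = g i ` R i \<and> E (i + 1) = g i ` E i)"

definition precisely_invariant ::
    "('a \<Rightarrow> 'a) set \<Rightarrow> ('a \<Rightarrow> 'a) set \<Rightarrow> 'a set \<Rightarrow> bool" where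
  "precisely_invariant G J A \<longleftrightarrow> (\<forall>g\<in>J. g ` A = A) \<and> (\<forall>g\<in>G - J. g ` A \<inter> A = {})"

end

theory Submission
  imports Defs
begin

text \<open>Suppose \<open>g \<in> G - J\<close> and \<open>gH\<close> meets \<open>H\<close>. By (1), \<open>H\<close> is covered by the tiles \<open>jP\<close> and \<open>gH\<close> by the
  tiles \<open>gjP\<close> with \<open>j \<in> J\<close>, and it suffices to find a tile of both kinds, since \<open>j = gj'\<close> gives \<open>g \<in> J\<close>.
  Choose a point \<open>y\<close> of \<open>L = H \<inter> gH\<close> that lies on no wall of a tile except those containing \<open>L\<close>.
  If \<open>gH = H\<close>, at most two tiles meet at \<open>y\<close>, and (2) excludes that they are of different kinds.
  Otherwise \<open>L\<close> has codimension two and every tile at \<open>y\<close> is, near \<open>y\<close>, a sector in the plane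
  orthogonal to \<open>L\<close>. If some tile is a half-space at \<open>y\<close>, only two tiles meet there, and one of
  \<open>H\<close>, \<open>gH\<close> passes through the interior of both. If not, following the edge chase through
  adjacent sectors from a tile \<open>hP\<close>, \<open>h \<in> J\<close>, runs through all tiles at \<open>y\<close> (finitely many), so it
  reaches some \<open>gjP\<close>; the angles add up along the way, and (3) forces \<open>gH = H\<close>.\<close>

section \<open>The hyperboloid\<close>

text \<open>All angles are measured around \<open>L\<close> at the single point \<open>y\<close>.
  The edges of the chase are the pull-backs of \<open>L\<close> by the tiles met on the way round,
  so each dihedral angle is the difference of two consecutive boundary angles and the sum
  telescopes. The last tile is \<open>k = gj\<close>, and its inverse carries \<open>gH\<close> back
  to \<open>H\<close>; hence the angle that (3) measures in \<open>P\<close> at the last edge is the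
  angle of \<open>gH\<close> around \<open>L\<close>. Two obstacles shape the proof. Adjacency has
  to be derived: a side-pairing only gives matched sides and disjoint interiors, and it must be
  shown that neighbours share the whole facet and lie on opposite sides of it. And \<open>L\<close>
  may run through the relative interior of a side, where there is no edge for (3) to speak about;
  being a half-space at \<open>y\<close> passes between neighbours in both directions, so a chase
  that starts in a wedge sees wedges only.\<close>

lemma lor_zero [simp]: "lor 0 u = 0" "lor u 0 = 0"
  by (simp_all add: lor_def)

lemma lor_minus [simp]: "lor (- u) v = - lor u v" "lor u (- v) = - lor u v"
  by (simp_all add: lor_def)

section \<open>Projection to the hyperboloid, chords and small displacements\<close>

lemma lor_hvec_neg: "lor (hvec p) (hvec q) < 0"
  using lor_hvec_le [of p q] by linarith

lemma cosh_dist: "cosh (dist p q) = - lor (hvec p) (hvec q)" for p q :: "'n::finite hyp"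
  unfolding dist_hyp_def using lor_hvec_le [of p q] by (intro cosh_arcosh_real) simp

lemma norm_less_of_timelike:
  fixes u :: "(real ^ 'n) \<times> real"
  assumes "lor u u < 0"
  shows "norm (fst u) < \<bar>snd u\<bar>"
proof -
  have "(norm (fst u))\<^sup>2 < (snd u)\<^sup>2"
    using assms by (simp add: lor_def dot_square_norm power2_eq_square)
  then show ?thesis
    by (metis abs_ge_zero power2_abs power_less_imp_less_base)
qed

text \<open>Vectors in opposite cones have nonnegative product, because Cauchy-Schwarz bounds the
  spatial part by the product of the time parts. So the sign of the product with one point decides
  the sheet.\<close>

lemma timelike_snd_pos:
  fixes u :: "(real ^ 'n) \<times> real"
  assumes "lor u u < 0" "lor u (hvec p) < 0"
  shows "0 < snd u"
proof (rule ccontr)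
  assume "\<not> 0 < snd u"
  then have n: "norm (fst u) < - snd u" using norm_less_of_timelike [OF assms(1)] by simp
  have m: "norm (fst (hvec p)) < snd (hvec p)"
    using norm_less_of_timelike [of "hvec p"] hvec_pos [of p] by simp
  have "- (fst u \<bullet> fst (hvec p)) \<le> norm (fst u) * norm (fst (hvec p))"
    by (metis inner_minus_left norm_cauchy_schwarz norm_minus_cancel)
  also have "\<dots> \<le> - snd u * snd (hvec p)"
    using n m norm_ge_zero [of "fst u"] norm_ge_zero [of "fst (hvec p)"]
    by (intro mult_mono; linarith)
  finally show False using assms(2) by (simp add: lor_def)
qed

text \<open>Radial projection from the origin; meaningful only in the future cone, which the
  hypotheses of \<open>hvec_proj\<close> secure.\<close>

definition proj :: "(real ^ 'n) \<times> real \<Rightarrow> 'n::finite hyp" where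
  "proj u = hpoint ((1 / sqrt (- lor u u)) *\<^sub>R u)"

lemma hvec_proj:
  fixes u :: "(real ^ 'n::finite) \<times> real"
  assumes "lor u u < 0" "lor u (hvec p) < 0"
  shows "hvec (proj u) = (1 / sqrt (- lor u u)) *\<^sub>R u"
proof -
  let ?r = "1 / sqrt (- lor u u)"
  have "?r * ?r = 1 / (- lor u u)" using assms(1) by simp
  then have "lor (?r *\<^sub>R u) (?r *\<^sub>R u) = -1" using assms(1) by (simp add: field_simps)
  moreover have "0 < snd (?r *\<^sub>R u)" using timelike_snd_pos [OF assms] assms(1) by simp
  ultimately show ?thesis unfolding proj_def by (simp add: hpoint_inverse)
qed

text \<open>A chord stays in the future cone and is rescaled back to the hyperboloid. On it
  \<open>lor u u\<close> is at most -1, so the factor is at most 1; \<open>ball_convex_comb\<close>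
  depends on this bound.\<close>

lemma convex_comb_ex:
  fixes p q :: "'n::finite hyp"
  assumes "0 \<le> t" "t \<le> 1"
  obtains s r where "0 < r" "r \<le> 1" "hvec s = r *\<^sub>R ((1 - t) *\<^sub>R hvec p + t *\<^sub>R hvec q)"
proof -
  define u where "u = (1 - t) *\<^sub>R hvec p + t *\<^sub>R hvec q"
  have *: "lor u u = - 1 + 2 * t * (1 - t) * (1 + lor (hvec p) (hvec q))"
    unfolding u_def by (simp add: lor_commute [of "hvec q" "hvec p"] algebra_simps)
  have "t * (1 - t) * (1 + lor (hvec p) (hvec q)) \<le> 0"
    using assms lor_hvec_le [of p q] by (intro mult_nonneg_nonpos) auto
  then have le: "lor u u \<le> -1" unfolding * by simp
  have "lor u (hvec p) = - (1 - t) + t * lor (hvec q) (hvec p)"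
    unfolding u_def by simp
  also have "\<dots> < 0"
  proof (cases "t = 0")
    case False
    then have "t * lor (hvec q) (hvec p) < 0"
      using lor_hvec_neg [of q p] assms by (simp add: mult_pos_neg)
    then show ?thesis using assms by linarith
  qed simp
  finally have lt: "lor u (hvec p) < 0" .
  show ?thesis
  proof
    show "hvec (proj u) = (1 / sqrt (- lor u u)) *\<^sub>R ((1 - t) *\<^sub>R hvec p + t *\<^sub>R hvec q)"
      unfolding u_def [symmetric] using le lt by (intro hvec_proj) auto
    show "0 < 1 / sqrt (- lor u u)" "1 / sqrt (- lor u u) \<le> 1"
      using le by auto
  qed
qed

text \<open>A substitute for geodesics: \<open>d\<close> need not be tangent or of unit length, and
  up to a positive factor every form \<open>lor m\<close> is affine in \<open>t\<close> along the
  curve.\<close>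

definition shift :: "'n::finite hyp \<Rightarrow> (real ^ 'n) \<times> real \<Rightarrow> real \<Rightarrow> 'n hyp" where
  "shift p d t = proj (hvec p + t *\<^sub>R d)"

lemma shift_small:
  fixes p :: "'n::finite hyp"
  assumes "0 < \<epsilon>"
  obtains \<delta> where "0 < \<delta>"
    "\<And>t. \<bar>t\<bar> < \<delta> \<Longrightarrow> dist p (shift p d t) < \<epsilon>"
    "\<And>t. \<bar>t\<bar> < \<delta> \<Longrightarrow> \<exists>r>0. hvec (shift p d t) = r *\<^sub>R (hvec p + t *\<^sub>R d)"
proof -
  let ?u = "\<lambda>t. hvec p + t *\<^sub>R d"
  have uu: "lor (?u t) (?u t) = -1 + 2 * t * lor d (hvec p) + t * t * lor d d" for t
    by (simp add: lor_commute [of "hvec p" d] algebra_simps)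
  have up: "lor (?u t) (hvec p) = -1 + t * lor d (hvec p)" for t
    by simp
  have t1: "((\<lambda>t. lor (?u t) (?u t)) \<longlongrightarrow> -1) (at 0)"
    unfolding uu by (rule tendsto_eq_intros refl | simp)+
  have t2: "((\<lambda>t. lor (?u t) (hvec p)) \<longlongrightarrow> -1) (at 0)"
    unfolding up by (rule tendsto_eq_intros refl | simp)+
  \<comment> \<open>This quotient is cosh of the distance from \<open>p\<close> to the shifted
    point, so its limit 1 gives the distance bound.\<close>
  have t3: "((\<lambda>t. - (lor (?u t) (hvec p) / sqrt (- lor (?u t) (?u t)))) \<longlongrightarrow> 1) (at 0)"
    by (rule tendsto_eq_intros t1 t2 refl | simp)+
  have "1 < cosh \<epsilon>" using assms by (simp add: cosh_real_nonneg_less_iff [of 0, simplified])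
  then have "\<forall>\<^sub>F t in at 0. - (lor (?u t) (hvec p) / sqrt (- lor (?u t) (?u t))) < cosh \<epsilon>"
    using order_tendstoD(2) [OF t3] by blast
  moreover have "\<forall>\<^sub>F t in at 0. lor (?u t) (?u t) < 0"
    using order_tendstoD(2) [OF t1, of 0] by simp
  moreover have "\<forall>\<^sub>F t in at 0. lor (?u t) (hvec p) < 0"
    using order_tendstoD(2) [OF t2, of 0] by simp
  ultimately have "\<forall>\<^sub>F t in at 0. dist p (shift p d t) < \<epsilon> \<and>
      (\<exists>r>0. hvec (shift p d t) = r *\<^sub>R (hvec p + t *\<^sub>R d))"
  proof eventually_elim
    case (elim t)
    have h: "hvec (shift p d t) = (1 / sqrt (- lor (?u t) (?u t))) *\<^sub>R ?u t"
      unfolding shift_def using elim by (intro hvec_proj [where p = p]) auto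
    have "cosh (dist p (shift p d t)) = - (lor (?u t) (hvec p) / sqrt (- lor (?u t) (?u t)))"
      unfolding cosh_dist h lor_commute [of "hvec p"] lor_bilinear(5) by simp
    then have "cosh (dist p (shift p d t)) < cosh \<epsilon>" using elim by simp
    then have "dist p (shift p d t) < \<epsilon>"
      using assms by (simp add: cosh_real_nonneg_less_iff)
    moreover have "1 / sqrt (- lor (?u t) (?u t)) > 0" using elim by simp
    ultimately show ?case using h by blast
  qed
  then obtain \<delta> where \<delta>: "\<delta> > 0" "\<And>t. t \<noteq> 0 \<Longrightarrow> \<bar>t\<bar> < \<delta> \<Longrightarrow> dist p (shift p d t) < \<epsilon> \<and>
      (\<exists>r>0. hvec (shift p d t) = r *\<^sub>R (hvec p + t *\<^sub>R d))"
    unfolding eventually_at by (auto simp: dist_real_def)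
  have "shift p d 0 = p" by (simp add: shift_def proj_def hvec_inverse)
  then have "dist p (shift p d 0) < \<epsilon> \<and> (\<exists>r>0. hvec (shift p d 0) = r *\<^sub>R (hvec p + 0 *\<^sub>R d))"
    using assms by (auto intro: exI [of _ 1])
  with \<delta> have "dist p (shift p d t) < \<epsilon> \<and>
      (\<exists>r>0. hvec (shift p d t) = r *\<^sub>R (hvec p + t *\<^sub>R d))" if "\<bar>t\<bar> < \<delta>" for t
    using that by (cases "t = 0") simp_all
  with \<delta>(1) show ?thesis using that by blast
qed

lemma hvec_geodesic:
  fixes p :: "'n::finite hyp"
  assumes "lor w (hvec p) = 0" "lor w w = 1"
  shows "hvec (geodesic p w t) = cosh t *\<^sub>R hvec p + sinh t *\<^sub>R w"
proof -
  let ?u = "cosh t *\<^sub>R hvec p + sinh t *\<^sub>R w"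
  have 1: "lor ?u ?u = -1"
    using assms hyperbolic_pythagoras [of t] by (simp add: lor_commute [of "hvec p" w] power2_eq_square algebra_simps)
  have "lor ?u (hvec p) < 0" using assms by simp
  then have "0 < snd ?u" using 1 timelike_snd_pos [of ?u p] by linarith
  with 1 show ?thesis unfolding geodesic_def by (subst hpoint_inverse) auto
qed

lemma hvec_difference:
  fixes u :: "(real ^ 'n::finite) \<times> real"
  obtains p q :: "'n hyp" and r s where "u = r *\<^sub>R hvec p - s *\<^sub>R hvec q"
proof -
  define q where "q = (hpoint (0, 1) :: 'n hyp)"
  have q: "hvec q = (0, 1)" unfolding q_def by (rule hpoint_inverse) (simp add: lor_def)
  \<comment> \<open>Large enough that adding \<open>s\<close> times the point \<open>(0, 1)\<close>
    pushes \<open>u\<close> into the future cone.\<close>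
  define s where "s = norm (fst u) + \<bar>snd u\<bar> + 1"
  define w where "w = u + s *\<^sub>R hvec q"
  have w: "fst w = fst u" "snd w = snd u + s" by (simp_all add: w_def q)
  have "norm (fst w) < snd w" using w by (simp add: s_def)
  then have "(norm (fst w))\<^sup>2 < (snd w)\<^sup>2" by (simp add: power_strict_mono)
  then have 1: "lor w w < 0" by (simp add: lor_def dot_square_norm power2_eq_square)
  have 2: "lor w (hvec q) < 0" using w \<open>norm (fst w) < snd w\<close> q
    by (simp add: lor_def) (smt (verit) norm_ge_zero)
  have "hvec (proj w) = (1 / sqrt (- lor w w)) *\<^sub>R w" using 1 2 by (rule hvec_proj)
  then have "w = sqrt (- lor w w) *\<^sub>R hvec (proj w)" using 1 by simp
  then have "u = sqrt (- lor w w) *\<^sub>R hvec (proj w) - s *\<^sub>R hvec q"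
    unfolding w_def by (simp add: algebra_simps)
  then show ?thesis using that by blast
qed

text \<open>The difference is orthogonal to all points, hence to itself by
  \<open>hvec_difference\<close>; as the form is positive definite on the complement of a point, it
  vanishes.\<close>

lemma lor_eqI:
  fixes u w :: "(real ^ 'n::finite) \<times> real"
  assumes "\<And>p. lor u (hvec p) = lor w (hvec p)"
  shows "u = w"
proof -
  have "lor (u - w) (hvec p) = 0" for p using assms by simp
  moreover from this have "lor (u - w) (u - w) = 0"
    by (metis hvec_difference lor_bilinear(4,6) mult_zero_right diff_self)
  ultimately have "u - w = 0" using lor_orthogonal_pos(2) by blast
  then show ?thesis by simp
qed

text \<open>Writing \<open>v\<close> through two points turns the form into a combination of two
  functions cosh of a distance, which are continuous in the metric.\<close>

lemma continuous_on_lor_hvec [continuous_intros]: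
  fixes v :: "(real ^ 'n::finite) \<times> real"
  shows "continuous_on A (\<lambda>p. lor v (hvec p))"
proof -
  obtain p q :: "'n hyp" and r s where v: "v = r *\<^sub>R hvec p - s *\<^sub>R hvec q"
    using hvec_difference by blast
  have "lor v (hvec x) = s * cosh (dist q x) - r * cosh (dist p x)" for x
    unfolding v by (simp add: cosh_dist)
  then show ?thesis by (simp add: continuous_intros)
qed

lemma closed_hplane: "closed (hplane v)"
proof -
  have "hplane v = (\<lambda>p. lor v (hvec p)) -` {0} \<inter> UNIV" by (auto simp: hplane_def)
  then show ?thesis
    by (metis closed_UNIV closed_singleton continuous_on_lor_hvec continuous_closed_preimage inf_commute)
qed

lemma closed_hspace: "closed (hspace v)"
proof -
  have "hspace v = UNIV \<inter> (\<lambda>p. lor v (hvec p)) -` {..0}" by (auto simp: hspace_def)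
  then show ?thesis
    by (metis closed_UNIV closed_atMost continuous_on_lor_hvec continuous_closed_preimage)
qed

text \<open>One notation for the whole space, a hyperplane and an intersection of two hyperplanes,
  so that later lemmas serve all three.\<close>

definition subspace_of :: "((real ^ 'n) \<times> real) set \<Rightarrow> 'n::finite hyp set" where
  "subspace_of U = {p. \<forall>u\<in>U. lor u (hvec p) = 0}"

lemma subspace_of_empty [simp]: "subspace_of {} = UNIV"
  and subspace_of_insert: "subspace_of (insert u U) = subspace_of U \<inter> hplane u"
  by (auto simp: subspace_of_def hplane_def)

lemma subspace_of_singleton: "subspace_of {v} = hplane v"
  by (simp add: subspace_of_insert)

lemma closed_subspace_of: "closed (subspace_of U)"
proof -
  have "subspace_of U = (\<Inter>u\<in>U. hplane u)" by (auto simp: subspace_of_def hplane_def)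
  then show ?thesis by (simp add: closed_hplane closed_INT)
qed

text \<open>A ball is a sublevel set of the nonnegative linear form \<open>- lor (hvec x)\<close>,
  and rescaling by \<open>r\<close> \<le> 1 does not increase its values.\<close>

lemma ball_convex_comb:
  fixes x :: "'n::finite hyp"
  assumes "p \<in> ball x \<epsilon>" "q \<in> ball x \<epsilon>" "0 \<le> t" "t \<le> 1" "0 < r" "r \<le> 1"
    and s: "hvec s = r *\<^sub>R ((1 - t) *\<^sub>R hvec p + t *\<^sub>R hvec q)"
  shows "s \<in> ball x \<epsilon>"
proof -
  have \<epsilon>: "0 < \<epsilon>" using assms(1) by (metis le_less_trans mem_ball zero_le_dist)
  have "- lor (hvec x) (hvec p) < cosh \<epsilon>" "- lor (hvec x) (hvec q) < cosh \<epsilon>"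
    using assms(1,2) \<epsilon> by (simp_all add: cosh_dist [symmetric] cosh_real_nonneg_less_iff)
  then have "(1 - t) * - lor (hvec x) (hvec p) + t * - lor (hvec x) (hvec q) < cosh \<epsilon>"
    using assms(3,4) convex_bound_lt [of "- lor (hvec x) (hvec p)" "cosh \<epsilon>" "- lor (hvec x) (hvec q)" "1 - t" t] by simp
  moreover define y where "y = (1 - t) * - lor (hvec x) (hvec p) + t * - lor (hvec x) (hvec q)"
  moreover have "0 \<le> y" unfolding y_def using assms(3,4) lor_hvec_neg [of x p] lor_hvec_neg [of x q]
    by (intro add_nonneg_nonneg mult_nonneg_nonneg) auto
  moreover have "cosh (dist x s) = r * y"
    unfolding cosh_dist s y_def by (simp add: algebra_simps)
  ultimately have "cosh (dist x s) < cosh \<epsilon>"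
    using assms(5,6) by (smt (verit) mult_left_le_one_le)
  then show ?thesis using \<epsilon> by (simp add: cosh_real_nonneg_less_iff)
qed

lemma lor_zero_in_ball:
  fixes x :: "'n::finite hyp"
  assumes "p \<in> subspace_of U \<inter> ball x \<epsilon>" "q \<in> subspace_of U \<inter> ball x \<epsilon>"
    and "lor w (hvec p) < 0" "0 \<le> lor w (hvec q)"
  obtains s where "s \<in> subspace_of U \<inter> ball x \<epsilon>" "lor w (hvec s) = 0"
proof -
  define A B where "A = lor w (hvec p)" "B = lor w (hvec q)"
  \<comment> \<open>The zero of the affine function with value \<open>A\<close> at 0 and
    \<open>B\<close> at 1.\<close>
  define t where "t = - A / (B - A)"
  have t: "0 \<le> t" "t \<le> 1" "(1 - t) * A + t * B = 0"
    using assms(3,4) unfolding t_def A_B_def [symmetric] by (simp_all add: field_simps)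
  obtain s r where s: "0 < r" "r \<le> 1" "hvec s = r *\<^sub>R ((1 - t) *\<^sub>R hvec p + t *\<^sub>R hvec q)"
    using convex_comb_ex [OF t(1,2), of p q] by blast
  have "s \<in> ball x \<epsilon>" using ball_convex_comb [of p x \<epsilon> q] assms(1,2) t s by blast
  moreover have "s \<in> subspace_of U" using assms(1,2) s(3) by (simp add: subspace_of_def)
  moreover have "lor w (hvec s) = 0" using t(3) s(3) by (simp add: A_B_def)
  ultimately show ?thesis using that by blast
qed

lemma subspace_shift:
  assumes "p \<in> subspace_of U" "\<And>u. u \<in> U \<Longrightarrow> lor u d = 0" "hvec q = r *\<^sub>R (hvec p + t *\<^sub>R d)"
  shows "q \<in> subspace_of U"
  using assms by (simp add: subspace_of_def)

text \<open>From \<open>p\<close> one can move a little towards any point \<open>q\<close> of the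
  subspace without leaving \<open>W\<close>; linearity then transfers the vanishing of
  \<open>lor v\<close> to \<open>q\<close>.\<close>

lemma hyperplane_contains:
  assumes "p \<in> subspace_of U" "p \<in> W" "open W" "subspace_of U \<inter> W \<subseteq> hplane v"
  shows "subspace_of U \<subseteq> hplane v"
proof
  fix q assume q: "q \<in> subspace_of U"
  obtain \<epsilon> where \<epsilon>: "\<epsilon> > 0" "ball p \<epsilon> \<subseteq> W" using assms(2,3) openE by blast
  obtain \<delta> where \<delta>: "0 < \<delta>" "\<And>t. \<bar>t\<bar> < \<delta> \<Longrightarrow> dist p (shift p (hvec q) t) < \<epsilon>"
    "\<And>t. \<bar>t\<bar> < \<delta> \<Longrightarrow> \<exists>r>0. hvec (shift p (hvec q) t) = r *\<^sub>R (hvec p + t *\<^sub>R hvec q)"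
    using shift_small [OF \<epsilon>(1)] by blast
  define t where "t = \<delta> / 2"
  have t: "0 < t" "\<bar>t\<bar> < \<delta>" using \<delta>(1) by (auto simp: t_def)
  obtain r where r: "r > 0" "hvec (shift p (hvec q) t) = r *\<^sub>R (hvec p + t *\<^sub>R hvec q)"
    using \<delta>(3) t by blast
  have "shift p (hvec q) t \<in> subspace_of U"
    using assms(1) r(2) q by (simp add: subspace_of_def)
  then have "lor v (hvec (shift p (hvec q) t)) = 0"
    using \<delta>(2) [OF t(2)] \<epsilon>(2) assms(4) by (auto simp: hplane_def)
  moreover have "lor v (hvec p) = 0" using assms(1,2,4) by (auto simp: hplane_def)
  ultimately have "lor v (hvec q) = 0" using r t by simp
  then show "q \<in> hplane v" by (simp add: hplane_def)
qed

text \<open>A displacement of \<open>y\<close> in the direction \<open>u\<close> stays in the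
  subspace, so \<open>lor u u = 0\<close>. Applied to what remains of a normal after subtracting its
  components along \<open>U\<close>, this shows that the normal lies in the span.\<close>

lemma orthogonal_subspace_zero:
  assumes "y \<in> subspace_of U" "subspace_of U \<subseteq> hplane u" "\<And>b. b \<in> U \<Longrightarrow> lor b u = 0"
  shows "u = 0"
proof -
  have y: "lor u (hvec y) = 0" using assms(1,2) by (auto simp: hplane_def)
  obtain \<delta> where \<delta>: "0 < \<delta>"
    "\<And>t. \<bar>t\<bar> < \<delta> \<Longrightarrow> \<exists>r>0. hvec (shift y u t) = r *\<^sub>R (hvec y + t *\<^sub>R u)"
    using shift_small [of 1 y u] zero_less_one by metis
  obtain r where r: "r > 0" "hvec (shift y u (\<delta>/2)) = r *\<^sub>R (hvec y + (\<delta>/2) *\<^sub>R u)"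
    using \<delta>(2) [of "\<delta>/2"] \<delta>(1) by auto
  have "shift y u (\<delta>/2) \<in> subspace_of U" using subspace_shift assms(1,3) r(2) by blast
  then have "lor u (hvec (shift y u (\<delta>/2))) = 0" using assms(2) by (auto simp: hplane_def)
  then have "lor u u = 0" using r y \<delta>(1) by simp
  then show ?thesis using y lor_orthogonal_pos(2) by blast
qed

lemma hplane_subset_parallel:
  assumes "y \<in> hplane v" "hplane v \<subseteq> hplane w" "0 < lor v v"
  shows "w = (lor w v / lor v v) *\<^sub>R v"
proof -
  have "w - (lor w v / lor v v) *\<^sub>R v = 0"
  proof (rule orthogonal_subspace_zero [of y "{v}"])
    show "subspace_of {v} \<subseteq> hplane (w - (lor w v / lor v v) *\<^sub>R v)"
      using assms(2) by (auto simp: subspace_of_singleton hplane_def)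
  qed (use assms in \<open>auto simp: subspace_of_singleton lor_commute\<close>)
  then show ?thesis by simp
qed

lemma hplane_scaleR: "c \<noteq> 0 \<Longrightarrow> hplane (c *\<^sub>R v) = hplane v"
  by (simp add: hplane_def)

lemma hplane_uminus [simp]: "hplane (- v) = hplane v"
  by (simp add: hplane_def)

text \<open>Removing from a point its component along the space-like \<open>v\<close> leaves a
  vector that is still in the future cone.\<close>

lemma hplane_nonempty:
  fixes v :: "(real ^ 'n::finite) \<times> real"
  assumes "0 < lor v v"
  shows "hplane v \<noteq> {}"
proof -
  obtain q :: "'n hyp" where True by simp
  define c where "c = lor v (hvec q) / lor v v"
  define u where "u = hvec q - c *\<^sub>R v"
  have c: "lor v u = 0" using assms by (simp add: u_def c_def)
  have "lor u u = -1 - c * lor v (hvec q)"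
    using c unfolding u_def by (simp add: lor_commute algebra_simps)
  moreover have "c * lor v (hvec q) \<ge> 0" using assms by (simp add: c_def)
  ultimately have "lor u u < 0" by linarith
  moreover have "lor u (hvec q) = -1 - c * lor v (hvec q)" by (simp add: u_def)
  ultimately have "hvec (proj u) = (1 / sqrt (- lor u u)) *\<^sub>R u"
    using \<open>c * lor v (hvec q) \<ge> 0\<close> by (intro hvec_proj [where p = q]) auto
  then have "lor v (hvec (proj u)) = 0" using c by simp
  then show ?thesis by (auto simp: hplane_def)
qed

section \<open>Isometries are linear\<close>

lemma isomD:
  assumes "f \<in> carrier isom_group"
  shows "bij f" "dist (f p) (f q) = dist p q" "lor (hvec (f p)) (hvec (f q)) = lor (hvec p) (hvec q)"
proof -
  show d: "dist (f p) (f q) = dist p q" for p q using assms by (simp add: isom_group_def)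
  then have "inj f" by (metis dist_eq_0_iff injI)
  then show "bij f" using assms by (simp add: isom_group_def bij_def)
  show "lor (hvec (f p)) (hvec (f q)) = lor (hvec p) (hvec q)"
    using cosh_dist [of "f p" "f q"] cosh_dist [of p q] d by simp
qed

lemma inv_isom_group:
  assumes "f \<in> carrier isom_group"
  shows "inv\<^bsub>isom_group\<^esub> f = inv_into UNIV f"
proof -
  interpret group isom_group by (rule group_isom_group)
  have "f \<circ> inv\<^bsub>isom_group\<^esub> f = id"
    using r_inv [OF assms] by (simp add: isom_group_def)
  moreover have "inv_into UNIV f \<circ> f = id" using isomD(1) [OF assms] by (simp add: bij_def)
  ultimately show ?thesis by (metis comp_assoc comp_id id_comp)
qed

lemma isom_group_inv_into:
  "f \<in> carrier isom_group \<Longrightarrow> inv_into UNIV f \<in> carrier isom_group"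
  using group.inv_closed [OF group_isom_group] inv_isom_group by metis

lemma isom_image_inv:
  assumes "f \<in> carrier isom_group"
  shows "p \<in> f ` A \<longleftrightarrow> inv_into UNIV f p \<in> A"
proof -
  have "inj f" "surj f" using isomD(1) [OF assms] by (auto simp: bij_def)
  then show ?thesis
    using inj_image_mem_iff [of f "inv_into UNIV f p" A] by (simp add: surj_f_inv_f)
qed

lemma isom_image_Int:
  "f \<in> carrier isom_group \<Longrightarrow> f ` (A \<inter> B) = f ` A \<inter> f ` B"
  using isomD(1) [of f] by (simp add: bij_is_inj image_Int)

lemma isom_image_ball:
  assumes "f \<in> carrier isom_group"
  shows "f ` ball x r = ball (f x) r"
proof -
  have "dist (f x) y < r \<Longrightarrow> y \<in> f ` ball x r" for y
    using isomD(2) [OF assms, of x "inv_into UNIV f y"] isomD(1) [OF assms]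
    by (simp add: isom_image_inv [OF assms] bij_is_surj surj_f_inv_f)
  then show ?thesis using isomD(2) [OF assms] by auto
qed

lemma isom_image_interior:
  assumes "f \<in> carrier isom_group"
  shows "interior (f ` A) = f ` interior A"
proof -
  have *: "interior (f ` A) \<supseteq> f ` interior A" if "f \<in> carrier isom_group" for f :: "'a hyp \<Rightarrow> 'a hyp" and A
  proof
    fix y assume "y \<in> f ` interior A"
    then obtain x e where x: "y = f x" "e > 0" "ball x e \<subseteq> A" by (auto simp: mem_interior)
    then have "ball y e \<subseteq> f ` A" using isom_image_ball [OF that, of x e] by blast
    then show "y \<in> interior (f ` A)" using x mem_interior by blast
  qed
  have "inv_into UNIV f ` interior (f ` A) \<subseteq> interior (inv_into UNIV f ` (f ` A))"
    using * [OF isom_group_inv_into [OF assms]] .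
  also have "inv_into UNIV f ` (f ` A) = A"
    using isomD(1) [OF assms] by (simp add: bij_is_inj image_inv_f_f)
  finally have "f ` (inv_into UNIV f ` interior (f ` A)) \<subseteq> f ` interior A" by blast
  then have "interior (f ` A) \<subseteq> f ` interior A"
    using isomD(1) [OF assms] by (simp add: bij_is_surj image_f_inv_f)
  with * [OF assms] show ?thesis by blast
qed

text \<open>The linear extension of \<open>f\<close> to Minkowski space. It is specified by its
  pairings with the points of the hyperboloid, which determine a vector by
  \<open>lor_eqI\<close>.\<close>

definition lin :: "('n::finite hyp \<Rightarrow> 'n hyp) \<Rightarrow> (real ^ 'n) \<times> real \<Rightarrow> (real ^ 'n) \<times> real" where
  "lin f u = (THE w. \<forall>q. lor w (hvec (f q)) = lor u (hvec q))"

context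
  fixes f :: "'n::finite hyp \<Rightarrow> 'n hyp"
  assumes f: "f \<in> carrier isom_group"
begin

lemma lin_unique:
  assumes "\<And>q. lor w (hvec (f q)) = lor u (hvec q)" "\<And>q. lor w' (hvec (f q)) = lor u (hvec q)"
  shows "w = w'"
proof (rule lor_eqI)
  fix p
  obtain q where "p = f q" using isomD(1) [OF f] by (metis bij_pointE)
  then show "lor w (hvec p) = lor w' (hvec p)" using assms by simp
qed

lemma lor_lin_hvec: "lor (lin f u) (hvec (f q)) = lor u (hvec q)"
proof -
  obtain x y :: "'n hyp" and r s where u: "u = r *\<^sub>R hvec x - s *\<^sub>R hvec y"
    using hvec_difference by blast
  have "\<forall>q. lor (r *\<^sub>R hvec (f x) - s *\<^sub>R hvec (f y)) (hvec (f q)) = lor u (hvec q)"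
    using isomD(3) [OF f] by (simp add: u)
  then have "\<exists>!w. \<forall>q. lor w (hvec (f q)) = lor u (hvec q)"
    using lin_unique [of _ u] by blast
  from theI' [OF this] show ?thesis unfolding lin_def by blast
qed

lemma lin_eqI:
  assumes "\<And>q. lor w (hvec (f q)) = lor u (hvec q)"
  shows "lin f u = w"
  using lin_unique lor_lin_hvec assms by blast

lemma lin_hvec: "lin f (hvec p) = hvec (f p)"
  by (rule lin_eqI) (simp add: isomD(3) [OF f])

lemma lin_linear:
  "lin f (u + w) = lin f u + lin f w" "lin f (u - w) = lin f u - lin f w"
  "lin f (- u) = - lin f u" "lin f (r *\<^sub>R u) = r *\<^sub>R lin f u" "lin f 0 = 0"
  by (rule lin_eqI; simp add: lor_lin_hvec)+

lemma lor_lin: "lor (lin f u) (lin f w) = lor u w"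
proof -
  obtain x y :: "'n hyp" and r s where w: "w = r *\<^sub>R hvec x - s *\<^sub>R hvec y"
    using hvec_difference by blast
  show ?thesis unfolding w by (simp add: lin_linear lin_hvec lor_lin_hvec)
qed

lemma isom_image_hplane: "f ` hplane v = hplane (lin f v)"
proof -
  have "p \<in> hplane (lin f v) \<Longrightarrow> p \<in> f ` hplane v" for p
    using isomD(1) [OF f] lor_lin_hvec unfolding hplane_def by (metis bij_pointE imageI mem_Collect_eq)
  then show ?thesis by (auto simp: hplane_def lor_lin_hvec)
qed

lemma isom_geodesic:
  assumes "lor w (hvec p) = 0" "lor w w = 1"
  shows "f (geodesic p w t) = geodesic (f p) (lin f w) t"
proof -
  have "hvec (f (geodesic p w t)) = hvec (geodesic (f p) (lin f w) t)"
  proof -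
    have "hvec (f (geodesic p w t)) = lin f (hvec (geodesic p w t))"
      by (simp add: lin_hvec)
    also have "\<dots> = cosh t *\<^sub>R hvec (f p) + sinh t *\<^sub>R lin f w"
      by (simp add: hvec_geodesic assms lin_linear lin_hvec)
    also have "\<dots> = hvec (geodesic (f p) (lin f w) t)"
      using assms by (simp add: hvec_geodesic lor_lin_hvec lor_lin)
    finally show ?thesis .
  qed
  then show ?thesis by (simp add: hvec_inject)
qed

end

section \<open>Polyhedra\<close>

lemma defining_normals_spacelike:
  "defining_normals X Q N \<Longrightarrow> v \<in> N \<Longrightarrow> 0 < lor v v"
  by (simp add: defining_normals_def hplane_normal_in_def)

lemma defining_normals_mem:
  "defining_normals X Q N \<Longrightarrow> p \<in> Q \<longleftrightarrow> p \<in> X \<and> (\<forall>v\<in>N. lor v (hvec p) \<le> 0)"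
  by (auto simp: defining_normals_def hspace_def)

lemma defining_normals_finite:
  assumes "defining_normals X Q N" "x \<in> X"
  obtains \<epsilon> where "0 < \<epsilon>" "finite {K \<in> (\<lambda>v. X \<inter> hplane v) ` N. K \<inter> ball x \<epsilon> \<noteq> {}}"
proof -
  obtain V where V: "openin (top_of_set X) V" "x \<in> V"
    "finite {K \<in> (\<lambda>v. X \<inter> hplane v) ` N. K \<inter> V \<noteq> {}}"
    using assms unfolding defining_normals_def locally_finite_in_def by force
  then obtain \<epsilon> where \<epsilon>: "\<epsilon> > 0" "ball x \<epsilon> \<inter> X \<subseteq> V"
    unfolding openin_contains_ball by blast
  have "{K \<in> (\<lambda>v. X \<inter> hplane v) ` N. K \<inter> ball x \<epsilon> \<noteq> {}} \<subseteq> {K \<in> (\<lambda>v. X \<inter> hplane v) ` N. K \<inter> V \<noteq> {}}"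
    using \<epsilon>(2) by blast
  then show ?thesis using that \<epsilon>(1) V(3) finite_subset by blast
qed

text \<open>\<open>N\<close> may be infinite, but near \<open>x\<close> only finitely many walls
  occur, and those missing \<open>x\<close> form a closed set. A constraint that is strict at
  \<open>x\<close> and fails nearby would vanish somewhere in between, on a wall that the ball
  avoids.\<close>

lemma defining_normals_local:
  assumes "defining_normals (subspace_of U) Q N" "x \<in> subspace_of U"
  obtains \<epsilon> where "0 < \<epsilon>"
    "\<And>w p. w \<in> N \<Longrightarrow> lor w (hvec x) < 0 \<Longrightarrow> p \<in> subspace_of U \<Longrightarrow> p \<in> ball x \<epsilon> \<Longrightarrow> lor w (hvec p) < 0"
proof -
  let ?X = "subspace_of U"
  obtain \<epsilon>0 where \<epsilon>0: "0 < \<epsilon>0" "finite {K \<in> (\<lambda>v. ?X \<inter> hplane v) ` N. K \<inter> ball x \<epsilon>0 \<noteq> {}}"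
    using defining_normals_finite [OF assms] by blast
  define F where "F = {K \<in> (\<lambda>v. ?X \<inter> hplane v) ` N. K \<inter> ball x \<epsilon>0 \<noteq> {} \<and> x \<notin> K}"
  have "finite F" unfolding F_def by (rule finite_subset [OF _ \<epsilon>0(2)]) blast
  moreover have "closed K" if "K \<in> F" for K
    using that closed_subspace_of closed_hplane unfolding F_def by blast
  ultimately have "open (ball x \<epsilon>0 - \<Union>F)" by (simp add: closed_Union open_Diff)
  moreover have "x \<in> ball x \<epsilon>0 - \<Union>F" using \<epsilon>0(1) by (auto simp: F_def)
  ultimately obtain \<epsilon> where \<epsilon>: "0 < \<epsilon>" "ball x \<epsilon> \<subseteq> ball x \<epsilon>0 - \<Union>F" by (meson openE)
  show ?thesis
  proof (rule that [OF \<epsilon>(1)], rule ccontr)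
    fix w p assume w: "w \<in> N" "lor w (hvec x) < 0" and p: "p \<in> ?X" "p \<in> ball x \<epsilon>" and "\<not> lor w (hvec p) < 0"
    then obtain s where s: "s \<in> ?X \<inter> ball x \<epsilon>" "lor w (hvec s) = 0"
      using lor_zero_in_ball [of x U x \<epsilon> p w] assms(2) \<epsilon>(1) by auto
    then have "?X \<inter> hplane w \<in> F"
      using w(1,2) \<epsilon>(2) by (auto simp: F_def hplane_def)
    then show False using s \<epsilon>(2) by (auto simp: hplane_def)
  qed
qed

text \<open>For an interior point, moving in the direction of the space-like normal \<open>v\<close>
  increases \<open>lor v\<close> and must still stay inside, so the inequality is strict.\<close>

lemma interior_polyhedron:
  assumes "defining_normals UNIV Q N"
  shows "x \<in> interior Q \<longleftrightarrow> (\<forall>v\<in>N. lor v (hvec x) < 0)"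
proof
  assume "\<forall>v\<in>N. lor v (hvec x) < 0"
  then obtain \<epsilon> where \<epsilon>: "0 < \<epsilon>" "\<And>w p. w \<in> N \<Longrightarrow> p \<in> ball x \<epsilon> \<Longrightarrow> lor w (hvec p) < 0"
    using defining_normals_local [of "{}" Q N x] assms by auto
  then have "ball x \<epsilon> \<subseteq> Q" using defining_normals_mem [OF assms] by (meson UNIV_I less_imp_le subsetI)
  then show "x \<in> interior Q" using \<epsilon>(1) mem_interior by blast
next
  assume x: "x \<in> interior Q"
  then obtain \<epsilon> where \<epsilon>: "0 < \<epsilon>" "ball x \<epsilon> \<subseteq> Q" using mem_interior by blast
  show "\<forall>v\<in>N. lor v (hvec x) < 0"
  proof
    fix v assume v: "v \<in> N"
    obtain \<delta> where \<delta>: "0 < \<delta>" "\<And>t. \<bar>t\<bar> < \<delta> \<Longrightarrow> dist x (shift x v t) < \<epsilon>"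
      "\<And>t. \<bar>t\<bar> < \<delta> \<Longrightarrow> \<exists>r>0. hvec (shift x v t) = r *\<^sub>R (hvec x + t *\<^sub>R v)"
      using shift_small [OF \<epsilon>(1)] by blast
    define t where "t = \<delta> / 2"
    have t: "0 < t" "\<bar>t\<bar> < \<delta>" using \<delta>(1) by (auto simp: t_def)
    obtain r where r: "r > 0" "hvec (shift x v t) = r *\<^sub>R (hvec x + t *\<^sub>R v)"
      using \<delta>(3) t by blast
    have "shift x v t \<in> Q" using \<delta>(2) [OF t(2)] \<epsilon>(2) by auto
    then have "r * (lor v (hvec x) + t * lor v v) \<le> 0"
      using v defining_normals_mem [OF assms] r(2) by force
    then have "lor v (hvec x) + t * lor v v \<le> 0" using r(1) by (simp add: mult_le_0_iff)
    moreover have "0 < t * lor v v" using t defining_normals_spacelike [OF assms v] by simp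
    ultimately show "lor v (hvec x) < 0" by linarith
  qed
qed

lemma relint_face:
  assumes "defining_normals (subspace_of U) Q N" "z \<in> Q" "lor v (hvec z) = 0"
    and "\<And>w. w \<in> N \<Longrightarrow> lor w (hvec z) < 0 \<or> subspace_of U \<inter> hplane w = subspace_of U \<inter> hplane v"
  obtains \<epsilon> where "0 < \<epsilon>" "subspace_of U \<inter> hplane v \<inter> ball z \<epsilon> \<subseteq> Q"
proof -
  have z: "z \<in> subspace_of U" using assms(1,2) defining_normals_mem by blast
  obtain \<epsilon> where \<epsilon>: "0 < \<epsilon>"
    "\<And>w p. w \<in> N \<Longrightarrow> lor w (hvec z) < 0 \<Longrightarrow> p \<in> subspace_of U \<Longrightarrow> p \<in> ball z \<epsilon> \<Longrightarrow> lor w (hvec p) < 0"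
    using defining_normals_local [OF assms(1) z] by blast
  have "p \<in> Q" if p: "p \<in> subspace_of U \<inter> hplane v" "p \<in> ball z \<epsilon>" for p
  proof -
    have "lor w (hvec p) \<le> 0" if "w \<in> N" for w
    proof (cases "lor w (hvec z) < 0")
      case False
      then have "p \<in> hplane w" using assms(4) that p by blast
      then show ?thesis by (simp add: hplane_def)
    qed (use \<epsilon>(2) that p in \<open>simp add: less_imp_le\<close>)
    then show ?thesis using p defining_normals_mem [OF assms(1)] by blast
  qed
  then show ?thesis using that \<epsilon>(1) by blast
qed

text \<open>A working criterion for sides: \<open>z\<close> witnesses the relative interior, and
  \<open>z0\<close> shows that the polyhedron is not contained in the wall.\<close>

lemma side_onI:
  assumes N: "defining_normals (subspace_of U) Q N" and v: "v \<in> N"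
    and z: "z \<in> Q" "lor v (hvec z) = 0"
    and strict: "\<And>w. w \<in> N \<Longrightarrow> lor w (hvec z) < 0 \<or> subspace_of U \<inter> hplane w = subspace_of U \<inter> hplane v"
    and z0: "z0 \<in> Q" "lor v (hvec z0) < 0"
  shows "side_on (subspace_of U) Q (subspace_of U \<inter> hplane v) (Q \<inter> hplane v)"
proof -
  let ?X = "subspace_of U" and ?S = "Q \<inter> hplane v"
  let ?Y = "?X \<inter> hplane v"
  have QX: "Q \<subseteq> ?X" using N defining_normals_mem by blast
  have mem: "p \<in> Q \<longleftrightarrow> p \<in> ?X \<and> (\<forall>v\<in>N. lor v (hvec p) \<le> 0)" for p
    using defining_normals_mem [OF N] .
  have "q \<in> top_of_set ?X frontier_of Q" if q: "q \<in> ?S" for q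
  proof -
    have "q \<notin> top_of_set ?X interior_of Q"
    proof
      assume "q \<in> top_of_set ?X interior_of Q"
      then obtain T where T: "openin (top_of_set ?X) T" "q \<in> T" "T \<subseteq> Q"
        unfolding interior_of_def by blast
      then obtain \<epsilon> where \<epsilon>: "\<epsilon> > 0" "ball q \<epsilon> \<inter> ?X \<subseteq> T" unfolding openin_contains_ball by blast
      \<comment> \<open>Moving away from \<open>z0\<close> crosses the wall of \<open>v\<close>, so
        no neighbourhood of \<open>q\<close> is contained in \<open>Q\<close>.\<close>
      obtain \<delta> where \<delta>: "0 < \<delta>" "\<And>t. \<bar>t\<bar> < \<delta> \<Longrightarrow> dist q (shift q (- hvec z0) t) < \<epsilon>"
        "\<And>t. \<bar>t\<bar> < \<delta> \<Longrightarrow> \<exists>r>0. hvec (shift q (- hvec z0) t) = r *\<^sub>R (hvec q + t *\<^sub>R (- hvec z0))"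
        using shift_small [OF \<epsilon>(1)] by blast
      define t where "t = \<delta> / 2"
      have t: "0 < t" "\<bar>t\<bar> < \<delta>" using \<delta>(1) by (auto simp: t_def)
      obtain r where r: "r > 0" "hvec (shift q (- hvec z0) t) = r *\<^sub>R (hvec q + t *\<^sub>R (- hvec z0))"
        using \<delta>(3) t by blast
      have "shift q (- hvec z0) t \<in> ?X"
        using r(2) q z0 QX by (auto simp: subspace_of_def subset_eq)
      then have "shift q (- hvec z0) t \<in> Q" using \<delta>(2) [OF t(2)] \<epsilon>(2) T(3) by auto
      then have "lor v (hvec (shift q (- hvec z0) t)) \<le> 0" using mem v by blast
      moreover have "lor v (hvec q) = 0" using q by (simp add: hplane_def)
      ultimately have "r * (t * lor v (hvec z0)) \<ge> 0" using r by simp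
      then show False using r(1) t(1) z0(2) by (simp add: zero_le_mult_iff)
    qed
    moreover have "q \<in> top_of_set ?X closure_of Q"
      using q QX closure_of_subset [of Q "top_of_set ?X"] by (simp add: subset_eq)
    ultimately show ?thesis by (simp add: frontier_of_def)
  qed
  moreover have "q \<in> top_of_set ?Y closure_of (top_of_set ?Y interior_of ?S)" if q: "q \<in> ?S" for q
    unfolding in_closure_of
  proof (intro conjI allI impI)
    show "q \<in> topspace (top_of_set ?Y)" using q QX by auto
    fix T assume T: "q \<in> T \<and> openin (top_of_set ?Y) T"
    then obtain \<epsilon> where \<epsilon>: "\<epsilon> > 0" "ball q \<epsilon> \<inter> ?Y \<subseteq> T" unfolding openin_contains_ball by blast
    \<comment> \<open>Points on the chord from \<open>q\<close> to \<open>z\<close> other than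
      \<open>q\<close> inherit the strict inequalities of \<open>z\<close>; so \<open>q\<close> is a
      limit of relative interior points.\<close>
    define d where "d = hvec z - hvec q"
    obtain \<delta> where \<delta>: "0 < \<delta>" "\<And>t. \<bar>t\<bar> < \<delta> \<Longrightarrow> dist q (shift q d t) < \<epsilon>"
        "\<And>t. \<bar>t\<bar> < \<delta> \<Longrightarrow> \<exists>r>0. hvec (shift q d t) = r *\<^sub>R (hvec q + t *\<^sub>R d)"
        using shift_small [OF \<epsilon>(1)] by blast
    define t where "t = min \<delta> 1 / 2"
    have t: "0 < t" "\<bar>t\<bar> < \<delta>" "t < 1" using \<delta>(1) by (auto simp: t_def)
    obtain r where r: "r > 0" "hvec (shift q d t) = r *\<^sub>R (hvec q + t *\<^sub>R d)"
      using \<delta>(3) t by blast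
    let ?y = "shift q d t"
    have l: "lor w (hvec ?y) = r * ((1 - t) * lor w (hvec q) + t * lor w (hvec z))" for w
      by (subst r(2)) (simp add: d_def algebra_simps)
    have yX: "?y \<in> ?X" using q z QX l by (auto simp: subspace_of_def subset_eq)
    moreover have yv: "lor v (hvec ?y) = 0" using q z(2) l by (simp add: hplane_def)
    ultimately have "?y \<in> T" using \<delta>(2) [OF t(2)] \<epsilon>(2) by (auto simp: hplane_def)
    have st: "lor w (hvec ?y) < 0" if w: "w \<in> N" "lor w (hvec z) < 0" for w
    proof -
      have "lor w (hvec q) \<le> 0" using w q mem by blast
      then have "(1 - t) * lor w (hvec q) \<le> 0" using t by (simp add: mult_nonneg_nonpos)
      moreover have "t * lor w (hvec z) < 0" using t w by (simp add: mult_pos_neg)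
      ultimately show ?thesis unfolding l using r(1) by (simp add: mult_pos_neg)
    qed
    have le: "lor w (hvec ?y) < 0 \<or> ?X \<inter> hplane w = ?X \<inter> hplane v" if "w \<in> N" for w
      using strict [OF that] st [OF that] by blast
    moreover have yY: "?y \<in> ?X \<inter> hplane v" using yX yv by (simp add: hplane_def)
    ultimately have "lor w (hvec ?y) \<le> 0" if "w \<in> N" for w
    proof (cases "lor w (hvec ?y) < 0")
      case False
      then have "?y \<in> hplane w" using le [OF that] yY by blast
      then show ?thesis by (simp add: hplane_def)
    qed simp
    then have yQ: "?y \<in> Q" using mem yX by blast
    obtain e where e: "0 < e" "?X \<inter> hplane v \<inter> ball ?y e \<subseteq> Q"
      using relint_face [OF N yQ yv le] by blast
    have "?y \<in> top_of_set ?Y interior_of ?S"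
      unfolding interior_of_def mem_Collect_eq
    proof (intro exI conjI)
      show "openin (top_of_set ?Y) (?Y \<inter> ball ?y e)" by (simp add: openin_open_Int)
      show "?y \<in> ?Y \<inter> ball ?y e" using yX yv e(1) by (simp add: hplane_def)
      show "?Y \<inter> ball ?y e \<subseteq> ?S" using e(2) by blast
    qed
    with \<open>?y \<in> T\<close> show "\<exists>y. y \<in> top_of_set ?Y interior_of ?S \<and> y \<in> T" by blast
  qed
  moreover have "top_of_set ?Y closure_of (top_of_set ?Y interior_of ?S) \<subseteq> ?S"
  proof (rule closure_of_minimal)
    show "top_of_set ?Y interior_of ?S \<subseteq> ?S" by (rule interior_of_subset)
    have "?S = ?Y \<inter> (\<Inter>v\<in>N. hspace v)"
      using mem by (auto simp: hspace_def)
    then show "closedin (top_of_set ?Y) ?S"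
      by (metis closed_INT closed_hspace closedin_closed_Int)
  qed
  moreover have "?S = Q \<inter> ?Y" using QX by blast
  moreover have "?S \<noteq> {}" using z by (auto simp: hplane_def)
  ultimately show ?thesis unfolding side_on_def using N v by blast
qed

lemma eventually_shift:
  fixes p :: "'n::finite hyp"
  assumes "0 < \<epsilon>"
  shows "\<forall>\<^sub>F t in at_right 0. shift p d t \<in> ball p \<epsilon> \<and>
    (\<exists>r>0. hvec (shift p d t) = r *\<^sub>R (hvec p + t *\<^sub>R d))"
proof -
  obtain \<delta> where "0 < \<delta>" "\<And>t. \<bar>t\<bar> < \<delta> \<Longrightarrow> dist p (shift p d t) < \<epsilon>"
    "\<And>t. \<bar>t\<bar> < \<delta> \<Longrightarrow> \<exists>r>0. hvec (shift p d t) = r *\<^sub>R (hvec p + t *\<^sub>R d)"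
    using shift_small [OF assms] by blast
  then show ?thesis
    unfolding eventually_at_right_field by (intro exI [of _ \<delta>]) auto
qed

text \<open>The factor \<open>r\<close> is the same for all forms vanishing at \<open>p\<close>, so
  the signs of all of them after the shift are read off from \<open>d\<close> at once.\<close>

lemma eventually_shift_lor:
  fixes p :: "'n::finite hyp"
  shows "\<forall>\<^sub>F t in at_right 0. \<exists>r>0. \<forall>m. lor m (hvec p) = 0 \<longrightarrow> lor m (hvec (shift p d t)) = r * lor m d"
  using eventually_shift [of 1 p d, OF zero_less_one] eventually_at_right_less [of "0::real"]
proof eventually_elim
  case (elim t)
  then obtain r where r: "r > 0" "hvec (shift p d t) = r *\<^sub>R (hvec p + t *\<^sub>R d)" by blast
  show ?case by (rule exI [of _ "r * t"]) (use r elim in \<open>simp add: algebra_simps\<close>)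
qed

lemma eventually_at_right_ex:
  assumes "\<forall>\<^sub>F t in at_right (0::real). Q t"
  obtains t where "Q t"
  using eventually_happens [OF assms] by auto

section \<open>Tessellations\<close>

text \<open>\<open>disjoint\<close> yields equality of group elements, not just of tiles; this is
  how finding a common tile becomes an equation in \<open>G\<close>.\<close>

locale tessellation =
  fixes P :: "'n::finite hyp set" and N :: "((real ^ 'n) \<times> real) set" and G :: "('n hyp \<Rightarrow> 'n hyp) set"
  assumes subgroup: "subgroup G isom_group"
    and normals: "defining_normals UNIV P N"
    and interior_nonempty: "interior P \<noteq> {}"
    and locally_finite: "locally_finite_in euclidean ((\<lambda>g. g ` P) ` G)"
    and disjoint: "\<And>g h. g \<in> G \<Longrightarrow> h \<in> G \<Longrightarrow> interior (g ` P) \<inter> interior (h ` P) \<noteq> {} \<Longrightarrow> g = h"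
begin

lemma isom [simp]: "g \<in> G \<Longrightarrow> g \<in> carrier isom_group"
  by (rule subgroup.mem_carrier [OF subgroup])

lemma comp_closed: "g \<in> G \<Longrightarrow> h \<in> G \<Longrightarrow> g \<circ> h \<in> G"
  using subgroup.m_closed [OF subgroup] by (simp add: isom_group_def)

lemma inv_closed: "g \<in> G \<Longrightarrow> inv_into UNIV g \<in> G"
  using subgroup.m_inv_closed [OF subgroup] inv_isom_group [OF isom] by metis

lemma inv_apply: "g \<in> G \<Longrightarrow> g (inv_into UNIV g p) = p" "g \<in> G \<Longrightarrow> inv_into UNIV g (g p) = p"
  using isomD(1) [OF isom] by (auto simp: bij_def surj_f_inv_f)

lemma lor_lin_inv: "g \<in> G \<Longrightarrow> lor (lin g v) (hvec p) = lor v (hvec (inv_into UNIV g p))"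
  using lor_lin_hvec [OF isom, of g v "inv_into UNIV g p"] by (simp add: inv_apply)

lemma mem_tile: "g \<in> G \<Longrightarrow> p \<in> g ` P \<longleftrightarrow> (\<forall>v\<in>N. lor (lin g v) (hvec p) \<le> 0)"
  by (simp add: isom_image_inv defining_normals_mem [OF normals] lor_lin_inv)

lemma mem_interior_tile: "g \<in> G \<Longrightarrow> p \<in> interior (g ` P) \<longleftrightarrow> (\<forall>v\<in>N. lor (lin g v) (hvec p) < 0)"
  by (simp add: isom_image_interior isom_image_inv interior_polyhedron [OF normals] lor_lin_inv)

lemma lin_normal_pos: "g \<in> G \<Longrightarrow> v \<in> N \<Longrightarrow> 0 < lor (lin g v) (lin g v)"
  by (simp add: lor_lin defining_normals_spacelike [OF normals])

lemma interior_tile_nonempty: "g \<in> G \<Longrightarrow> interior (g ` P) \<noteq> {}"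
  using interior_nonempty by (simp add: isom_image_interior)

text \<open>A small move towards an interior point \<open>z\<close> of the second tile stays in the
  interior of the first and, by convexity, enters the interior of the second.\<close>

lemma tile_eqI:
  assumes g: "g \<in> G" and h: "h \<in> G" and p: "p \<in> interior (g ` P)" "p \<in> h ` P"
  shows "g = h"
proof -
  obtain z where z: "z \<in> interior (h ` P)" using interior_tile_nonempty [OF h] by blast
  obtain \<epsilon> where \<epsilon>: "0 < \<epsilon>" "ball p \<epsilon> \<subseteq> interior (g ` P)" using p(1) openE by blast
  have "\<forall>\<^sub>F t in at_right 0. shift p (hvec z - hvec p) t \<in> interior (g ` P) \<inter> interior (h ` P)"
    using eventually_shift [OF \<epsilon>(1), of p "hvec z - hvec p"]
      eventually_at_right_real [OF zero_less_one]
  proof eventually_elim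
    case (elim t)
    then obtain r where r: "r > 0" "hvec (shift p (hvec z - hvec p) t) = r *\<^sub>R (hvec p + t *\<^sub>R (hvec z - hvec p))"
      by blast
    have "lor m (hvec (shift p (hvec z - hvec p) t)) < 0"
      if "lor m (hvec p) \<le> 0" "lor m (hvec z) < 0" for m
    proof -
      have "(1 - t) * lor m (hvec p) \<le> 0" using that elim by (simp add: mult_nonneg_nonpos)
      moreover have "t * lor m (hvec z) < 0" using that elim by (simp add: mult_pos_neg)
      ultimately have "(1 - t) * lor m (hvec p) + t * lor m (hvec z) < 0" by simp
      moreover have "lor m (hvec (shift p (hvec z - hvec p) t)) = r * ((1 - t) * lor m (hvec p) + t * lor m (hvec z))"
        by (subst r(2)) (simp add: algebra_simps)
      ultimately show ?thesis using r(1) by (simp add: mult_pos_neg)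
    qed
    then have "shift p (hvec z - hvec p) t \<in> interior (h ` P)"
      using z p(2) by (simp add: mem_interior_tile mem_tile h)
    with elim \<epsilon>(2) show ?case by blast
  qed
  then obtain t where "shift p (hvec z - hvec p) t \<in> interior (g ` P) \<inter> interior (h ` P)"
    by (rule eventually_at_right_ex)
  then show ?thesis using disjoint [OF g h] by blast
qed

lemma finite_tiles:
  obtains \<epsilon> where "0 < \<epsilon>" "finite {g \<in> G. g ` P \<inter> ball y \<epsilon> \<noteq> {}}"
proof -
  obtain V where V: "open V" "y \<in> V" "finite {U \<in> (\<lambda>g. g ` P) ` G. U \<inter> V \<noteq> {}}"
    using locally_finite unfolding locally_finite_in_def by auto
  then obtain \<epsilon> where \<epsilon>: "0 < \<epsilon>" "ball y \<epsilon> \<subseteq> V" by (meson openE)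
  let ?T = "{g \<in> G. g ` P \<inter> ball y \<epsilon> \<noteq> {}}"
  have "inj_on (\<lambda>g. g ` P) ?T"
    using disjoint interior_tile_nonempty by (fastforce intro!: inj_onI)
  moreover have "finite ((\<lambda>g. g ` P) ` ?T)"
    by (rule finite_subset [OF _ V(3)]) (use \<epsilon>(2) in blast)
  ultimately have "finite ?T" using finite_imageD by blast
  with \<epsilon>(1) show ?thesis using that by blast
qed

lemma tile_local:
  assumes g: "g \<in> G"
  obtains \<epsilon> where "0 < \<epsilon>"
    "\<And>v p. v \<in> N \<Longrightarrow> lor (lin g v) (hvec y) < 0 \<Longrightarrow> p \<in> ball y \<epsilon> \<Longrightarrow> lor (lin g v) (hvec p) < 0"
proof -
  obtain \<epsilon> where \<epsilon>: "0 < \<epsilon>" "\<And>v p. v \<in> N \<Longrightarrow> lor v (hvec (inv_into UNIV g y)) < 0 \<Longrightarrow>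
      p \<in> ball (inv_into UNIV g y) \<epsilon> \<Longrightarrow> lor v (hvec p) < 0"
    using defining_normals_local [of "{}" P N "inv_into UNIV g y"] normals by auto
  have "inv_into UNIV g p \<in> ball (inv_into UNIV g y) \<epsilon>" if "p \<in> ball y \<epsilon>" for p
    using that isomD(2) [OF isom [OF inv_closed [OF g]]] by simp
  then show ?thesis using that [OF \<epsilon>(1)] \<epsilon>(2) by (simp add: lor_lin_inv g)
qed

text \<open>A point of a subspace \<open>X\<close> that lies on as few walls of the tessellation as possible.\<close>

definition generic :: "'n hyp set \<Rightarrow> 'n hyp \<Rightarrow> bool" where
  "generic X y \<longleftrightarrow> y \<in> X \<and>
     (\<forall>g\<in>G. \<forall>v\<in>N. y \<in> g ` P \<longrightarrow> lor (lin g v) (hvec y) = 0 \<longrightarrow> X \<subseteq> hplane (lin g v))"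

text \<open>A subspace is not covered locally by hyperplanes that do not contain it: each one is
  removed from the window \<open>W\<close>, which stays open and still meets the subspace.\<close>

lemma exists_avoiding:
  assumes "finite F" "open W" "x \<in> subspace_of U \<inter> W" "\<And>K. K \<in> F \<Longrightarrow> \<exists>v. K = hplane v"
  shows "\<exists>y\<in>subspace_of U \<inter> W. \<forall>K\<in>F. y \<in> K \<longrightarrow> subspace_of U \<subseteq> K"
  using assms
proof (induction F arbitrary: W x rule: finite_induct)
  case empty
  then show ?case by blast
next
  case (insert K F)
  obtain v where v: "K = hplane v" using insert.prems(3) by blast
  show ?case
  proof (cases "subspace_of U \<subseteq> K")
    case True
    have "\<exists>y\<in>subspace_of U \<inter> W. \<forall>K\<in>F. y \<in> K \<longrightarrow> subspace_of U \<subseteq> K"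
      using insert.IH [of W x] insert.prems by blast
    with True show ?thesis by blast
  next
    case False
    then obtain x' where x': "x' \<in> subspace_of U \<inter> (W - K)"
      using hyperplane_contains [of x U W v] insert.prems v by blast
    have "\<exists>y\<in>subspace_of U \<inter> (W - K). \<forall>K\<in>F. y \<in> K \<longrightarrow> subspace_of U \<subseteq> K"
      using insert.IH [of "W - K" x'] insert.prems x' v closed_hplane [of v] by (simp add: open_Diff)
    then show ?thesis by blast
  qed
qed

lemma exists_generic:
  assumes x: "x \<in> subspace_of U"
  obtains y where "generic (subspace_of U) y"
proof -
  obtain \<epsilon> where \<epsilon>: "0 < \<epsilon>" "finite {g \<in> G. g ` P \<inter> ball x \<epsilon> \<noteq> {}}"
    using finite_tiles by blast
  let ?T = "{g \<in> G. g ` P \<inter> ball x \<epsilon> \<noteq> {}}"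
  have "\<forall>g. \<exists>\<delta>>0. finite {K \<in> hplane ` N. K \<inter> ball (inv_into UNIV g x) \<delta> \<noteq> {}}"
  proof
    fix g :: "'n hyp \<Rightarrow> 'n hyp"
    obtain \<delta> where "0 < \<delta>"
      "finite {K \<in> (\<lambda>v. UNIV \<inter> hplane v) ` N. K \<inter> ball (inv_into UNIV g x) \<delta> \<noteq> {}}"
      by (rule defining_normals_finite [OF normals UNIV_I])
    then show "\<exists>\<delta>>0. finite {K \<in> hplane ` N. K \<inter> ball (inv_into UNIV g x) \<delta> \<noteq> {}}"
      by (intro exI [of _ \<delta>]) simp
  qed
  from choice [OF this] obtain \<delta> where \<delta>: "\<And>g. 0 < \<delta> g"
    "\<And>g. finite {K \<in> hplane ` N. K \<inter> ball (inv_into UNIV g x) (\<delta> g) \<noteq> {}}"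
    by blast
  \<comment> \<open>All walls that can matter: those near \<open>x\<close> of the finitely many
    tiles near \<open>x\<close>. Inside \<open>W\<close> no other wall of a tile is met.\<close>
  define F where "F = (\<Union>g\<in>?T. (`) g ` {K \<in> hplane ` N. K \<inter> ball (inv_into UNIV g x) (\<delta> g) \<noteq> {}})"
  define W where "W = ball x \<epsilon> \<inter> (\<Inter>g\<in>?T. ball x (\<delta> g))"
  have "finite F" unfolding F_def using \<epsilon>(2) \<delta>(2) by blast
  moreover have "open W" unfolding W_def using \<epsilon>(2) by (intro open_Int open_INT) auto
  moreover have "x \<in> subspace_of U \<inter> W" using x \<epsilon>(1) \<delta>(1) by (simp add: W_def)
  moreover have "\<exists>v. K = hplane v" if K: "K \<in> F" for K
  proof -
    obtain g K' where "g \<in> G" "K' \<in> hplane ` N" "K = g ` K'"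
      using K unfolding F_def by blast
    then obtain v where "g \<in> G" "K = g ` hplane v" by blast
    then have "K = hplane (lin g v)" by (simp add: isom_image_hplane)
    then show ?thesis by blast
  qed
  ultimately have "\<exists>y\<in>subspace_of U \<inter> W. \<forall>K\<in>F. y \<in> K \<longrightarrow> subspace_of U \<subseteq> K"
    by (rule exists_avoiding)
  then obtain y where y: "y \<in> subspace_of U \<inter> W" "\<forall>K\<in>F. y \<in> K \<longrightarrow> subspace_of U \<subseteq> K"
    by blast
  have "subspace_of U \<subseteq> hplane (lin g v)"
    if g: "g \<in> G" and v: "v \<in> N" "y \<in> g ` P" "lor (lin g v) (hvec y) = 0" for g v
  proof -
    have gT: "g \<in> ?T" using g v(2) y(1) by (auto simp: W_def)
    then have "dist x y < \<delta> g" using y(1) by (auto simp: W_def)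
    then have "inv_into UNIV g y \<in> ball (inv_into UNIV g x) (\<delta> g)"
      using isomD(2) [OF isom [OF inv_closed [OF g]]] by simp
    moreover have "inv_into UNIV g y \<in> hplane v"
      using v(3) by (simp add: hplane_def lor_lin_inv g)
    ultimately have "g ` hplane v \<in> F" using gT v(1) unfolding F_def by blast
    moreover have "y \<in> g ` hplane v" using v(3) by (simp add: isom_image_hplane g) (simp add: hplane_def)
    ultimately show ?thesis using y(2) by (simp add: isom_image_hplane g)
  qed
  then have "generic (subspace_of U) y" using y(1) by (simp add: generic_def)
  then show ?thesis using that by blast
qed

text \<open>Near \<open>y\<close> the tile \<open>g ` P\<close> is the intersection of the half-spaces with outer normals \<open>m1\<close> and
  \<open>m2\<close>; the case \<open>m1 = m2\<close> is that of a point in the relative interior of a side.\<close>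

definition corner :: "('n hyp \<Rightarrow> 'n hyp) \<Rightarrow> 'n hyp \<Rightarrow> (real ^ 'n) \<times> real \<Rightarrow> (real ^ 'n) \<times> real \<Rightarrow> bool" where
  "corner g y m1 m2 \<longleftrightarrow> g \<in> G \<and> y \<in> g ` P \<and> lor m1 (hvec y) = 0 \<and> lor m2 (hvec y) = 0 \<and>
     (\<exists>v\<in>N. \<exists>r>0. lin g v = r *\<^sub>R m1) \<and> (\<exists>v\<in>N. \<exists>r>0. lin g v = r *\<^sub>R m2) \<and>
     (\<forall>v\<in>N. lor (lin g v) (hvec y) = 0 \<longrightarrow> (\<exists>s t. 0 \<le> s \<and> 0 \<le> t \<and> lin g v = s *\<^sub>R m1 + t *\<^sub>R m2))"

lemma corner_active:
  assumes "corner g y m1 m2" "v \<in> N" "lor (lin g v) (hvec y) = 0"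
  obtains s t where "0 \<le> s" "0 \<le> t" "lin g v = s *\<^sub>R m1 + t *\<^sub>R m2"
  using assms by (auto simp: corner_def)

lemma corner_sym:
  assumes "corner g y m1 m2"
  shows "corner g y m2 m1"
proof -
  have "\<exists>s t. 0 \<le> s \<and> 0 \<le> t \<and> lin g v = s *\<^sub>R m2 + t *\<^sub>R m1"
    if v: "v \<in> N" "lor (lin g v) (hvec y) = 0" for v
  proof -
    obtain s t where "0 \<le> s" "0 \<le> t" "lin g v = s *\<^sub>R m1 + t *\<^sub>R m2"
      by (rule corner_active [OF assms v])
    then show ?thesis by (intro exI [of _ t] exI [of _ s]) (simp add: add.commute)
  qed
  then show ?thesis using assms unfolding corner_def by simp
qed

lemma corner_near:
  assumes c: "corner g y m1 m2"
  obtains \<epsilon> where "0 < \<epsilon>"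
    "\<And>p. p \<in> ball y \<epsilon> \<Longrightarrow> p \<in> g ` P \<longleftrightarrow> lor m1 (hvec p) \<le> 0 \<and> lor m2 (hvec p) \<le> 0"
    "\<And>p. p \<in> ball y \<epsilon> \<Longrightarrow> p \<in> interior (g ` P) \<longleftrightarrow> lor m1 (hvec p) < 0 \<and> lor m2 (hvec p) < 0"
proof -
  have g: "g \<in> G" and y: "y \<in> g ` P" using c by (auto simp: corner_def)
  obtain \<epsilon> where \<epsilon>: "0 < \<epsilon>"
    "\<And>v p. v \<in> N \<Longrightarrow> lor (lin g v) (hvec y) < 0 \<Longrightarrow> p \<in> ball y \<epsilon> \<Longrightarrow> lor (lin g v) (hvec p) < 0"
    using tile_local [OF g] by blast
  obtain v1 r1 v2 r2 where v: "v1 \<in> N" "0 < r1" "lin g v1 = r1 *\<^sub>R m1" "v2 \<in> N" "0 < r2" "lin g v2 = r2 *\<^sub>R m2"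
    using c unfolding corner_def by blast
  \<comment> \<open>Normals are space-like and hence nonzero, so \<open>s + t\<close> is positive;
    this makes the strict inequalities for \<open>m1\<close>, \<open>m2\<close> pass to every active
    normal.\<close>
  have act: "lor (lin g v) (hvec y) < 0 \<or>
      (\<exists>s t. 0 \<le> s \<and> 0 \<le> t \<and> 0 < s + t \<and> lin g v = s *\<^sub>R m1 + t *\<^sub>R m2)" if v: "v \<in> N" for v
  proof (cases "lor (lin g v) (hvec y) = 0")
    case True
    then obtain s t where st: "0 \<le> s" "0 \<le> t" "lin g v = s *\<^sub>R m1 + t *\<^sub>R m2"
      by (rule corner_active [OF c v])
    have "s + t \<noteq> 0"
    proof
      assume "s + t = 0"
      then have "s = 0" "t = 0" using st by auto
      then show False using st(3) lin_normal_pos [OF g v] by simp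
    qed
    then have "0 < s + t" using st by linarith
    with st show ?thesis by blast
  next
    case False
    moreover have "lor (lin g v) (hvec y) \<le> 0" using y v by (simp add: mem_tile g)
    ultimately show ?thesis by simp
  qed
  show ?thesis
  proof (rule that [OF \<epsilon>(1)])
    fix p assume p: "p \<in> ball y \<epsilon>"
    show "p \<in> g ` P \<longleftrightarrow> lor m1 (hvec p) \<le> 0 \<and> lor m2 (hvec p) \<le> 0" (is "?L \<longleftrightarrow> ?R")
    proof
      assume ?L
      then have "lor (lin g v1) (hvec p) \<le> 0" "lor (lin g v2) (hvec p) \<le> 0"
        using v by (auto simp: mem_tile g)
      then show ?R using v by (simp add: mult_le_0_iff)
    next
      assume R: ?R
      have "lor (lin g w) (hvec p) \<le> 0" if "w \<in> N" for w
        using act [OF that] \<epsilon>(2) [OF that _ p] R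
        by (auto simp: mult_nonneg_nonpos add_nonpos_nonpos less_imp_le)
      then show ?L by (simp add: mem_tile g)
    qed
    show "p \<in> interior (g ` P) \<longleftrightarrow> lor m1 (hvec p) < 0 \<and> lor m2 (hvec p) < 0" (is "?L \<longleftrightarrow> ?R")
    proof
      assume ?L
      then have "lor (lin g v1) (hvec p) < 0" "lor (lin g v2) (hvec p) < 0"
        using v by (auto simp: mem_interior_tile g)
      then show ?R using v by (simp add: mult_less_0_iff)
    next
      assume R: ?R
      have "lor (lin g w) (hvec p) < 0" if w: "w \<in> N" for w
      proof (cases "lor (lin g w) (hvec y) < 0")
        case False
        then obtain s t where st: "0 \<le> s" "0 \<le> t" "0 < s + t" "lin g w = s *\<^sub>R m1 + t *\<^sub>R m2"
          using act [OF w] by blast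
        show ?thesis
        proof (cases "s = 0")
          case True
          then show ?thesis using R st by (simp add: mult_pos_neg)
        next
          case False
          then have "s * lor m1 (hvec p) < 0" using st R by (simp add: mult_pos_neg)
          moreover have "t * lor m2 (hvec p) \<le> 0" using st R by (simp add: mult_nonneg_nonpos)
          ultimately show ?thesis using st(4) by simp
        qed
      qed (use \<epsilon>(2) w p in simp)
      then show ?L by (simp add: mem_interior_tile g)
    qed
  qed
qed

lemma corner_shift:
  assumes c: "corner g y m1 m2"
  shows "\<forall>\<^sub>F t in at_right 0. (shift y d t \<in> g ` P \<longleftrightarrow> lor m1 d \<le> 0 \<and> lor m2 d \<le> 0) \<and>
    (shift y d t \<in> interior (g ` P) \<longleftrightarrow> lor m1 d < 0 \<and> lor m2 d < 0)"
proof -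
  obtain \<epsilon> where \<epsilon>: "0 < \<epsilon>"
    "\<And>p. p \<in> ball y \<epsilon> \<Longrightarrow> p \<in> g ` P \<longleftrightarrow> lor m1 (hvec p) \<le> 0 \<and> lor m2 (hvec p) \<le> 0"
    "\<And>p. p \<in> ball y \<epsilon> \<Longrightarrow> p \<in> interior (g ` P) \<longleftrightarrow> lor m1 (hvec p) < 0 \<and> lor m2 (hvec p) < 0"
    using corner_near [OF c] by blast
  have m: "lor m1 (hvec y) = 0" "lor m2 (hvec y) = 0" using c by (auto simp: corner_def)
  show ?thesis
    using eventually_shift [OF \<epsilon>(1), of y d] eventually_shift_lor [of y d]
  proof eventually_elim
    case (elim t)
    then obtain r where r: "r > 0" "\<And>m. lor m (hvec y) = 0 \<Longrightarrow> lor m (hvec (shift y d t)) = r * lor m d" by blast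
    have "shift y d t \<in> ball y \<epsilon>" using elim by blast
    from \<epsilon>(2,3) [OF this] show ?case
      using r m by (simp add: mult_le_0_iff mult_less_0_iff)
  qed
qed

text \<open>The direction \<open>d\<close> points from \<open>y\<close> into the face with outer normal \<open>m2\<close>.\<close>

definition facet_dir where
  "facet_dir m1 m2 d \<longleftrightarrow> lor m2 d = 0 \<and> (lor m1 d < 0 \<or> m1 = m2)"

text \<open>Pulled back to \<open>P\<close>, so that it can be a side of \<open>P\<close> and an
  argument of \<open>pr\<close>.\<close>

definition facet :: "('n hyp \<Rightarrow> 'n hyp) \<Rightarrow> (real ^ 'n) \<times> real \<Rightarrow> 'n hyp set" where
  "facet g m = inv_into UNIV g ` (g ` P \<inter> hplane m)"

lemma image_facet: "g \<in> G \<Longrightarrow> g ` facet g m = g ` P \<inter> hplane m"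
  unfolding facet_def by (simp add: image_f_inv_f isomD(1) bij_is_surj)

text \<open>Shifting \<open>y\<close> slightly along \<open>d\<close> gives a point of the face that
  lies on no other wall; its pull-back is the witness that \<open>side_onI\<close> asks for.\<close>

lemma facet_relint:
  assumes c: "corner g y m1 m2" and d: "facet_dir m1 m2 d"
  obtains v z where "v \<in> N" "facet g m2 = P \<inter> hplane v" "hplane (lin g v) = hplane m2"
    "z \<in> P" "lor v (hvec z) = 0" "\<And>w. w \<in> N \<Longrightarrow> lor w (hvec z) < 0 \<or> hplane w = hplane v"
    "lor m1 d < 0 \<Longrightarrow> lor m1 (hvec (g z)) < 0"
proof -
  have g: "g \<in> G" and y: "y \<in> g ` P" and m: "lor m1 (hvec y) = 0" "lor m2 (hvec y) = 0"
    using c by (auto simp: corner_def)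
  obtain v r where v: "v \<in> N" "0 < r" "lin g v = r *\<^sub>R m2" using c unfolding corner_def by blast
  have hp: "hplane (lin g v) = hplane m2" using v by (simp add: hplane_scaleR)
  have fac: "facet g m2 = P \<inter> hplane v"
    unfolding facet_def hp [symmetric]
    by (simp add: g isom_image_hplane [symmetric] isom_image_Int [symmetric] image_inv_f_f isomD(1) bij_is_inj)
  have le: "lor m1 d \<le> 0" "lor m2 d \<le> 0" using d by (auto simp: facet_dir_def)
  obtain \<epsilon> where \<epsilon>: "0 < \<epsilon>"
    "\<And>v p. v \<in> N \<Longrightarrow> lor (lin g v) (hvec y) < 0 \<Longrightarrow> p \<in> ball y \<epsilon> \<Longrightarrow> lor (lin g v) (hvec p) < 0"
    using tile_local [OF g] by blast
  have "\<forall>\<^sub>F t in at_right 0. shift y d t \<in> ball y \<epsilon> \<and> shift y d t \<in> g ` P \<and>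
      (\<exists>r>0. \<forall>m. lor m (hvec y) = 0 \<longrightarrow> lor m (hvec (shift y d t)) = r * lor m d)"
    using eventually_shift [OF \<epsilon>(1), of y d] eventually_shift_lor [of y d] corner_shift [OF c, of d]
  proof eventually_elim
    case (elim t)
    then show ?case using le by (intro conjI) simp_all
  qed
  then obtain t where t: "shift y d t \<in> ball y \<epsilon> \<and> shift y d t \<in> g ` P \<and>
      (\<exists>r>0. \<forall>m. lor m (hvec y) = 0 \<longrightarrow> lor m (hvec (shift y d t)) = r * lor m d)"
    by (rule eventually_at_right_ex)
  let ?z = "shift y d t"
  obtain \<rho> where \<rho>: "\<rho> > 0" "\<And>m. lor m (hvec y) = 0 \<Longrightarrow> lor m (hvec ?z) = \<rho> * lor m d" using t by blast
  \<comment> \<open>An active normal to which \<open>m1\<close> contributes becomes negative along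
    \<open>d\<close>; otherwise it is a multiple of \<open>m2\<close> and defines the same
    wall.\<close>
  have strict: "lor (lin g w) (hvec ?z) < 0 \<or> hplane (lin g w) = hplane m2" if w: "w \<in> N" for w
  proof (cases "lor (lin g w) (hvec y) < 0")
    case False
    moreover have "lor (lin g w) (hvec y) \<le> 0" using y w by (simp add: mem_tile g)
    ultimately have y0: "lor (lin g w) (hvec y) = 0" by simp
    obtain s u where su: "0 \<le> s" "0 \<le> u" "lin g w = s *\<^sub>R m1 + u *\<^sub>R m2"
      by (rule corner_active [OF c w y0])
    show ?thesis
    proof (cases "s = 0 \<or> m1 = m2")
      case True
      have "\<exists>k. lin g w = k *\<^sub>R m2"
      proof (cases "s = 0")
        case True
        then show ?thesis by (intro exI [of _ u]) (simp add: su(3))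
      next
        case False
        then have "m1 = m2" using \<open>s = 0 \<or> m1 = m2\<close> by blast
        then show ?thesis by (intro exI [of _ "s + u"]) (simp add: su(3) scaleR_add_left)
      qed
      then obtain k where k: "lin g w = k *\<^sub>R m2" by blast
      then have "k \<noteq> 0" using lin_normal_pos [OF g w] by auto
      then show ?thesis using k by (simp add: hplane_scaleR)
    next
      case False
      then have "lor m1 d < 0" "lor m2 d = 0" "0 < s" using d su by (auto simp: facet_dir_def)
      then have "lor (lin g w) d < 0" using su(3) by (simp add: mult_pos_neg)
      then show ?thesis using \<rho> y0 by (simp add: mult_pos_neg)
    qed
  qed (use \<epsilon>(2) w t in simp)
  have gz: "g (inv_into UNIV g ?z) = ?z" by (simp add: g inv_apply)
  show ?thesis
  proof (rule that [OF v(1) fac hp])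
    show "inv_into UNIV g ?z \<in> P" using t by (simp add: isom_image_inv g)
    show "lor v (hvec (inv_into UNIV g ?z)) = 0"
      using \<rho> m d v(3) by (simp add: lor_lin_inv [OF g, symmetric] facet_dir_def)
    show "lor w (hvec (inv_into UNIV g ?z)) < 0 \<or> hplane w = hplane v" if "w \<in> N" for w
      using strict [OF that] hp inj_image_eq_iff [OF bij_is_inj [OF isomD(1) [OF isom [OF g]]], of "hplane w" "hplane v"]
      by (simp add: lor_lin_inv g isom_image_hplane)
    show "lor m1 (hvec (g (inv_into UNIV g ?z))) < 0" if "lor m1 d < 0"
      unfolding gz using \<rho> m that by (simp add: mult_pos_neg)
  qed
qed

lemma facet_side:
  assumes "corner g y m1 m2" "facet_dir m1 m2 d"
  shows "side P (facet g m2)"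
proof -
  obtain v z where v: "v \<in> N" "facet g m2 = P \<inter> hplane v"
    "z \<in> P" "lor v (hvec z) = 0" "\<And>w. w \<in> N \<Longrightarrow> lor w (hvec z) < 0 \<or> hplane w = hplane v"
    using facet_relint [OF assms] by metis
  obtain z0 where "z0 \<in> interior P" using interior_nonempty by blast
  then have "z0 \<in> P" "lor v (hvec z0) < 0"
    using interior_subset [of P] v(1) interior_polyhedron [OF normals, of z0] by blast+
  then show ?thesis
    unfolding side_def using side_onI [of "{}" P N v z z0] normals v by auto
qed

text \<open>The face contains a relatively open piece of its wall, and such a piece determines the
  hyperplane.\<close>

lemma facet_hyperplane:
  assumes c: "corner g y m1 m2" and d: "facet_dir m1 m2 d" and sub: "g ` P \<inter> hplane m2 \<subseteq> hplane w"
  shows "hplane m2 \<subseteq> hplane w"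
proof -
  have g: "g \<in> G" using c by (simp add: corner_def)
  obtain v z where v: "v \<in> N" "facet g m2 = P \<inter> hplane v" "hplane (lin g v) = hplane m2"
    "z \<in> P" "lor v (hvec z) = 0" "\<And>w. w \<in> N \<Longrightarrow> lor w (hvec z) < 0 \<or> hplane w = hplane v"
    using facet_relint [OF c d] by metis
  obtain \<epsilon> where \<epsilon>: "0 < \<epsilon>" "hplane v \<inter> ball z \<epsilon> \<subseteq> P"
    using relint_face [of "{}" P N z v] normals v by auto
  then have "g ` (hplane v \<inter> ball z \<epsilon>) \<subseteq> g ` P" by blast
  then have "hplane m2 \<inter> ball (g z) \<epsilon> \<subseteq> g ` P"
    using v(3) by (simp add: isom_image_Int isom_image_ball isom_image_hplane g)
  then have "subspace_of {m2} \<inter> ball (g z) \<epsilon> \<subseteq> hplane w"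
    using sub by (auto simp: subspace_of_singleton)
  moreover have "g z \<in> hplane m2"
    unfolding v(3) [symmetric] using v(5) by (simp add: hplane_def lor_lin_hvec g)
  ultimately show ?thesis
    using hyperplane_contains [of "g z" "{m2}" "ball (g z) \<epsilon>" w] \<epsilon>(1) by (simp add: subspace_of_singleton)
qed

lemma corner_spacelike:
  assumes "corner g y m1 m2"
  shows "0 < lor m2 m2"
proof -
  have g: "g \<in> G" using assms by (simp add: corner_def)
  obtain v r where v: "v \<in> N" "0 < r" "lin g v = r *\<^sub>R m2" using assms unfolding corner_def by blast
  have "0 < lor (lin g v) (lin g v)" using lin_normal_pos [OF g v(1)] .
  then show ?thesis unfolding v(3) using v(2) by (simp add: zero_less_mult_iff)
qed

lemma inv_image_tile_Int:
  assumes g: "g \<in> G"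
  shows "inv_into UNIV g ` (g ` P \<inter> A) = P \<inter> inv_into UNIV g ` A"
proof -
  have "inv_into UNIV g ` (g ` P) = P"
    by (simp add: image_inv_f_f isomD(1) bij_is_inj g)
  then show ?thesis
    by (simp add: isom_image_Int [OF isom [OF inv_closed [OF g]]])
qed

section \<open>Edges as sides of sides\<close>

definition ridge :: "('n hyp \<Rightarrow> 'n hyp) \<Rightarrow> (real ^ 'n) \<times> real \<Rightarrow> (real ^ 'n) \<times> real \<Rightarrow> 'n hyp set" where
  "ridge g m1 m2 = inv_into UNIV g ` (g ` P \<inter> (hplane m1 \<inter> hplane m2))"

lemma ridge_eq: "g \<in> G \<Longrightarrow> ridge g m1 m2 = facet g m1 \<inter> facet g m2"
  unfolding ridge_def facet_def
  by (simp add: inv_image_tile_Int isom_image_Int [OF isom [OF inv_closed]]) blast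

text \<open>Normals whose walls contain or miss \<open>hplane v\<close> are not normals in it and
  are dropped. No constraint is lost: a point violating a dropped one, together with
  \<open>z\<close>, would force its wall to meet \<open>hplane v\<close>.\<close>

lemma defining_normals_face:
  assumes v: "0 < lor v v" and z: "z \<in> P \<inter> hplane v"
  shows "defining_normals (hplane v) (P \<inter> hplane v) {w \<in> N. hplane_normal_in (hplane v) w}"
  unfolding defining_normals_def
proof (intro conjI)
  let ?Y = "hplane v" and ?N = "{w \<in> N. hplane_normal_in (hplane v) w}"
  show "\<forall>w\<in>?N. hplane_normal_in ?Y w" by blast
  show "locally_finite_in (top_of_set ?Y) ((\<lambda>w. ?Y \<inter> hplane w) ` ?N)"
    unfolding locally_finite_in_def
  proof (intro conjI ballI)
    show "\<Union> ((\<lambda>w. ?Y \<inter> hplane w) ` ?N) \<subseteq> topspace (top_of_set ?Y)" by auto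
    fix x assume x: "x \<in> topspace (top_of_set ?Y)"
    obtain \<epsilon> where \<epsilon>: "0 < \<epsilon>" "finite {K \<in> (\<lambda>v. UNIV \<inter> hplane v) ` N. K \<inter> ball x \<epsilon> \<noteq> {}}"
      by (rule defining_normals_finite [OF normals UNIV_I])
    have "{K \<in> (\<lambda>w. ?Y \<inter> hplane w) ` ?N. K \<inter> (?Y \<inter> ball x \<epsilon>) \<noteq> {}}
      \<subseteq> (\<lambda>K. ?Y \<inter> K) ` {K \<in> (\<lambda>v. UNIV \<inter> hplane v) ` N. K \<inter> ball x \<epsilon> \<noteq> {}}"
      by blast
    then have "finite {K \<in> (\<lambda>w. ?Y \<inter> hplane w) ` ?N. K \<inter> (?Y \<inter> ball x \<epsilon>) \<noteq> {}}"
      using \<epsilon>(2) finite_surj by blast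
    moreover have "openin (top_of_set ?Y) (?Y \<inter> ball x \<epsilon>)" by (simp add: openin_open_Int)
    moreover have "x \<in> ?Y \<inter> ball x \<epsilon>" using x \<epsilon>(1) by simp
    ultimately show "\<exists>V. openin (top_of_set ?Y) V \<and> x \<in> V \<and>
        finite {K \<in> (\<lambda>w. ?Y \<inter> hplane w) ` ?N. K \<inter> V \<noteq> {}}" by blast
  qed
  show "P \<inter> ?Y = ?Y \<inter> (\<Inter>w\<in>?N. hspace w)"
  proof
    show "P \<inter> ?Y \<subseteq> ?Y \<inter> (\<Inter>w\<in>?N. hspace w)"
      using defining_normals_mem [OF normals] by (auto simp: hspace_def)
    have "lor w (hvec p) \<le> 0" if p: "p \<in> ?Y \<inter> (\<Inter>w\<in>?N. hspace w)" and w: "w \<in> N" for p w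
    proof (rule ccontr)
      assume neg: "\<not> lor w (hvec p) \<le> 0"
      have "w \<notin> ?N"
      proof
        assume "w \<in> ?N"
        then have "p \<in> hspace w" using p by blast
        then show False using neg by (simp add: hspace_def)
      qed
      then have "\<not> hplane_normal_in ?Y w" using w by blast
      moreover have "\<not> ?Y \<subseteq> hplane w" using p neg by (auto simp: hplane_def)
      ultimately have e: "?Y \<inter> hplane w = {}"
        using defining_normals_spacelike [OF normals w] by (simp add: hplane_normal_in_def)
      have "lor w (hvec z) \<le> 0" using z w defining_normals_mem [OF normals] by blast
      moreover have "z \<notin> hplane w" using e z by blast
      ultimately have lt: "lor w (hvec z) < 0" by (simp add: hplane_def)
      have zb: "z \<in> subspace_of {v} \<inter> ball z (dist z p + 1)"
        using z by (simp add: subspace_of_singleton add_nonneg_pos)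
      have pb: "p \<in> subspace_of {v} \<inter> ball z (dist z p + 1)"
        using p by (simp add: subspace_of_singleton)
      have "0 \<le> lor w (hvec p)" using neg by simp
      from lor_zero_in_ball [OF zb pb lt this]
      obtain s where "s \<in> subspace_of {v} \<inter> ball z (dist z p + 1)" "lor w (hvec s) = 0" .
      then show False using e by (auto simp: subspace_of_singleton hplane_def)
    qed
    then show "?Y \<inter> (\<Inter>w\<in>?N. hspace w) \<subseteq> P \<inter> ?Y"
      using defining_normals_mem [OF normals] by blast
  qed
qed

text \<open>\<open>side_onI\<close> is used twice: in the whole space with the relative interior
  point \<open>z\<close> of the facet, then in \<open>hplane v\<close> with the pull-back of
  \<open>y\<close>, where \<open>z\<close> serves as the point off the wall.\<close>

lemma ridge_edge:
  assumes c: "corner g y m1 m2" and d: "lor m2 d = 0" "lor m1 d < 0"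
  shows "edge P (ridge g m1 m2)"
proof -
  have g: "g \<in> G" and y: "y \<in> g ` P" "lor m1 (hvec y) = 0" "lor m2 (hvec y) = 0"
    using c by (auto simp: corner_def)
  have fd: "facet_dir m1 m2 d" using d by (simp add: facet_dir_def)
  obtain v z where v: "v \<in> N" "facet g m2 = P \<inter> hplane v" "hplane (lin g v) = hplane m2"
    and z: "z \<in> P" "lor v (hvec z) = 0" "\<And>w. w \<in> N \<Longrightarrow> lor w (hvec z) < 0 \<or> hplane w = hplane v"
    and zd: "lor m1 (hvec (g z)) < 0"
    using facet_relint [OF c fd] d(2) by metis
  obtain v1 r1 where v1: "v1 \<in> N" "0 < r1" "lin g v1 = r1 *\<^sub>R m1" using c unfolding corner_def by blast
  have z1: "lor v1 (hvec z) < 0"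
  proof -
    have "lor v1 (hvec z) = r1 * lor m1 (hvec (g z))"
      using lor_lin_hvec [OF isom [OF g], of v1 z] v1(3) by simp
    then show ?thesis using mult_pos_neg [OF v1(2) zd] by simp
  qed
  obtain z0 where "z0 \<in> interior P" using interior_nonempty by blast
  then have "z0 \<in> P" "lor v (hvec z0) < 0"
    using interior_subset [of P] v(1) interior_polyhedron [OF normals, of z0] by blast+
  then have side: "side_on UNIV P (hplane v) (P \<inter> hplane v)"
    using side_onI [of "{}" P N v z z0] normals v z by auto
  let ?Y = "hplane v" and ?N = "{w \<in> N. hplane_normal_in (hplane v) w}"
  have zY: "z \<in> P \<inter> ?Y" using z by (simp add: hplane_def)
  have dn: "defining_normals (subspace_of {v}) (P \<inter> ?Y) ?N"
    unfolding subspace_of_singleton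
    by (rule defining_normals_face [OF defining_normals_spacelike [OF normals v(1)] zY])
  define y' where "y' = inv_into UNIV g y"
  have gy': "g y' = y" by (simp add: y'_def inv_apply g)
  have y'P: "y' \<in> P" using y(1) by (simp add: y'_def isom_image_inv g)
  have y'1: "lor v1 (hvec y') = 0"
    using lor_lin_hvec [OF isom [OF g], of v1 y'] y v1 by (simp add: gy')
  have y'v: "y' \<in> ?Y"
  proof -
    have "g y' \<in> hplane (lin g v)" using v(3) y(3) gy' by (simp add: hplane_def)
    then show ?thesis by (simp add: hplane_def lor_lin_hvec g)
  qed
  have v1N: "v1 \<in> ?N"
    using v1(1) defining_normals_spacelike [OF normals v1(1)] y'v y'1 z1 zY
    by (auto simp: hplane_normal_in_def hplane_def)
  have strict: "lor w (hvec y') < 0 \<or> subspace_of {v} \<inter> hplane w = subspace_of {v} \<inter> hplane v1"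
    if w: "w \<in> ?N" for w
  proof (cases "lor w (hvec y') < 0")
    case False
    have wN: "w \<in> N" using w by blast
    moreover have "lor w (hvec y') \<le> 0" using y'P wN defining_normals_mem [OF normals] by blast
    ultimately have "lor (lin g w) (hvec y) = 0"
      using False lor_lin_hvec [OF isom [OF g], of w y'] by (simp add: gy')
    then obtain s t where st: "lin g w = s *\<^sub>R m1 + t *\<^sub>R m2"
      using corner_active [OF c wN] by metis
    \<comment> \<open>On the facet hyperplane the \<open>m2\<close> part vanishes, so every active
      constraint restricts to a multiple of \<open>m1\<close>, which is the wall of
      \<open>v1\<close> there.\<close>
    have l: "lor w (hvec p) = s * lor m1 (hvec (g p))" if p: "p \<in> ?Y" for p
    proof -
      have "g p \<in> hplane (lin g v)" using p by (simp add: hplane_def lor_lin_hvec g)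
      then have "lor m2 (hvec (g p)) = 0" unfolding v(3) by (simp add: hplane_def)
      then show ?thesis using lor_lin_hvec [OF isom [OF g], of w p] by (simp add: st)
    qed
    have l1: "lor v1 (hvec p) = r1 * lor m1 (hvec (g p))" for p
      using lor_lin_hvec [OF isom [OF g], of v1 p] v1 by simp
    have "s \<noteq> 0"
    proof
      assume "s = 0"
      then have "?Y \<subseteq> hplane w" using l by (auto simp: hplane_def)
      then show False using w by (simp add: hplane_normal_in_def)
    qed
    then have "?Y \<inter> hplane w = ?Y \<inter> hplane v1"
      using l l1 v1(2) by (auto simp: hplane_def [of w] hplane_def [of v1])
    then show ?thesis by (simp add: subspace_of_singleton)
  qed simp
  have "side_on (subspace_of {v}) (P \<inter> ?Y) (subspace_of {v} \<inter> hplane v1) (P \<inter> ?Y \<inter> hplane v1)"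
    by (rule side_onI [OF dn v1N _ y'1 strict zY z1]) (use y'P y'v in auto)
  moreover have "ridge g m1 m2 = P \<inter> ?Y \<inter> hplane v1"
  proof -
    have "hplane m1 = hplane (lin g v1)" using v1 by (simp add: hplane_scaleR)
    then have "facet g m1 = P \<inter> hplane v1"
      unfolding facet_def
      by (simp add: g inv_image_tile_Int isom_image_hplane [symmetric] image_inv_f_f isomD(1) bij_is_inj)
    then show ?thesis using v(2) by (auto simp: ridge_eq g)
  qed
  ultimately show ?thesis using side unfolding edge_def subspace_of_singleton by metis
qed

text \<open>By genericity every active normal is a multiple of \<open>v\<close>, and an interior
  point \<open>z\<close> of the tile forces all multiples to have the same sign.\<close>

lemma generic_hplane:
  assumes gen: "generic (hplane v) y" and v: "0 < lor v v" and g: "g \<in> G" and y: "y \<in> g ` P"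
  shows "y \<in> interior (g ` P) \<or> corner g y v v \<or> corner g y (- v) (- v)"
proof (cases "\<exists>w\<in>N. lor (lin g w) (hvec y) = 0")
  case False
  have "lor (lin g w) (hvec y) < 0" if w: "w \<in> N" for w
  proof -
    have "lor (lin g w) (hvec y) \<le> 0" using y w by (simp add: mem_tile g)
    moreover have "lor (lin g w) (hvec y) \<noteq> 0" using False w by blast
    ultimately show ?thesis by simp
  qed
  then show ?thesis by (simp add: mem_interior_tile g)
next
  case True
  have yv: "y \<in> hplane v" using gen by (simp add: generic_def)
  obtain z where z: "z \<in> interior (g ` P)" using interior_tile_nonempty [OF g] by blast
  have *: "\<exists>k. lin g w = k *\<^sub>R v \<and> k * lor v (hvec z) < 0"
    if w: "w \<in> N" "lor (lin g w) (hvec y) = 0" for w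
  proof -
    have "hplane v \<subseteq> hplane (lin g w)" using gen w g y by (simp add: generic_def)
    then have k: "lin g w = (lor (lin g w) v / lor v v) *\<^sub>R v" (is "_ = ?k *\<^sub>R v")
      using hplane_subset_parallel yv v by blast
    moreover have "lor (lin g w) (hvec z) < 0" using z w(1) by (simp add: mem_interior_tile g)
    then have "?k * lor v (hvec z) < 0" by (subst (asm) k) simp
    ultimately show ?thesis by blast
  qed
  define e where "e = (if lor v (hvec z) < 0 then 1 else - 1 :: real)"
  have **: "\<exists>k>0. lin g w = k *\<^sub>R (e *\<^sub>R v)" if w: "w \<in> N" "lor (lin g w) (hvec y) = 0" for w
  proof -
    obtain k where k: "lin g w = k *\<^sub>R v" "k * lor v (hvec z) < 0" using * [OF w] by blast
    then have "k * e > 0" by (auto simp: e_def mult_less_0_iff)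
    moreover have "lin g w = (k * e) *\<^sub>R (e *\<^sub>R v)" using k(1) by (simp add: e_def)
    ultimately show ?thesis by blast
  qed
  have ey: "lor (e *\<^sub>R v) (hvec y) = 0" using yv by (simp add: hplane_def)
  have "corner g y (e *\<^sub>R v) (e *\<^sub>R v)"
    unfolding corner_def
  proof (intro conjI ballI impI g y ey)
    show "\<exists>w\<in>N. \<exists>r>0. lin g w = r *\<^sub>R (e *\<^sub>R v)" using True ** by blast
    then show "\<exists>w\<in>N. \<exists>r>0. lin g w = r *\<^sub>R (e *\<^sub>R v)" .
    fix w assume "w \<in> N" "lor (lin g w) (hvec y) = 0"
    then obtain k where "k > 0" "lin g w = k *\<^sub>R (e *\<^sub>R v)" using ** by blast
    then show "\<exists>s t. 0 \<le> s \<and> 0 \<le> t \<and> lin g w = s *\<^sub>R e *\<^sub>R v + t *\<^sub>R e *\<^sub>R v"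
      by (intro exI [of _ k] exI [of _ 0]) simp
  qed
  then show ?thesis unfolding e_def by (cases "lor v (hvec z) < 0") auto
qed

end

section \<open>Neighbouring tiles given by the side-pairing\<close>

locale paired_tessellation = tessellation P N G
  for P :: "'n::finite hyp set" and N G +
  fixes mate :: "'n hyp set \<Rightarrow> 'n hyp set" and pr :: "'n hyp set \<Rightarrow> 'n hyp \<Rightarrow> 'n hyp"
  assumes pairing: "side_pairing P mate pr"
    and pr_mem: "\<And>S. side P S \<Longrightarrow> pr S \<in> G"
begin

definition neighbour :: "('n hyp \<Rightarrow> 'n hyp) \<Rightarrow> (real ^ 'n) \<times> real \<Rightarrow> 'n hyp \<Rightarrow> 'n hyp" where
  "neighbour g m = g \<circ> inv_into UNIV (pr (facet g m))"

lemma neighbour: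
  assumes c: "corner g y m1 m2" and d: "facet_dir m1 m2 d"
  shows "neighbour g m2 \<in> G"
    and "neighbour g m2 ` P \<inter> hplane m2 = g ` P \<inter> hplane m2"
    and "g ` P \<inter> hplane m2 \<inter> interior (neighbour g m2 ` P) = {}"
    and "interior (g ` P) \<inter> interior (neighbour g m2 ` P) = {}"
    and "pr (facet g m2) ` facet g m2 = facet (neighbour g m2) m2"
    and "neighbour g m2 \<circ> pr (facet g m2) = g"
proof -
  let ?R = "facet g m2"
  let ?s = "pr ?R"
  let ?g' = "neighbour g m2"
  have g: "g \<in> G" and y: "lor m2 (hvec y) = 0" using c by (auto simp: corner_def)
  have R: "side P ?R" using facet_side [OF c d] .
  have s: "?s \<in> G" using pr_mem [OF R] .
  have sp: "side P (mate ?R)" "?s ` ?R = mate ?R" "?s ` interior P \<inter> interior P = {}"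
    using pairing R unfolding side_pairing_def by blast+
  show g': "?g' \<in> G" unfolding neighbour_def using comp_closed [OF g inv_closed [OF s]] .
  show g's: "?g' \<circ> ?s = g"
    by (rule ext) (simp add: neighbour_def inv_apply s)
  \<comment> \<open>The normals witnessing that the paired side is a side need not be
    \<open>N\<close>; all that is taken from them is a space-like normal of its hyperplane.\<close>
  obtain Y where Y: "side_on UNIV P Y (mate ?R)"
    using sp(1) unfolding side_def by blast
  then have "\<exists>M. defining_normals UNIV P M \<and> (\<exists>v\<in>M. Y = UNIV \<inter> hplane v)"
    unfolding side_on_def by blast
  then obtain M v0 where v0: "defining_normals UNIV P M" "v0 \<in> M" "Y = hplane v0"
    by (metis Int_UNIV_left)
  have "mate ?R \<subseteq> top_of_set UNIV frontier_of P" and mR: "mate ?R = P \<inter> Y"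
    using Y unfolding side_on_def by blast+
  then have fr: "mate ?R \<subseteq> frontier P" by simp
  have F: "?g' ` mate ?R = g ` P \<inter> hplane m2"
    unfolding sp(2) [symmetric] image_comp g's by (rule image_facet [OF g])
  have F': "?g' ` mate ?R = ?g' ` P \<inter> hplane (lin ?g' v0)"
    unfolding mR v0(3) by (simp add: isom_image_Int isom_image_hplane g')
  have sub: "hplane m2 \<subseteq> hplane (lin ?g' v0)"
    by (rule facet_hyperplane [OF c d]) (use F F' in blast)
  have pos: "0 < lor m2 m2" using corner_spacelike [OF c] .
  have k: "lin ?g' v0 = (lor (lin ?g' v0) m2 / lor m2 m2) *\<^sub>R m2" (is "_ = ?k *\<^sub>R m2")
    by (rule hplane_subset_parallel [of y, OF _ sub pos]) (use y in \<open>simp add: hplane_def\<close>)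
  have "0 < lor (lin ?g' v0) (lin ?g' v0)"
    using defining_normals_spacelike [OF v0(1,2)] by (simp add: lor_lin g')
  then have "?k \<noteq> 0" using k by auto
  then have hp: "hplane (lin ?g' v0) = hplane m2" by (metis k hplane_scaleR)
  show F'': "?g' ` P \<inter> hplane m2 = g ` P \<inter> hplane m2" using F F' hp by simp
  have "mate ?R \<inter> interior P = {}" using fr by (auto simp: frontier_def)
  then have "?g' ` (mate ?R \<inter> interior P) = {}" by simp
  then show "g ` P \<inter> hplane m2 \<inter> interior (?g' ` P) = {}"
    by (simp add: isom_image_Int isom_image_interior g' F)
  have "?g' ` (?s ` interior P \<inter> interior P) = {}" using sp(3) by simp
  then have "(?g' \<circ> ?s) ` interior P \<inter> ?g' ` interior P = {}"
    by (simp add: isom_image_Int g' image_comp)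
  then show "interior (g ` P) \<inter> interior (?g' ` P) = {}"
    unfolding g's by (simp add: isom_image_interior g g')
  have "facet ?g' m2 = inv_into UNIV ?g' ` (?g' ` mate ?R)"
    by (simp only: facet_def [of ?g' m2] F'' F)
  then show "?s ` ?R = facet ?g' m2"
    by (simp add: sp(2) image_inv_f_f isomD(1) bij_is_inj g')
qed

end

section \<open>Angles around a subspace of codimension two\<close>

definition dir :: "(real ^ 'n) \<times> real \<Rightarrow> (real ^ 'n) \<times> real \<Rightarrow> real \<Rightarrow> (real ^ 'n) \<times> real" where
  "dir a c \<phi> = cos \<phi> *\<^sub>R a + sin \<phi> *\<^sub>R c"

lemma dir_shift [simp]:
  "dir a c (\<phi> + pi) = - dir a c \<phi>" "dir a c (\<phi> + 2 * pi) = dir a c \<phi>"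
  by (simp_all add: dir_def)

lemma dir_periodic: "dir a c (\<phi> + of_int k * (2 * pi)) = dir a c \<phi>"
  by (simp add: dir_def cos_add sin_add mult.commute [of "of_int k"] cos_int_2pin sin_int_2pin)

text \<open>The linear relation between three vectors of a plane. For \<omega> between \<phi> and
  \<psi>, less than a half turn apart, all coefficients are nonnegative, as \<open>corner\<close>
  demands.\<close>

lemma dir_combination:
  "sin (\<psi> - \<phi>) *\<^sub>R dir a c \<omega> = sin (\<psi> - \<omega>) *\<^sub>R dir a c \<phi> + sin (\<omega> - \<phi>) *\<^sub>R dir a c \<psi>"
proof -
  have "sin (\<psi> - \<phi>) * cos \<omega> = sin (\<psi> - \<omega>) * cos \<phi> + sin (\<omega> - \<phi>) * cos \<psi>"
    "sin (\<psi> - \<phi>) * sin \<omega> = sin (\<psi> - \<omega>) * sin \<phi> + sin (\<omega> - \<phi>) * sin \<psi>"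
    by (simp_all add: sin_diff algebra_simps)
  then have "(sin (\<psi> - \<phi>) * cos \<omega>) *\<^sub>R a + (sin (\<psi> - \<phi>) * sin \<omega>) *\<^sub>R c =
     (sin (\<psi> - \<omega>) * cos \<phi> + sin (\<omega> - \<phi>) * cos \<psi>) *\<^sub>R a +
     (sin (\<psi> - \<omega>) * sin \<phi> + sin (\<omega> - \<phi>) * sin \<psi>) *\<^sub>R c" by simp
  then show ?thesis
    by (simp add: dir_def scaleR_add_left scaleR_add_right)
qed

lemma dir_add_half: "dir a c (\<phi> + pi / 2) = cos \<phi> *\<^sub>R c - sin \<phi> *\<^sub>R a"
  by (simp add: dir_def cos_add sin_add)

locale frame =
  fixes a c :: "(real ^ 'n::finite) \<times> real"
  assumes orthonormal: "lor a a = 1" "lor c c = 1" "lor a c = 0"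
begin

lemma lor_dir: "lor (dir a c \<phi>) (dir a c \<psi>) = cos (\<phi> - \<psi>)"
  using orthonormal lor_commute [of c a] by (simp add: dir_def cos_diff)

lemma lor_perp_dir: "lor (dir a c (\<phi> + pi / 2)) (dir a c \<psi>) = sin (\<psi> - \<phi>)"
proof -
  have "cos (\<phi> + pi / 2 - \<psi>) = sin (\<psi> - \<phi>)"
    using cos_sin_eq [of "\<phi> + pi / 2 - \<psi>"] by simp
  then show ?thesis by (simp add: lor_dir)
qed

lemma dir_ortho:
  "lor a (hvec p) = 0 \<Longrightarrow> lor c (hvec p) = 0 \<Longrightarrow> lor (dir a c \<phi>) (hvec p) = 0"
  by (simp add: dir_def)

lemma span_coords:
  assumes "lor m a = x" "lor m c = y" "m = x *\<^sub>R a + y *\<^sub>R c"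
  shows "m = lor m (dir a c \<psi>) *\<^sub>R dir a c \<psi> + lor m (dir a c (\<psi> + pi/2)) *\<^sub>R dir a c (\<psi> + pi/2)"
proof -
  have 1: "cos \<psi> * cos \<psi> + sin \<psi> * sin \<psi> = 1"
    by (metis sin_cos_squared_add3 add.commute)
  have m: "lor m (dir a c \<psi>) = x * cos \<psi> + y * sin \<psi>"
    "lor m (dir a c (\<psi> + pi/2)) = y * cos \<psi> - x * sin \<psi>"
    unfolding dir_add_half using assms(1,2) by (simp_all add: dir_def)
  have "(x * cos \<psi> + y * sin \<psi>) * cos \<psi> - (y * cos \<psi> - x * sin \<psi>) * sin \<psi> = x"
    "(x * cos \<psi> + y * sin \<psi>) * sin \<psi> + (y * cos \<psi> - x * sin \<psi>) * cos \<psi> = y"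
    using 1 by algebra+
  then have "x *\<^sub>R a + y *\<^sub>R c = ((x * cos \<psi> + y * sin \<psi>) * cos \<psi> - (y * cos \<psi> - x * sin \<psi>) * sin \<psi>) *\<^sub>R a +
    ((x * cos \<psi> + y * sin \<psi>) * sin \<psi> + (y * cos \<psi> - x * sin \<psi>) * cos \<psi>) *\<^sub>R c"
    by simp
  also have "\<dots> = (x * cos \<psi> + y * sin \<psi>) *\<^sub>R dir a c \<psi> + (y * cos \<psi> - x * sin \<psi>) *\<^sub>R dir a c (\<psi> + pi/2)"
    by (simp add: dir_def cos_add sin_add scaleR_add_right scaleR_diff_right scaleR_add_left scaleR_diff_left)
  finally show ?thesis unfolding m using assms(3) by simp
qed

lemma hplane_dir_subsetD:
  assumes "hplane (dir a c \<phi>) \<subseteq> hplane (dir a c \<psi>)"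
  shows "sin (\<psi> - \<phi>) = 0"
proof -
  have pos: "0 < lor (dir a c \<phi>) (dir a c \<phi>)" by (simp add: lor_dir)
  then obtain y where "y \<in> hplane (dir a c \<phi>)" using hplane_nonempty by blast
  from hplane_subset_parallel [OF this assms pos]
  have "dir a c \<psi> = cos (\<psi> - \<phi>) *\<^sub>R dir a c \<phi>" by (simp add: lor_dir)
  then have "lor (dir a c (\<phi> + pi/2)) (dir a c \<psi>) = cos (\<psi> - \<phi>) * lor (dir a c (\<phi> + pi/2)) (dir a c \<phi>)"
    by simp
  then show ?thesis by (simp add: lor_perp_dir)
qed

end

text \<open>Polar coordinates in the open right half-plane, with radius \<alpha> / cos
  \<tau>.\<close>

lemma tan_polar:
  assumes "0 < \<alpha>"
  obtains \<tau> where "- (pi/2) < \<tau>" "\<tau> < pi/2" "0 < cos \<tau>" "\<beta> = \<alpha> / cos \<tau> * sin \<tau>"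
proof -
  define \<tau> where "\<tau> = arctan (\<beta> / \<alpha>)"
  have "- (pi/2) < \<tau>" "\<tau> < pi/2" unfolding \<tau>_def by (rule arctan_lbound arctan_ubound)+
  moreover from this have "0 < cos \<tau>" by (simp add: cos_gt_zero_pi)
  moreover have "tan \<tau> = \<beta> / \<alpha>" by (simp add: \<tau>_def tan_arctan)
  then have "\<beta> = \<alpha> / cos \<tau> * sin \<tau>" using assms by (simp add: tan_def field_simps)
  ultimately show ?thesis using that by blast
qed

section \<open>Tiles as sectors around a generic point of the axis\<close>

locale framed_tessellation = tessellation P N G + frame a c
  for P :: "'n::finite hyp set" and N G a c +
  fixes y :: "'n hyp"
  assumes gen: "generic (hplane a \<inter> hplane c) y"
begin

abbreviation e :: "real \<Rightarrow> (real ^ 'n) \<times> real" where "e \<equiv> dir a c"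
abbreviation n :: "real \<Rightarrow> (real ^ 'n) \<times> real" where "n \<phi> \<equiv> dir a c (\<phi> + pi / 2)"

text \<open>Near \<open>y\<close>, the tile \<open>g ` P\<close> consists of the points in directions \<open>e \<phi>\<close> with \<open>\<phi>1 \<le> \<phi> \<le> \<phi>2\<close>.\<close>

definition sector :: "('n hyp \<Rightarrow> 'n hyp) \<Rightarrow> real \<Rightarrow> real \<Rightarrow> bool" where
  "sector g \<phi>1 \<phi>2 \<longleftrightarrow> \<phi>1 < \<phi>2 \<and> \<phi>2 \<le> \<phi>1 + pi \<and> corner g y (- n \<phi>1) (n \<phi>2)"

lemma y_ortho [simp]: "lor a (hvec y) = 0" "lor c (hvec y) = 0" "lor (e \<phi>) (hvec y) = 0"
  using gen by (auto simp: generic_def hplane_def dir_def)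

lemma active_span:
  assumes "g \<in> G" "y \<in> g ` P" "v \<in> N" "lor (lin g v) (hvec y) = 0"
  shows "lin g v = lor (lin g v) a *\<^sub>R a + lor (lin g v) c *\<^sub>R c"
proof -
  let ?m = "lin g v"
  have "hplane a \<inter> hplane c \<subseteq> hplane ?m" using gen assms by (simp add: generic_def)
  then have sub: "subspace_of {a, c} \<subseteq> hplane (?m - (lor ?m a *\<^sub>R a + lor ?m c *\<^sub>R c))"
    by (auto simp: subspace_of_def hplane_def)
  have "y \<in> subspace_of {a, c}" by (simp add: subspace_of_def)
  then have "?m - (lor ?m a *\<^sub>R a + lor ?m c *\<^sub>R c) = 0"
  proof (rule orthogonal_subspace_zero [OF _ sub])
    fix b assume "b \<in> {a, c}"
    then consider "b = a" | "b = c" by blast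
    then show "lor b (?m - (lor ?m a *\<^sub>R a + lor ?m c *\<^sub>R c)) = 0"
      using orthonormal lor_commute [of c a] lor_commute [of a ?m] lor_commute [of c ?m]
      by cases simp_all
  qed
  then show ?thesis by simp
qed

text \<open>The active normals span at most the plane of \<open>a\<close> and \<open>c\<close>, and
  an interior point confines them to an open half-plane. There they are ordered by angle, and the
  two extreme ones generate the rest.\<close>

lemma sector_exists:
  assumes g: "g \<in> G" and yP: "y \<in> g ` P"
  shows "y \<in> interior (g ` P) \<or> (\<exists>\<phi>1 \<phi>2. sector g \<phi>1 \<phi>2)"
proof -
  define A where "A = {v \<in> N. lor (lin g v) (hvec y) = 0}"
  show ?thesis
  proof (cases "A = {}")
    case True
    have "lor (lin g w) (hvec y) < 0" if w: "w \<in> N" for w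
    proof -
      have "lor (lin g w) (hvec y) \<le> 0" using yP w g by (simp add: mem_tile)
      moreover have "lor (lin g w) (hvec y) \<noteq> 0" using True w unfolding A_def by blast
      ultimately show ?thesis by simp
    qed
    then show ?thesis by (simp add: mem_interior_tile g)
  next
    case False
    obtain z where z: "z \<in> interior (g ` P)" using interior_tile_nonempty [OF g] by blast
    \<comment> \<open>The signs are chosen so that active normals, being negative at
      \<open>z\<close>, have positive product with the direction \<psi> of
      \<open>(x0, y0)\<close>.\<close>
    define x0 y0 where xy0: "x0 = - lor a (hvec z)" "y0 = - lor c (hvec z)"
    define \<rho> where "\<rho> = sqrt (x0\<^sup>2 + y0\<^sup>2)"
    have neg: "lor (lin g v) (hvec z) < 0" if v: "v \<in> A" for v
      using z v by (simp add: mem_interior_tile g A_def)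
    have coord: "lor (lin g v) (hvec z) = - (lor (lin g v) a * x0 + lor (lin g v) c * y0)" if v: "v \<in> A" for v
    proof -
      have "lor (lin g v) (hvec z) = lor (lor (lin g v) a *\<^sub>R a + lor (lin g v) c *\<^sub>R c) (hvec z)"
        using active_span [OF g yP] v by (simp add: A_def)
      then show ?thesis by (simp add: xy0)
    qed
    obtain v0 where v0: "v0 \<in> A" using False by blast
    have "x0 \<noteq> 0 \<or> y0 \<noteq> 0" using neg [OF v0] coord [OF v0] by auto
    then have \<rho>: "0 < \<rho>" by (simp add: \<rho>_def sum_power2_gt_zero_iff)
    have "(x0 / \<rho>)\<^sup>2 + (y0 / \<rho>)\<^sup>2 = (x0\<^sup>2 + y0\<^sup>2) / \<rho>\<^sup>2"
      by (simp add: power_divide add_divide_distrib)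
    also have "\<rho>\<^sup>2 = x0\<^sup>2 + y0\<^sup>2" by (simp add: \<rho>_def)
    finally have "(x0 / \<rho>)\<^sup>2 + (y0 / \<rho>)\<^sup>2 = 1"
      using \<open>x0 \<noteq> 0 \<or> y0 \<noteq> 0\<close> by (simp add: sum_power2_eq_zero_iff)
    then obtain \<psi> where "x0 / \<rho> = cos \<psi>" "y0 / \<rho> = sin \<psi>" by (metis sincos_total_2pi)
    then have \<psi>: "x0 = \<rho> * cos \<psi>" "y0 = \<rho> * sin \<psi>" using \<rho> by (simp_all add: field_simps)
    have polar: "\<exists>\<tau> r. - (pi/2) < \<tau> \<and> \<tau> < pi/2 \<and> 0 < r \<and> lin g v = r *\<^sub>R e (\<psi> + \<tau>)" if v: "v \<in> A" for v
    proof -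
      define \<alpha> \<beta> where \<alpha>\<beta>: "\<alpha> = lor (lin g v) (e \<psi>)" "\<beta> = lor (lin g v) (n \<psi>)"
      have "\<rho> * \<alpha> > 0"
        using neg [OF v] coord [OF v] unfolding \<psi> \<alpha>\<beta> by (simp add: dir_def algebra_simps)
      then have "0 < \<alpha>" using \<rho> by (simp add: zero_less_mult_iff)
      then obtain \<tau> where \<tau>: "- (pi/2) < \<tau>" "\<tau> < pi/2" "0 < cos \<tau>" "\<beta> = \<alpha> / cos \<tau> * sin \<tau>"
        by (rule tan_polar)
      have "lin g v = \<alpha> *\<^sub>R e \<psi> + \<beta> *\<^sub>R n \<psi>"
        unfolding \<alpha>\<beta> by (rule span_coords [OF refl refl]) (use active_span [OF g yP] v in \<open>simp add: A_def\<close>)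
      also have "\<dots> = (\<alpha> / cos \<tau>) *\<^sub>R (cos \<tau> *\<^sub>R e \<psi> + sin \<tau> *\<^sub>R n \<psi>)"
        using \<tau>(3,4) by (simp add: scaleR_add_right)
      also have "cos \<tau> *\<^sub>R e \<psi> + sin \<tau> *\<^sub>R n \<psi> = e (\<psi> + \<tau>)"
        unfolding dir_add_half by (simp add: dir_def cos_add sin_add algebra_simps)
      finally show ?thesis using \<tau> \<open>0 < \<alpha>\<close> by (metis divide_pos_pos)
    qed
    \<comment> \<open>Angles instead of normals: \<open>N\<close> may contain many multiples of one
      normal, whereas distinct angles in this range have distinct walls, so local finiteness
      applies.\<close>
    define T where "T = {\<tau>. - (pi/2) < \<tau> \<and> \<tau> < pi/2 \<and> (\<exists>v\<in>A. \<exists>r>0. lin g v = r *\<^sub>R e (\<psi> + \<tau>))}"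
    have Tb: "- (pi/2) < \<tau>" "\<tau> < pi/2" if "\<tau> \<in> T" for \<tau> using that by (auto simp: T_def)
    have "inj_on (\<lambda>\<tau>. hplane (e (\<psi> + \<tau>)) :: 'n hyp set) T"
    proof (rule inj_onI)
      fix \<sigma> \<tau> assume *: "\<sigma> \<in> T" "\<tau> \<in> T" "(hplane (e (\<psi> + \<sigma>)) :: 'n hyp set) = hplane (e (\<psi> + \<tau>))"
      then have "sin (\<psi> + \<tau> - (\<psi> + \<sigma>)) = 0" by (intro hplane_dir_subsetD) simp
      then have "sin (\<tau> - \<sigma>) = 0" by simp
      moreover have "- pi < \<tau> - \<sigma>" "\<tau> - \<sigma> < pi" using Tb [OF *(1)] Tb [OF *(2)] by auto
      ultimately show "\<sigma> = \<tau>" using sin_eq_0_pi by fastforce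
    qed
    moreover have "finite ((\<lambda>\<tau>. hplane (e (\<psi> + \<tau>)) :: 'n hyp set) ` T)"
    proof -
      obtain \<epsilon> where \<epsilon>: "0 < \<epsilon>"
        "finite {K \<in> (\<lambda>v. UNIV \<inter> hplane v) ` N. K \<inter> ball (inv_into UNIV g y) \<epsilon> \<noteq> {}}"
        by (rule defining_normals_finite [OF normals UNIV_I])
      have "(\<lambda>\<tau>. hplane (e (\<psi> + \<tau>))) ` T \<subseteq>
          (`) g ` {K \<in> (\<lambda>v. UNIV \<inter> hplane v) ` N. K \<inter> ball (inv_into UNIV g y) \<epsilon> \<noteq> {}}"
      proof
        fix K :: "'n hyp set" assume "K \<in> (\<lambda>\<tau>. hplane (e (\<psi> + \<tau>))) ` T"
        then obtain \<tau> v r where K: "K = hplane (e (\<psi> + \<tau>))" and v: "v \<in> A" "0 < r" "lin g v = r *\<^sub>R e (\<psi> + \<tau>)"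
          unfolding T_def by blast
        then have "K = g ` hplane v" by (simp add: isom_image_hplane g hplane_scaleR)
        moreover have "inv_into UNIV g y \<in> hplane v"
          using v(1) by (simp add: hplane_def A_def lor_lin_inv g)
        ultimately show "K \<in> (`) g ` {K \<in> (\<lambda>v. UNIV \<inter> hplane v) ` N. K \<inter> ball (inv_into UNIV g y) \<epsilon> \<noteq> {}}"
          using v(1) \<epsilon>(1) unfolding A_def by (intro image_eqI [of _ _ "hplane v"]) auto
      qed
      then show ?thesis using finite_surj \<epsilon>(2) by blast
    qed
    ultimately have finT: "finite T" using finite_imageD by blast
    have AT: "\<exists>\<tau>\<in>T. \<exists>r>0. lin g v = r *\<^sub>R e (\<psi> + \<tau>)" if v: "v \<in> A" for v
      using polar [OF v] v unfolding T_def by blast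
    then have neT: "T \<noteq> {}" using v0 by blast
    define lo hi where lohi: "lo = Min T" "hi = Max T"
    have lo: "lo \<in> T" and hi: "hi \<in> T" and le: "\<And>\<tau>. \<tau> \<in> T \<Longrightarrow> lo \<le> \<tau> \<and> \<tau> \<le> hi"
      using finT neT by (auto simp: lohi)
    \<comment> \<open>Solved from \<open>- n \<phi>1 = e (\<psi> + hi)\<close> and
      \<open>n \<phi>2 = e (\<psi> + lo)\<close>, with representatives such that the width is \<pi>
      - (hi - lo).\<close>
    define \<phi>1 \<phi>2 where \<phi>: "\<phi>1 = \<psi> + hi + pi/2" "\<phi>2 = \<psi> + lo + 3 * pi/2"
    have "\<phi>1 + pi/2 = \<psi> + hi + pi" "\<phi>2 + pi/2 = \<psi> + lo + 2 * pi" by (simp_all add: \<phi>)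
    then have m: "- n \<phi>1 = e (\<psi> + hi)" "n \<phi>2 = e (\<psi> + lo)" by (simp_all only: dir_shift minus_minus)
    have "\<phi>1 < \<phi>2" "\<phi>2 \<le> \<phi>1 + pi" using Tb [OF lo] Tb [OF hi] le [OF lo] by (simp_all add: \<phi>)
    moreover have "corner g y (- n \<phi>1) (n \<phi>2)"
      unfolding m corner_def
    proof (intro conjI ballI impI g yP y_ortho)
      show "\<exists>v\<in>N. \<exists>r>0. lin g v = r *\<^sub>R e (\<psi> + hi)" "\<exists>v\<in>N. \<exists>r>0. lin g v = r *\<^sub>R e (\<psi> + lo)"
        using lo hi by (auto simp: T_def A_def)
      fix v assume "v \<in> N" "lor (lin g v) (hvec y) = 0"
      then have "v \<in> A" by (simp add: A_def)
      then obtain \<tau> r where \<tau>: "\<tau> \<in> T" "0 < r" "lin g v = r *\<^sub>R e (\<psi> + \<tau>)" using AT by blast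
      show "\<exists>s t. 0 \<le> s \<and> 0 \<le> t \<and> lin g v = s *\<^sub>R e (\<psi> + hi) + t *\<^sub>R e (\<psi> + lo)"
      proof (cases "lo = hi")
        case True
        then have "\<tau> = hi" using le [OF \<tau>(1)] by simp
        then show ?thesis using \<tau> by (intro exI [of _ r] exI [of _ 0]) simp
      next
        case False
        then have lt: "lo < hi" using le [OF lo] by simp
        define \<sigma> where "\<sigma> = sin (hi - lo)"
        have \<sigma>: "0 < \<sigma>" using lt Tb [OF lo] Tb [OF hi] unfolding \<sigma>_def by (intro sin_gt_zero) auto
        have s: "0 \<le> sin (\<tau> - lo)" "0 \<le> sin (hi - \<tau>)"
          using le [OF \<tau>(1)] Tb [OF lo] Tb [OF hi] Tb [OF \<tau>(1)] by (auto intro!: sin_ge_zero)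
        have "\<sigma> *\<^sub>R e (\<psi> + \<tau>) = sin (\<tau> - lo) *\<^sub>R e (\<psi> + hi) + sin (hi - \<tau>) *\<^sub>R e (\<psi> + lo)"
          using dir_combination [of "\<psi> + hi" "\<psi> + lo" a c "\<psi> + \<tau>"] by (simp add: \<sigma>_def add.commute)
        then have "(r / \<sigma>) *\<^sub>R (\<sigma> *\<^sub>R e (\<psi> + \<tau>)) =
            (r / \<sigma>) *\<^sub>R (sin (\<tau> - lo) *\<^sub>R e (\<psi> + hi) + sin (hi - \<tau>) *\<^sub>R e (\<psi> + lo))" by simp
        then have "lin g v = (r / \<sigma> * sin (\<tau> - lo)) *\<^sub>R e (\<psi> + hi) + (r / \<sigma> * sin (hi - \<tau>)) *\<^sub>R e (\<psi> + lo)"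
          using \<sigma> \<tau>(3) by (simp add: scaleR_add_right)
        moreover have "0 \<le> r / \<sigma> * sin (\<tau> - lo)" "0 \<le> r / \<sigma> * sin (hi - \<tau>)"
          using s \<sigma> \<tau>(2) by simp_all
        ultimately show ?thesis by blast
      qed
    qed
    ultimately show ?thesis unfolding sector_def by blast
  qed
qed

lemma sector_periodic:
  assumes "sector g \<phi>1 \<phi>2"
  shows "sector g (\<phi>1 + of_int k * (2 * pi)) (\<phi>2 + of_int k * (2 * pi))"
proof -
  have "n (\<phi> + of_int k * (2 * pi)) = n \<phi>" for \<phi>
    using dir_periodic [of a c "\<phi> + pi / 2" k] by (simp add: algebra_simps)
  then show ?thesis using assms by (simp add: sector_def)
qed

lemma sector_mem: "sector g \<phi>1 \<phi>2 \<Longrightarrow> g \<in> G \<and> y \<in> g ` P"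
  by (simp add: sector_def corner_def)

text \<open>Signs of sines replace comparisons of angles because a direction fixes \<phi> only
  modulo 2\<pi>.\<close>

lemma sector_shift:
  assumes "sector g \<phi>1 \<phi>2"
  shows "\<forall>\<^sub>F t in at_right 0.
    (shift y (e \<phi>) t \<in> g ` P \<longleftrightarrow> 0 \<le> sin (\<phi> - \<phi>1) \<and> 0 \<le> sin (\<phi>2 - \<phi>)) \<and>
    (shift y (e \<phi>) t \<in> interior (g ` P) \<longleftrightarrow> 0 < sin (\<phi> - \<phi>1) \<and> 0 < sin (\<phi>2 - \<phi>))"
proof -
  have "lor (n \<phi>2) (e \<phi>) = - sin (\<phi>2 - \<phi>)" "lor (- n \<phi>1) (e \<phi>) = - sin (\<phi> - \<phi>1)"
    using sin_minus [of "\<phi>2 - \<phi>"] by (simp_all add: lor_perp_dir)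
  then show ?thesis
    using corner_shift [of g y "- n \<phi>1" "n \<phi>2" "e \<phi>"] assms by (simp add: sector_def)
qed

text \<open>The two alternatives in \<open>facet_dir\<close> are the wedge and the half-space, where
  both boundary rays lie on one wall and the two normals coincide.\<close>

lemma sector_facet_dir:
  assumes "sector g \<phi>1 \<phi>2"
  shows "facet_dir (- n \<phi>1) (n \<phi>2) (e \<phi>2)" "facet_dir (n \<phi>2) (- n \<phi>1) (e \<phi>1)"
proof -
  have *: "0 < sin (\<phi>2 - \<phi>1) \<or> - n \<phi>1 = n \<phi>2"
  proof (cases "\<phi>2 = \<phi>1 + pi")
    case True
    then have "\<phi>2 + pi / 2 = \<phi>1 + pi / 2 + pi" by simp
    then have "n \<phi>2 = - n \<phi>1" by (simp only: dir_shift)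
    then show ?thesis by simp
  next
    case False
    then show ?thesis using assms by (intro disjI1 sin_gt_zero) (auto simp: sector_def)
  qed
  then show "facet_dir (- n \<phi>1) (n \<phi>2) (e \<phi>2)" "facet_dir (n \<phi>2) (- n \<phi>1) (e \<phi>1)"
    using sin_minus [of "\<phi>2 - \<phi>1"] by (auto simp: facet_dir_def lor_perp_dir)
qed

lemma sector_unique:
  assumes "sector g \<phi>1 \<phi>2" "sector h \<psi>1 \<psi>2"
    and "0 < sin (\<omega> - \<phi>1)" "0 < sin (\<phi>2 - \<omega>)" "0 \<le> sin (\<omega> - \<psi>1)" "0 \<le> sin (\<psi>2 - \<omega>)"
  shows "g = h"
proof -
  have "\<forall>\<^sub>F t in at_right 0. shift y (e \<omega>) t \<in> interior (g ` P) \<and> shift y (e \<omega>) t \<in> h ` P"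
    using sector_shift [OF assms(1), of \<omega>] sector_shift [OF assms(2), of \<omega>]
    by eventually_elim (use assms in simp)
  then obtain t where "shift y (e \<omega>) t \<in> interior (g ` P) \<and> shift y (e \<omega>) t \<in> h ` P"
    by (rule eventually_at_right_ex)
  then show ?thesis using tile_eqI sector_mem assms(1,2) by blast
qed

end

lemma angle_normalize:
  obtains k :: int where "lo \<le> \<phi> + of_int k * (2 * pi)" "\<phi> + of_int k * (2 * pi) < lo + 2 * pi"
proof -
  define m where "m = \<lfloor>(\<phi> - lo) / (2 * pi)\<rfloor>"
  have "of_int m \<le> (\<phi> - lo) / (2 * pi)" "(\<phi> - lo) / (2 * pi) < of_int m + 1"
    unfolding m_def by linarith+
  then have "of_int m * (2 * pi) \<le> \<phi> - lo" "\<phi> - lo < (of_int m + 1) * (2 * pi)"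
    by (simp_all add: pos_le_divide_eq pos_divide_less_eq)
  then show ?thesis using that [of "- m"] by (simp add: algebra_simps)
qed

lemma sin_add_of_int: "sin (x + of_int k * (2 * pi)) = sin x"
  by (simp add: sin_add mult.commute [of "of_int k"] cos_int_2pin sin_int_2pin)

lemma sin_nonneg_le_pi:
  assumes "0 \<le> x" "x < 2 * pi" "0 \<le> sin x"
  shows "x \<le> pi"
  using assms sin_lt_zero [of x] by force

lemma sin_nonpos_iff:
  assumes "0 < x" "x \<le> pi"
  shows "sin x \<le> 0 \<longleftrightarrow> x = pi"
  using assms sin_gt_zero [of x] by force

lemma sector_boundary:
  assumes "\<psi>1 < \<psi>2" "\<psi>2 \<le> \<psi>1 + pi" "0 \<le> sin (\<phi> - \<psi>1)" "0 \<le> sin (\<psi>2 - \<phi>)"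
    and "\<not> (0 < sin (\<phi> - \<psi>1) \<and> 0 < sin (\<psi>2 - \<phi>))"
  shows "\<exists>k::int. \<phi> = \<psi>1 + of_int k * (2 * pi) \<or> \<phi> = \<psi>2 + of_int k * (2 * pi)"
proof -
  obtain k :: int where k: "\<psi>1 \<le> \<phi> + of_int k * (2 * pi)" "\<phi> + of_int k * (2 * pi) < \<psi>1 + 2 * pi"
    by (rule angle_normalize)
  define x w where xw: "x = \<phi> + of_int k * (2 * pi) - \<psi>1" "w = \<psi>2 - \<psi>1"
  have sx: "sin (\<phi> - \<psi>1) = sin x"
    using sin_add_of_int [of "\<phi> - \<psi>1" k] by (simp add: xw algebra_simps)
  have sw: "sin (\<psi>2 - \<phi>) = sin (w - x)"
    using sin_add_of_int [of "\<psi>2 - \<phi>" "- k"] by (simp add: xw algebra_simps)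
  have x: "0 \<le> x" "x < 2 * pi" using k by (auto simp: xw)
  then have "x \<le> pi" using sin_nonneg_le_pi assms(3) sx by simp
  have w: "0 < w" "w \<le> pi" using assms(1,2) by (auto simp: xw)
  have "x = 0 \<or> x = w"
  proof (cases "x = 0 \<or> x = pi")
    case True
    \<comment> \<open>The ray opposite to the initial one belongs to the closed sector only if that
      is a half-plane.\<close>
    moreover have "x = w" if "x = pi"
    proof -
      have "0 \<le> - sin w" using assms(4) sw that by (simp add: sin_diff)
      then show ?thesis using sin_nonpos_iff [OF w] that by simp
    qed
    ultimately show ?thesis by blast
  next
    case False
    then have "0 < sin x" using x \<open>x \<le> pi\<close> by (intro sin_gt_zero) auto
    then have "sin (w - x) = 0" using assms(4,5) sx sw by simp
    moreover have "- pi < w - x" "w - x < pi" using w x \<open>x \<le> pi\<close> False by auto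
    ultimately have "w - x = 0" using sin_eq_0_pi by blast
    then show ?thesis by simp
  qed
  then have "\<phi> = \<psi>1 + of_int (- k) * (2 * pi) \<or> \<phi> = \<psi>2 + of_int (- k) * (2 * pi)"
    by (auto simp: xw algebra_simps)
  then show ?thesis by blast
qed

lemma dist_geodesic:
  assumes "lor w (hvec p) = 0" "lor w w = 1" "0 \<le> t"
  shows "dist p (geodesic p w t) = t"
proof -
  have "lor (hvec p) w = 0" using assms(1) by (simp add: lor_commute)
  then have "cosh (dist p (geodesic p w t)) = cosh t"
    by (simp add: cosh_dist hvec_geodesic [OF assms(1,2)])
  then show ?thesis
    using assms(3) cosh_real_nonneg_le_iff [of t "dist p (geodesic p w t)"]
      cosh_real_nonneg_le_iff [of "dist p (geodesic p w t)" t] by simp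
qed

section \<open>The chase through adjacent sectors\<close>

locale framed_pairing = framed_tessellation P N G a c y + paired_tessellation P N G mate pr
  for P :: "'n::finite hyp set" and N G a c y mate pr
begin

lemma eventually_shift_hplane: "\<forall>\<^sub>F t in at_right 0. shift y (e \<phi>) t \<in> hplane (n \<phi>)"
  using eventually_shift_lor [of y "e \<phi>"]
proof eventually_elim
  case (elim t)
  then obtain r where "\<And>m. lor m (hvec y) = 0 \<Longrightarrow> lor m (hvec (shift y (e \<phi>) t)) = r * lor m (e \<phi>)" by blast
  from this [of "n \<phi>"] show ?case by (simp add: hplane_def lor_perp_dir)
qed

lemma n_add_pi: "n (\<phi> + pi) = - n \<phi>"
proof -
  have "\<phi> + pi + pi / 2 = \<phi> + pi / 2 + pi" by simp
  then show ?thesis by (simp only: dir_shift)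
qed

lemma sector_step:
  assumes s: "sector g \<phi>1 \<phi>2"
  shows "\<exists>\<phi>3. sector (neighbour g (n \<phi>2)) \<phi>2 \<phi>3 \<and> (\<phi>3 = \<phi>2 + pi \<longleftrightarrow> \<phi>2 = \<phi>1 + pi)"
proof -
  let ?g' = "neighbour g (n \<phi>2)"
  have c: "corner g y (- n \<phi>1) (n \<phi>2)" and lt: "\<phi>1 < \<phi>2" "\<phi>2 \<le> \<phi>1 + pi" using s by (auto simp: sector_def)
  note nb = neighbour [OF c sector_facet_dir(1) [OF s]]
  have g: "g \<in> G" and yg: "y \<in> g ` P" using sector_mem [OF s] by auto
  have yh: "y \<in> g ` P \<inter> hplane (n \<phi>2)" using yg by (simp add: hplane_def)
  then have "y \<in> ?g' ` P" "y \<notin> interior (?g' ` P)" using nb(2,3) by blast+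
  then obtain \<psi>1 \<psi>2 where s': "sector ?g' \<psi>1 \<psi>2" using sector_exists [OF nb(1)] by blast
  then have lt': "\<psi>1 < \<psi>2" "\<psi>2 \<le> \<psi>1 + pi" by (auto simp: sector_def)
  have nn: "0 \<le> sin (\<phi>2 - \<phi>1)" using lt by (intro sin_ge_zero) auto
  have "\<forall>\<^sub>F t in at_right (0::real). (0 \<le> sin (\<phi>2 - \<psi>1) \<and> 0 \<le> sin (\<psi>2 - \<phi>2)) \<and>
      \<not> (0 < sin (\<phi>2 - \<psi>1) \<and> 0 < sin (\<psi>2 - \<phi>2))"
    using sector_shift [OF s, of \<phi>2] sector_shift [OF s', of \<phi>2] eventually_shift_hplane [of \<phi>2]
  proof eventually_elim
    case (elim t)
    then have "shift y (e \<phi>2) t \<in> g ` P \<inter> hplane (n \<phi>2)" using nn by simp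
    then have "shift y (e \<phi>2) t \<in> ?g' ` P" "shift y (e \<phi>2) t \<notin> interior (?g' ` P)"
      using nb(2,3) by blast+
    then show ?case using elim by blast
  qed
  \<comment> \<open>The signs do not depend on \<open>t\<close>; a point of the common facet was
    needed only to read them off.\<close>
  then have sgn: "0 \<le> sin (\<phi>2 - \<psi>1)" "0 \<le> sin (\<psi>2 - \<phi>2)" "\<not> (0 < sin (\<phi>2 - \<psi>1) \<and> 0 < sin (\<psi>2 - \<phi>2))"
    by (auto elim: eventually_at_right_ex)
  have bad: "\<phi>2 \<noteq> \<psi>2 + of_int k * (2 * pi)" for k :: int
  proof
    assume eq: "\<phi>2 = \<psi>2 + of_int k * (2 * pi)"
    \<comment> \<open>Less than both widths, so that the direction \<phi>2 - \<tau> is interior to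
      both sectors.\<close>
    define \<tau> where "\<tau> = min (\<phi>2 - \<phi>1) (\<psi>2 - \<psi>1) / 2"
    have \<tau>: "0 < \<tau>" "\<tau> < \<phi>2 - \<phi>1" "\<tau> < \<psi>2 - \<psi>1" "\<tau> < pi"
      using lt lt' unfolding \<tau>_def by auto
    have 1: "0 < sin (\<phi>2 - \<tau> - \<phi>1)" "0 < sin (\<phi>2 - (\<phi>2 - \<tau>))"
      using \<tau> lt by (intro sin_gt_zero; simp)+
    have "sin (\<phi>2 - \<tau> - \<psi>1) = sin (\<psi>2 - \<tau> - \<psi>1)"
      using sin_add_of_int [of "\<psi>2 - \<tau> - \<psi>1" k] by (simp add: eq algebra_simps)
    moreover have "0 < sin (\<psi>2 - \<tau> - \<psi>1)" using \<tau> lt' by (intro sin_gt_zero) auto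
    moreover have "sin (\<psi>2 - (\<phi>2 - \<tau>)) = sin \<tau>"
      using sin_add_of_int [of \<tau> "- k"] by (simp add: eq algebra_simps)
    moreover have "0 < sin \<tau>" using \<tau> by (intro sin_gt_zero) auto
    ultimately have 2: "0 < sin (\<phi>2 - \<tau> - \<psi>1)" "0 < sin (\<psi>2 - (\<phi>2 - \<tau>))" by simp_all
    have "\<forall>\<^sub>F t in at_right 0. shift y (e (\<phi>2 - \<tau>)) t \<in> interior (g ` P) \<inter> interior (?g' ` P)"
      using sector_shift [OF s, of "\<phi>2 - \<tau>"] sector_shift [OF s', of "\<phi>2 - \<tau>"]
      by eventually_elim (use 1 2 in simp)
    then show False using nb(4) by (auto elim: eventually_at_right_ex)
  qed
  obtain k :: int where k: "\<phi>2 = \<psi>1 + of_int k * (2 * pi)"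
    using sector_boundary [OF lt' sgn] bad by blast
  define \<phi>3 where "\<phi>3 = \<psi>2 + of_int k * (2 * pi)"
  have s3: "sector ?g' \<phi>2 \<phi>3" using sector_periodic [OF s', of k] by (simp only: k [symmetric] \<phi>3_def)
  then have lt3: "\<phi>2 < \<phi>3" "\<phi>3 \<le> \<phi>2 + pi" by (auto simp: sector_def)
  have "\<forall>\<^sub>F t in at_right (0::real). sin (\<phi>2 - \<phi>1) \<le> 0 \<longleftrightarrow> sin (\<phi>3 - \<phi>2) \<le> 0"
    using sector_shift [OF s, of "\<phi>2 + pi"] sector_shift [OF s3, of "\<phi>2 + pi"]
      eventually_shift_hplane [of "\<phi>2 + pi"]
  proof eventually_elim
    case (elim t)
    \<comment> \<open>The opposite ray lies on the same wall, so it belongs to both tiles or to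
      neither; it belongs to a tile exactly when that is a half-space at \<open>y\<close>.\<close>
    have "shift y (e (\<phi>2 + pi)) t \<in> hplane (n \<phi>2)" using elim(3) by (simp only: n_add_pi hplane_uminus)
    then have "shift y (e (\<phi>2 + pi)) t \<in> g ` P \<longleftrightarrow> shift y (e (\<phi>2 + pi)) t \<in> ?g' ` P"
      using nb(2) by blast
    then have "0 \<le> sin (\<phi>2 + pi - \<phi>1) \<longleftrightarrow> 0 \<le> sin (\<phi>3 - (\<phi>2 + pi))" using elim by simp
    moreover have "sin (\<phi>2 + pi - \<phi>1) = - sin (\<phi>2 - \<phi>1)"
      using sin_periodic_pi [of "\<phi>2 - \<phi>1"] by (simp add: algebra_simps)
    moreover have "sin (\<phi>3 - (\<phi>2 + pi)) = - sin (\<phi>3 - \<phi>2)"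
      using sin_periodic_pi [of "\<phi>3 - \<phi>2 - pi"] by (simp add: algebra_simps)
    ultimately show ?case by simp
  qed
  then have "sin (\<phi>2 - \<phi>1) \<le> 0 \<longleftrightarrow> sin (\<phi>3 - \<phi>2) \<le> 0" by (auto elim: eventually_at_right_ex)
  then have "\<phi>3 = \<phi>2 + pi \<longleftrightarrow> \<phi>2 = \<phi>1 + pi"
    using sin_nonpos_iff [of "\<phi>2 - \<phi>1"] sin_nonpos_iff [of "\<phi>3 - \<phi>2"] lt lt3 by auto
  then show ?thesis using s3 by blast
qed

text \<open>The angles are lifted to the real line and keep increasing, so that turns are not lost;
  widths below \<pi> guarantee an edge in every tile.\<close>

definition sector_chase :: "(nat \<Rightarrow> 'n hyp \<Rightarrow> 'n hyp) \<Rightarrow> (nat \<Rightarrow> real) \<Rightarrow> bool" where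
  "sector_chase h \<Theta> \<longleftrightarrow> (\<forall>i. sector (h i) (\<Theta> i) (\<Theta> (Suc i)) \<and> \<Theta> (Suc i) < \<Theta> i + pi \<and>
     h (Suc i) = neighbour (h i) (n (\<Theta> (Suc i))))"

lemma sector_chase_exists:
  assumes "sector g \<phi>1 \<phi>2" "\<phi>2 < \<phi>1 + pi"
  obtains h \<Theta> where "sector_chase h \<Theta>" "h 0 = g" "\<Theta> 0 = \<phi>1"
proof -
  \<comment> \<open>The state is a tile with its two boundary angles; the clause for 0 pins the
    start. The equivalence in \<open>sector_step\<close> keeps the width below \<pi>.\<close>
  define Q where "Q = (\<lambda>i (x :: ('n hyp \<Rightarrow> 'n hyp) \<times> real \<times> real).
    (i = (0::nat) \<longrightarrow> x = (g, \<phi>1, \<phi>2)) \<and> sector (fst x) (fst (snd x)) (snd (snd x)) \<and> snd (snd x) < fst (snd x) + pi)"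
  define R where "R = (\<lambda>(x :: ('n hyp \<Rightarrow> 'n hyp) \<times> real \<times> real) (x' :: ('n hyp \<Rightarrow> 'n hyp) \<times> real \<times> real).
    fst x' = neighbour (fst x) (n (snd (snd x))) \<and> fst (snd x') = snd (snd x))"
  have "\<exists>f. \<forall>i. Q i (f i) \<and> R (f i) (f (Suc i))"
  proof (rule dependent_nat_choice)
    show "\<exists>x. Q 0 x" using assms by (auto simp: Q_def)
    fix x i assume x: "Q i x"
    then obtain \<phi>3 where "sector (neighbour (fst x) (n (snd (snd x)))) (snd (snd x)) \<phi>3"
        "\<phi>3 = snd (snd x) + pi \<longleftrightarrow> snd (snd x) = fst (snd x) + pi"
      using sector_step unfolding Q_def by blast
    moreover from this have "\<phi>3 \<le> snd (snd x) + pi" by (simp add: sector_def)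
    ultimately have "Q (Suc i) (neighbour (fst x) (n (snd (snd x))), snd (snd x), \<phi>3)"
      using x by (simp add: Q_def)
    moreover have "R x (neighbour (fst x) (n (snd (snd x))), snd (snd x), \<phi>3)" by (simp add: R_def)
    ultimately show "\<exists>x'. Q (Suc i) x' \<and> R x x'" by blast
  qed
  then obtain f where f: "\<And>i. Q i (f i)" "\<And>i. R (f i) (f (Suc i))" by blast
  have "sector_chase (\<lambda>i. fst (f i)) (\<lambda>i. fst (snd (f i)))"
    unfolding sector_chase_def using f by (simp add: Q_def R_def)
  moreover have "f 0 = (g, \<phi>1, \<phi>2)" using f(1) [of 0] by (simp add: Q_def)
  ultimately show ?thesis using that by simp
qed

lemma sector_chase_less:
  assumes "sector_chase h \<Theta>" "i < j"
  shows "\<Theta> i < \<Theta> j"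
  by (rule lift_Suc_mono_less [OF _ assms(2)]) (use assms(1) in \<open>simp add: sector_chase_def sector_def\<close>)

text \<open>Otherwise the middle \<mu> of the later sector would also be interior to the earlier
  one, although it lies beyond its end and before its start one turn later.\<close>

lemma sector_chase_inj:
  assumes ch: "sector_chase h \<Theta>" and lt: "l < m" "\<Theta> (Suc m) < \<Theta> l + 2 * pi"
  shows "h l \<noteq> h m"
proof
  assume eq: "h l = h m"
  have sl: "sector (h l) (\<Theta> l) (\<Theta> (Suc l))" using ch by (simp add: sector_chase_def)
  have sm: "sector (h l) (\<Theta> m) (\<Theta> (Suc m))" unfolding eq using ch by (simp add: sector_chase_def)
  define \<mu> where "\<mu> = (\<Theta> m + \<Theta> (Suc m)) / 2"
  have lt_m: "\<Theta> m < \<Theta> (Suc m)" "\<Theta> (Suc m) \<le> \<Theta> m + pi" using sm by (auto simp: sector_def)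
  have mid: "0 < sin (\<mu> - \<Theta> m)" "0 < sin (\<Theta> (Suc m) - \<mu>)"
    using lt_m by (intro sin_gt_zero; simp add: \<mu>_def field_simps)+
  have "\<forall>\<^sub>F t in at_right (0::real). 0 < sin (\<mu> - \<Theta> l) \<and> 0 < sin (\<Theta> (Suc l) - \<mu>)"
    using sector_shift [OF sl, of \<mu>] sector_shift [OF sm, of \<mu>]
    by eventually_elim (use mid in blast)
  then have pos: "0 < sin (\<mu> - \<Theta> l)" "0 < sin (\<Theta> (Suc l) - \<mu>)" by (auto elim: eventually_at_right_ex)
  have "\<Theta> (Suc l) \<le> \<Theta> m"
    using sector_chase_less [OF ch, of "Suc l" m] lt(1) by (cases "Suc l = m") auto
  then have \<mu>: "\<Theta> (Suc l) < \<mu>" "\<mu> < \<Theta> l + 2 * pi" using lt_m lt(2) by (auto simp: \<mu>_def)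
  have "\<Theta> l < \<Theta> (Suc l)" using sl by (simp add: sector_def)
  have "\<mu> - \<Theta> l \<le> pi"
    using sin_nonneg_le_pi [of "\<mu> - \<Theta> l"] pos(1) \<mu> \<open>\<Theta> l < \<Theta> (Suc l)\<close> by simp
  then have "0 \<le> sin (\<mu> - \<Theta> (Suc l))"
    using \<mu> \<open>\<Theta> l < \<Theta> (Suc l)\<close> by (intro sin_ge_zero) auto
  then show False using pos(2) sin_minus [of "\<mu> - \<Theta> (Suc l)"] by simp
qed

lemma sector_middle:
  assumes "sector g \<psi>1 \<psi>2"
  shows "0 < sin ((\<psi>1 + \<psi>2) / 2 - \<psi>1)" "0 < sin (\<psi>2 - (\<psi>1 + \<psi>2) / 2)"
  using assms by (intro sin_gt_zero; simp add: sector_def field_simps)+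

text \<open>The chase cannot pass the middle direction \<psi> of the sector of \<open>k\<close>
  without meeting \<open>k\<close>. If it never passes, all its angles stay within one turn, its
  tiles are distinct, and infinitely many of them contain \<open>y\<close>.\<close>

lemma sector_chase_reaches:
  assumes ch: "sector_chase h \<Theta>" and k: "k \<in> G" "y \<in> k ` P"
  shows "\<exists>l. h l = k"
proof (rule ccontr)
  assume "\<nexists>l. h l = k"
  then have ne: "h l \<noteq> k" for l by blast
  have s: "sector (h i) (\<Theta> i) (\<Theta> (Suc i))" for i using ch by (simp add: sector_chase_def)
  have hG: "h i \<in> G" "y \<in> h i ` P" for i using sector_mem [OF s] by auto
  have "y \<notin> interior (k ` P)" using tile_eqI [OF k(1) hG(1) _ hG(2), of 0] ne by blast
  then obtain \<psi>1' \<psi>2' where s': "sector k \<psi>1' \<psi>2'" using sector_exists [OF k] by blast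
  obtain z :: int where z: "\<Theta> 0 \<le> (\<psi>1' + \<psi>2') / 2 + of_int z * (2 * pi)"
    "(\<psi>1' + \<psi>2') / 2 + of_int z * (2 * pi) < \<Theta> 0 + 2 * pi"
    by (rule angle_normalize)
  \<comment> \<open>The sector of \<open>k\<close> is moved by whole turns so that its middle falls
    into the first turn of the chase.\<close>
  define \<psi>1 \<psi>2 \<psi> where \<psi>: "\<psi>1 = \<psi>1' + of_int z * (2 * pi)" "\<psi>2 = \<psi>2' + of_int z * (2 * pi)" "\<psi> = (\<psi>1 + \<psi>2) / 2"
  have sk: "sector k \<psi>1 \<psi>2" unfolding \<psi> by (rule sector_periodic [OF s'])
  have zz: "\<Theta> 0 \<le> \<psi>" "\<psi> < \<Theta> 0 + 2 * pi" using z by (simp_all add: \<psi> field_simps)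
  have mid: "0 < sin (\<psi> - \<psi>1)" "0 < sin (\<psi>2 - \<psi>)"
    using sector_middle [OF sk] by (simp_all add: \<psi>(3))
  have le: "\<Theta> l \<le> \<psi>" for l
  proof (induction l)
    case (Suc l)
    have b: "\<Theta> (Suc l) \<le> \<Theta> l + pi" using s [of l] by (simp add: sector_def)
    show ?case
    proof (rule ccontr)
      assume "\<not> \<Theta> (Suc l) \<le> \<psi>"
      then have "0 \<le> sin (\<psi> - \<Theta> l)" "0 \<le> sin (\<Theta> (Suc l) - \<psi>)"
        using b Suc by (intro sin_ge_zero; simp)+
      then have "k = h l" using sector_unique [OF sk s mid] by blast
      then show False using ne [of l] by simp
    qed
  qed (use zz in simp)
  have "h l \<noteq> h m" if "l < m" for l m
  proof (rule sector_chase_inj [OF ch that])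
    have "\<Theta> 0 \<le> \<Theta> l" using sector_chase_less [OF ch, of 0 l] by (cases l) auto
    then show "\<Theta> (Suc m) < \<Theta> l + 2 * pi" using le [of "Suc m"] zz by simp
  qed
  then have "inj h" by (metis injI linorder_neqE_nat)
  obtain \<epsilon> where \<epsilon>: "0 < \<epsilon>" "finite {g \<in> G. g ` P \<inter> ball y \<epsilon> \<noteq> {}}" by (rule finite_tiles)
  have "y \<in> ball y \<epsilon>" using \<epsilon>(1) by simp
  then have "range h \<subseteq> {g \<in> G. g ` P \<inter> ball y \<epsilon> \<noteq> {}}" using hG by blast
  then have "finite (range h)" using \<epsilon>(2) finite_subset by blast
  then show False using \<open>inj h\<close> by (simp add: finite_image_iff)
qed

section \<open>Edges and angles of the polyhedron read off from a wedge\<close>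

lemma hplane_n_Int:
  assumes "sin (\<beta> - \<alpha>) \<noteq> 0"
  shows "hplane (n \<alpha>) \<inter> hplane (n \<beta>) = hplane a \<inter> hplane c"
proof -
  have "lor a (hvec p) = 0 \<and> lor c (hvec p) = 0"
    if p: "lor (n \<alpha>) (hvec p) = 0" "lor (n \<beta>) (hvec p) = 0" for p
  proof -
    have *: "sin (\<beta> - \<alpha>) * lor (e \<omega>) (hvec p) = 0" for \<omega>
    proof -
      have "lor (sin (\<beta> + pi/2 - (\<alpha> + pi/2)) *\<^sub>R e \<omega>) (hvec p) = 0"
        unfolding dir_combination [of "\<beta> + pi/2" "\<alpha> + pi/2" a c \<omega>] using p by simp
      then show ?thesis by simp
    qed
    have "e 0 = a" "e (pi/2) = c" by (simp_all add: dir_def)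
    then show ?thesis using * [of 0] * [of "pi/2"] assms by simp
  qed
  moreover have "lor (n \<alpha>) (hvec p) = 0" if "lor a (hvec p) = 0" "lor c (hvec p) = 0" for \<alpha> p
    using that by (rule dir_ortho)
  ultimately show ?thesis unfolding hplane_def by blast
qed

text \<open>For a wedge this is its ridge, written without the walls; so the two neighbours of a
  facet can be compared.\<close>

definition base :: "('n hyp \<Rightarrow> 'n hyp) \<Rightarrow> 'n hyp set" where
  "base g = inv_into UNIV g ` (g ` P \<inter> (hplane a \<inter> hplane c))"

lemma facet_uminus [simp]: "facet g (- m) = facet g m"
  by (simp add: facet_def)

context
  fixes g \<phi>1 \<phi>2
  assumes s: "sector g \<phi>1 \<phi>2" and wedge: "\<phi>2 < \<phi>1 + pi"
begin

lemma wedge_sin: "0 < sin (\<phi>2 - \<phi>1)"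
  using s wedge by (intro sin_gt_zero) (auto simp: sector_def)

lemma wedge_ridge: "ridge g (- n \<phi>1) (n \<phi>2) = base g"
  unfolding ridge_def base_def using hplane_n_Int [of \<phi>2 \<phi>1] wedge_sin by simp

lemma wedge_facets:
  "side P (facet g (n \<phi>1))" "side P (facet g (n \<phi>2))" "facet g (n \<phi>1) \<noteq> facet g (n \<phi>2)"
  "edge P (base g)" "base g = facet g (n \<phi>1) \<inter> facet g (n \<phi>2)"
proof -
  have g: "g \<in> G" using sector_mem [OF s] by blast
  have c: "corner g y (- n \<phi>1) (n \<phi>2)" using s by (simp add: sector_def)
  show "side P (facet g (n \<phi>1))"
    using facet_side [OF corner_sym [OF c] sector_facet_dir(2) [OF s]] by simp
  show "side P (facet g (n \<phi>2))"
    using facet_side [OF c sector_facet_dir(1) [OF s]] .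
  show "facet g (n \<phi>1) \<noteq> facet g (n \<phi>2)"
  proof
    assume eq: "facet g (n \<phi>1) = facet g (n \<phi>2)"
    have "g ` P \<inter> hplane (n \<phi>2) \<subseteq> hplane (n \<phi>1)"
      unfolding image_facet [OF g, symmetric] eq [symmetric] by (simp add: image_facet g)
    then have "hplane (n \<phi>2) \<subseteq> hplane (n \<phi>1)"
      by (rule facet_hyperplane [OF c sector_facet_dir(1) [OF s]])
    then have "sin (\<phi>1 + pi / 2 - (\<phi>2 + pi / 2)) = 0" by (rule hplane_dir_subsetD)
    then show False using wedge_sin sin_minus [of "\<phi>2 - \<phi>1"] by simp
  qed
  show "edge P (base g)"
    unfolding wedge_ridge [symmetric]
    by (rule ridge_edge [OF c, of "e \<phi>2"])
      (use wedge_sin in \<open>simp_all add: lor_perp_dir\<close>)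
  show "base g = facet g (n \<phi>1) \<inter> facet g (n \<phi>2)"
    unfolding wedge_ridge [symmetric] by (simp add: ridge_eq g)
qed

lemma base_normal:
  assumes "p \<in> base g"
  shows "lor (lin (inv_into UNIV g) (e \<phi>)) (hvec p) = 0"
proof -
  have g: "inv_into UNIV g \<in> G" using sector_mem [OF s] inv_closed by blast
  obtain q where "p = inv_into UNIV g q" "q \<in> hplane a \<inter> hplane c" using assms by (auto simp: base_def)
  then show ?thesis by (simp add: lor_lin_hvec g) (simp add: dir_ortho hplane_def)
qed

lemma unit_normal_dir: "lin (inv_into UNIV g) (e \<phi>) \<in> unit_normals (base g)"
proof -
  have "inv_into UNIV g \<in> G" using sector_mem [OF s] inv_closed by blast
  then show ?thesis by (simp add: unit_normals_def base_normal lor_lin lor_dir)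
qed

lemma ray_of_facet:
  assumes "\<phi> = \<phi>1 \<or> \<phi> = \<phi>2"
  shows "ray_of_side (base g) (facet g (n \<phi>)) (lin (inv_into UNIV g) (e \<phi>))"
  unfolding ray_of_side_def
proof (intro conjI unit_normal_dir)
  have g: "g \<in> G" "inv_into UNIV g \<in> G" and yP: "y \<in> g ` P" using sector_mem [OF s] inv_closed by blast+
  have c: "corner g y (- n \<phi>1) (n \<phi>2)" using s by (simp add: sector_def)
  obtain \<epsilon> where \<epsilon>: "0 < \<epsilon>"
    "\<And>p. p \<in> ball y \<epsilon> \<Longrightarrow> p \<in> g ` P \<longleftrightarrow> lor (- n \<phi>1) (hvec p) \<le> 0 \<and> lor (n \<phi>2) (hvec p) \<le> 0"
    "\<And>p. p \<in> ball y \<epsilon> \<Longrightarrow> p \<in> interior (g ` P) \<longleftrightarrow> lor (- n \<phi>1) (hvec p) < 0 \<and> lor (n \<phi>2) (hvec p) < 0"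
    using corner_near [OF c] by blast
  have unit: "lor (e \<phi>) (e \<phi>) = 1" by (simp add: lor_dir)
  have "geodesic (inv_into UNIV g y) (lin (inv_into UNIV g) (e \<phi>)) t \<in> facet g (n \<phi>)" if t: "0 < t" "t < \<epsilon>" for t
  proof -
    let ?p = "geodesic y (e \<phi>) t"
    have hv: "hvec ?p = cosh t *\<^sub>R hvec y + sinh t *\<^sub>R e \<phi>" by (rule hvec_geodesic) (simp_all add: unit)
    have "?p \<in> ball y \<epsilon>" using dist_geodesic [of "e \<phi>" y t] t by (simp add: unit)
    moreover have st: "0 < sinh t" using t by simp
    have "lor (- n \<phi>1) (hvec ?p) = - (sinh t * sin (\<phi> - \<phi>1))" "lor (n \<phi>2) (hvec ?p) = sinh t * sin (\<phi> - \<phi>2)"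
      unfolding hv by (simp_all add: lor_perp_dir)
    moreover have "0 \<le> sin (\<phi> - \<phi>1)" "sin (\<phi> - \<phi>2) \<le> 0"
      using assms wedge_sin sin_minus [of "\<phi>2 - \<phi>1"] by auto
    ultimately have "?p \<in> g ` P" using \<epsilon>(2) st by (simp add: mult_nonneg_nonpos)
    moreover have "?p \<in> hplane (n \<phi>)" unfolding hplane_def mem_Collect_eq hv by (simp add: lor_perp_dir)
    ultimately have "inv_into UNIV g ?p \<in> facet g (n \<phi>)" by (simp add: facet_def)
    moreover have "inv_into UNIV g ?p = geodesic (inv_into UNIV g y) (lin (inv_into UNIV g) (e \<phi>)) t"
      by (rule isom_geodesic [OF isom [OF g(2)]]) (simp_all add: unit)
    ultimately show ?thesis by simp
  qed
  moreover have "inv_into UNIV g y \<in> base g" using yP by (simp add: base_def hplane_def)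
  ultimately show "\<exists>p\<in>base g. \<exists>\<epsilon>>0. \<forall>t. 0 < t \<and> t < \<epsilon> \<longrightarrow>
      geodesic p (lin (inv_into UNIV g) (e \<phi>)) t \<in> facet g (n \<phi>)" using \<epsilon>(1) by blast
qed

lemma wedge_dihedral_angle: "dihedral_angle P (base g) (\<phi>2 - \<phi>1)"
proof -
  have g: "inv_into UNIV g \<in> G" using sector_mem [OF s] inv_closed by blast
  have "lor (lin (inv_into UNIV g) (e \<phi>1)) (lin (inv_into UNIV g) (e \<phi>2)) = cos (\<phi>2 - \<phi>1)"
    using cos_minus [of "\<phi>2 - \<phi>1"] by (simp add: lor_lin g lor_dir)
  moreover have "arccos (cos (\<phi>2 - \<phi>1)) = \<phi>2 - \<phi>1"
    using s wedge by (intro arccos_cos) (auto simp: sector_def)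
  ultimately have ang: "\<phi>2 - \<phi>1 = arccos (lor (lin (inv_into UNIV g) (e \<phi>1)) (lin (inv_into UNIV g) (e \<phi>2)))"
    by simp
  have "ray_of_side (base g) (facet g (n \<phi>1)) (lin (inv_into UNIV g) (e \<phi>1))"
    "ray_of_side (base g) (facet g (n \<phi>2)) (lin (inv_into UNIV g) (e \<phi>2))"
    by (simp_all add: ray_of_facet)
  with wedge_facets ang show ?thesis unfolding dihedral_angle_def by blast
qed

text \<open>Turning \<open>e \<phi>1\<close> by \<eta> - \<phi>1 gives \<open>e \<eta>\<close>,
  which spans the line of \<open>hplane (n \<eta>)\<close>. The orientation is right because
  \<open>n \<phi>1\<close> has product sin (\<phi>2 - \<phi>1) > 0 with the other ray.\<close>

lemma wedge_hyperplane_angle: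
  "hyperplane_angle (base g) (facet g (n \<phi>1)) (facet g (n \<phi>2)) (inv_into UNIV g ` hplane (n \<eta>)) (\<eta> - \<phi>1)"
proof -
  have g: "inv_into UNIV g \<in> G" using sector_mem [OF s] inv_closed by blast
  let ?l = "lin (inv_into UNIV g)"
  have "cos (\<eta> - \<phi>1) *\<^sub>R ?l (e \<phi>1) + sin (\<eta> - \<phi>1) *\<^sub>R ?l (n \<phi>1) =
      ?l (cos (\<eta> - \<phi>1) *\<^sub>R e \<phi>1 + sin (\<eta> - \<phi>1) *\<^sub>R n \<phi>1)"
    by (simp add: lin_linear [OF isom [OF g]])
  also have "cos (\<eta> - \<phi>1) *\<^sub>R e \<phi>1 + sin (\<eta> - \<phi>1) *\<^sub>R n \<phi>1 = e (\<phi>1 + (\<eta> - \<phi>1))"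
    unfolding dir_add_half unfolding dir_def cos_add sin_add by (simp add: algebra_simps)
  finally have dir: "cos (\<eta> - \<phi>1) *\<^sub>R ?l (e \<phi>1) + sin (\<eta> - \<phi>1) *\<^sub>R ?l (n \<phi>1) = ?l (e \<eta>)" by simp
  have "geodesic p (?l (e \<eta>)) t \<in> inv_into UNIV g ` hplane (n \<eta>)" if p: "p \<in> base g" for p t
  proof -
    obtain q where q: "p = inv_into UNIV g q" "q \<in> hplane a \<inter> hplane c" using p by (auto simp: base_def)
    have l: "lor (e \<phi>) (hvec q) = 0" for \<phi> using q(2) by (simp add: dir_ortho hplane_def)
    have u: "lor (e \<eta>) (e \<eta>) = 1" by (simp add: lor_dir)
    have "geodesic p (?l (e \<eta>)) t = inv_into UNIV g (geodesic q (e \<eta>) t)"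
      unfolding q(1) using isom_geodesic [OF isom [OF g] l u] by simp
    moreover have "geodesic q (e \<eta>) t \<in> hplane (n \<eta>)"
      unfolding hplane_def mem_Collect_eq hvec_geodesic [OF l u] by (simp add: l lor_perp_dir)
    ultimately show ?thesis by blast
  qed
  then have "\<forall>p\<in>base g. \<forall>t. geodesic p (cos (\<eta> - \<phi>1) *\<^sub>R ?l (e \<phi>1) + sin (\<eta> - \<phi>1) *\<^sub>R ?l (n \<phi>1)) t
      \<in> inv_into UNIV g ` hplane (n \<eta>)" unfolding dir by blast
  moreover have "ray_of_side (base g) (facet g (n \<phi>1)) (?l (e \<phi>1))"
    "ray_of_side (base g) (facet g (n \<phi>2)) (?l (e \<phi>2))"
    by (simp_all add: ray_of_facet)
  moreover have "?l (n \<phi>1) \<in> unit_normals (base g)" by (rule unit_normal_dir)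
  moreover have "lor (?l (e \<phi>1)) (?l (n \<phi>1)) = 0"
    unfolding lor_lin [OF isom [OF g]] by (subst lor_commute) (simp add: lor_perp_dir)
  moreover have "0 < lor (?l (e \<phi>2)) (?l (n \<phi>1))"
    unfolding lor_lin [OF isom [OF g]] by (subst lor_commute) (simp add: lor_perp_dir wedge_sin)
  ultimately show ?thesis unfolding hyperplane_angle_def by blast
qed

text \<open>The axis lies in the wall of the common facet, so both tiles meet it in the same set;
  and the neighbour composed with the pairing is \<open>g\<close>.\<close>

lemma base_neighbour: "base (neighbour g (n \<phi>2)) = pr (facet g (n \<phi>2)) ` base g"
proof -
  let ?g' = "neighbour g (n \<phi>2)"
  have c: "corner g y (- n \<phi>1) (n \<phi>2)" using s by (simp add: sector_def)
  note nb = neighbour [OF c sector_facet_dir(1) [OF s]]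
  have g: "g \<in> G" using sector_mem [OF s] by blast
  have L: "hplane a \<inter> hplane c \<subseteq> hplane (n \<phi>2)" by (auto simp: hplane_def dir_ortho)
  have "?g' ` (pr (facet g (n \<phi>2)) ` base g) = g ` base g"
    unfolding image_comp nb(6) ..
  also have "\<dots> = g ` P \<inter> (hplane a \<inter> hplane c)"
    unfolding base_def by (simp add: image_f_inv_f isomD(1) bij_is_surj g)
  also have "\<dots> = ?g' ` P \<inter> (hplane a \<inter> hplane c)" using nb(2) L by blast
  finally have "inv_into UNIV ?g' ` (?g' ` (pr (facet g (n \<phi>2)) ` base g)) = base ?g'"
    unfolding base_def by simp
  then show ?thesis by (simp add: image_inv_f_f isomD(1) bij_is_inj nb(1))
qed

end

end

section \<open>The case where \<open>H\<close> is mapped to itself\<close>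

context paired_tessellation
begin

lemma corner_unique:
  assumes c: "corner g y m m" "corner h y m m"
  shows "interior (g ` P) \<inter> interior (h ` P) \<noteq> {}"
proof -
  have neg: "lor m (- m) < 0" using corner_spacelike [OF c(1)] by simp
  have "\<forall>\<^sub>F t in at_right 0. shift y (- m) t \<in> interior (g ` P) \<inter> interior (h ` P)"
    using corner_shift [OF c(1), of "- m"] corner_shift [OF c(2), of "- m"]
    by eventually_elim (use neg in simp)
  then obtain t where "shift y (- m) t \<in> interior (g ` P) \<inter> interior (h ` P)"
    by (rule eventually_at_right_ex)
  then show ?thesis by blast
qed

text \<open>If different, \<open>h\<close> and \<open>k\<close> occupy opposite half-spaces at
  \<open>y\<close>. The neighbour of \<open>h\<close> across the hyperplane occupies the side of
  \<open>k\<close>, hence equals \<open>k\<close>, and then the pairing of that facet preserves the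
  hyperplane.\<close>

lemma generic_hplane_unique:
  assumes gen: "generic (hplane v) y" and v: "0 < lor v v"
    and h: "h \<in> G" "y \<in> h ` P" "h ` hplane v = hplane v"
    and k: "k \<in> G" "y \<in> k ` P" "k ` hplane v = hplane v"
    and side: "\<And>S. side P S \<Longrightarrow> S \<subseteq> hplane v \<Longrightarrow> pr S ` hplane v \<noteq> hplane v"
  shows "h = k"
proof (rule ccontr)
  assume ne: "h \<noteq> k"
  then have "y \<notin> interior (h ` P)" "y \<notin> interior (k ` P)"
    using tile_eqI [OF h(1) k(1)] tile_eqI [OF k(1) h(1)] h(2) k(2) by blast+
  then have ch: "corner h y v v \<or> corner h y (- v) (- v)" and ck: "corner k y v v \<or> corner k y (- v) (- v)"
    using generic_hplane [OF gen v] h k by blast+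
  have nc: "\<not> (corner h y m m \<and> corner k y m m)" for m
    using corner_unique [of h y m k] disjoint [OF h(1) k(1)] ne by blast
  have "\<exists>m. (m = v \<or> m = - v) \<and> corner h y m m \<and> corner k y (- m) (- m)"
  proof (cases "corner h y v v")
    case True
    then have "corner k y (- v) (- v)" using ck nc [of v] by blast
    with True show ?thesis by blast
  next
    case False
    then have "corner h y (- v) (- v)" using ch by blast
    moreover from this have "corner k y v v" using ck nc [of "- v"] by blast
    ultimately show ?thesis by (intro exI [of _ "- v"]) simp
  qed
  then obtain m where m: "m = v \<or> m = - v" "corner h y m m" "corner k y (- m) (- m)"
    by blast
  \<comment> \<open>With equal normals the zero direction is admissible: \<open>y\<close> itself is
    already in the relative interior of the facet.\<close>
  have fd: "facet_dir m m 0" by (simp add: facet_dir_def)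
  let ?h' = "neighbour h m" and ?S = "facet h m"
  note nb = neighbour [OF m(2) fd]
  have hm: "hplane m = hplane v" using m(1) by auto
  have "y \<in> h ` P \<inter> hplane m" using h(2) m(2) by (simp add: corner_def hplane_def)
  then have y': "y \<in> ?h' ` P" "y \<notin> interior (?h' ` P)" using nb(2,3) by blast+
  then have "corner ?h' y m m \<or> corner ?h' y (- m) (- m)"
    using generic_hplane [OF gen v nb(1)] m(1) by auto
  moreover have "\<not> corner ?h' y m m" using corner_unique [OF m(2)] nb(4) by blast
  ultimately have "?h' = k"
    using corner_unique [OF _ m(3)] disjoint [OF nb(1) k(1)] by blast
  then have "k ` (pr ?S ` hplane v) = k ` hplane v"
    using nb(6) h(3) k(3) by (simp add: image_comp)
  moreover have "inj k" using isomD(1) [OF isom [OF k(1)]] by (rule bij_is_inj)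
  ultimately have "pr ?S ` hplane v = hplane v" by (simp add: inj_image_eq_iff)
  moreover have "side P ?S" by (rule facet_side [OF m(2) fd])
  moreover have "?S \<subseteq> hplane v"
  proof -
    have "inv_into UNIV h ` hplane v = inv_into UNIV h ` (h ` hplane v)" by (simp only: h(3))
    also have "\<dots> = hplane v" by (simp add: image_inv_f_f isomD(1) bij_is_inj h(1))
    finally show ?thesis unfolding facet_def hm by blast
  qed
  ultimately show False using side by blast
qed

end

section \<open>The wedge case and the half-space case\<close>

context framed_pairing
begin

text \<open>Edge chases count from 1, sector chases from 0: the \<open>i\<close>-th edge lies in
  tile \<open>h (i - 1)\<close>, whose initial ray gives \<open>S\<close> and whose final ray gives
  \<open>R\<close>.\<close>

lemma sector_chase_edge_chase:
  assumes ch: "sector_chase h \<Theta>"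
  shows "edge_chase P pr (\<lambda>i. base (h (i - 1))) (\<lambda>i. facet (h (i - 1)) (n (\<Theta> (i - 1))))
    (\<lambda>i. facet (h (i - 1)) (n (\<Theta> i))) (\<lambda>i. pr (facet (h (i - 1)) (n (\<Theta> i))))"
  unfolding edge_chase_def
proof (intro allI impI)
  fix i :: nat assume "1 \<le> i"
  then obtain j where i: "i = Suc j" by (cases i) auto
  have s: "sector (h j) (\<Theta> j) (\<Theta> (Suc j))" "\<Theta> (Suc j) < \<Theta> j + pi"
    and nx: "h (Suc j) = neighbour (h j) (n (\<Theta> (Suc j)))" using ch by (auto simp: sector_chase_def)
  have c: "corner (h j) y (- n (\<Theta> j)) (n (\<Theta> (Suc j)))" using s(1) by (simp add: sector_def)
  have "pr (facet (h j) (n (\<Theta> (Suc j)))) ` facet (h j) (n (\<Theta> (Suc j))) = facet (h (Suc j)) (n (\<Theta> (Suc j)))"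
    unfolding nx by (rule neighbour(5) [OF c sector_facet_dir(1) [OF s(1)]])
  moreover have "base (h (Suc j)) = pr (facet (h j) (n (\<Theta> (Suc j)))) ` base (h j)"
    unfolding nx by (rule base_neighbour [OF s])
  ultimately show "edge P (base (h (i - 1))) \<and> side P (facet (h (i - 1)) (n (\<Theta> (i - 1)))) \<and>
      side P (facet (h (i - 1)) (n (\<Theta> i))) \<and>
      facet (h (i - 1)) (n (\<Theta> (i - 1))) \<noteq> facet (h (i - 1)) (n (\<Theta> i)) \<and>
      base (h (i - 1)) = facet (h (i - 1)) (n (\<Theta> (i - 1))) \<inter> facet (h (i - 1)) (n (\<Theta> i)) \<and>
      pr (facet (h (i - 1)) (n (\<Theta> i))) = pr (facet (h (i - 1)) (n (\<Theta> i))) \<and>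
      facet (h (i + 1 - 1)) (n (\<Theta> (i + 1 - 1))) = pr (facet (h (i - 1)) (n (\<Theta> i))) ` facet (h (i - 1)) (n (\<Theta> i)) \<and>
      base (h (i + 1 - 1)) = pr (facet (h (i - 1)) (n (\<Theta> i))) ` base (h (i - 1))"
    using wedge_facets [OF s] by (simp add: i)
qed

lemma hplane_n_add_of_int: "hplane (n (\<phi> + of_int k * pi)) = hplane (n \<phi>)"
proof -
  have s: "sin (of_int k * pi) = 0" using sin_zero_iff_int2 by blast
  then have "(cos (of_int k * pi))\<^sup>2 = 1" using sin_cos_squared_add [of "of_int k * pi"] by simp
  then have "cos (of_int k * pi) \<noteq> 0" by auto
  moreover have "n (\<phi> + of_int k * pi) = cos (of_int k * pi) *\<^sub>R n \<phi>"
    unfolding dir_add_half cos_add sin_add s by (simp add: algebra_simps)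
  ultimately show ?thesis by (simp add: hplane_scaleR)
qed

lemma wedge_case:
  assumes chase: "\<And>E S R g \<theta> \<alpha> \<beta> l.
      edge_chase P pr E S R g \<Longrightarrow> E 1 \<subseteq> H \<Longrightarrow>
      hyperplane_angle (E 1) (S 1) (R 1) H \<alpha> \<Longrightarrow>
      (\<And>i. 1 \<le> i \<Longrightarrow> dihedral_angle P (E i) (\<theta> i)) \<Longrightarrow>
      1 \<le> l \<Longrightarrow> E (l + 1) \<subseteq> H \<Longrightarrow>
      hyperplane_angle (E (l + 1)) (S (l + 1)) (R (l + 1)) H \<beta> \<Longrightarrow>
      \<exists>k::int. (\<Sum>i=1..l. \<theta> i) + \<beta> - \<alpha> = of_int k * pi"
    and s: "sector h \<phi>1 \<phi>2" "\<phi>2 < \<phi>1 + pi" and h: "h ` H = H" and \<eta>: "H = hplane (n \<eta>)"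
    and k: "k \<in> G" "y \<in> k ` P" and \<gamma>: "k ` H = hplane (n \<gamma>)"
  shows "k ` H = H"
proof -
  obtain f \<Theta> where ch: "sector_chase f \<Theta>" and f0: "f 0 = h" "\<Theta> 0 = \<phi>1"
    by (rule sector_chase_exists [OF s])
  obtain l where l: "f l = k" using sector_chase_reaches [OF ch k] by blast
  show ?thesis
  proof (cases "l = 0")
    case True
    then show ?thesis using f0 l h by simp
  next
    case False
    have sf: "sector (f i) (\<Theta> i) (\<Theta> (Suc i))" "\<Theta> (Suc i) < \<Theta> i + pi" for i
      using ch by (auto simp: sector_chase_def)
    have inv_image: "inv_into UNIV g ` (g ` H) = H" if "g \<in> G" for g
      by (simp add: image_inv_f_f isomD(1) bij_is_inj that)
    have hG: "h \<in> G" using sector_mem [OF s(1)] by blast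
    have h': "inv_into UNIV h ` hplane (n \<eta>) = H" using inv_image [OF hG] h \<eta> by simp
    have k': "inv_into UNIV k ` hplane (n \<gamma>) = H" using inv_image [OF k(1)] \<gamma> by simp
    have L: "hplane a \<inter> hplane c \<subseteq> hplane (n \<phi>)" for \<phi> by (auto simp: hplane_def dir_ortho)
    have "base h \<subseteq> H" unfolding base_def h' [symmetric] using L by blast
    moreover have "base k \<subseteq> H" unfolding base_def k' [symmetric] using L by blast
    moreover have "hyperplane_angle (base h) (facet h (n (\<Theta> 0))) (facet h (n (\<Theta> 1))) H (\<eta> - \<Theta> 0)"
      using wedge_hyperplane_angle [OF sf, of 0 \<eta>] by (simp add: f0 h')
    moreover have "hyperplane_angle (base k) (facet k (n (\<Theta> l))) (facet k (n (\<Theta> (l + 1)))) H (\<gamma> - \<Theta> l)"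
      using wedge_hyperplane_angle [OF sf, of l \<gamma>] by (simp add: l k')
    moreover have "dihedral_angle P (base (f (i - 1))) (\<Theta> i - \<Theta> (i - 1))" if "1 \<le> i" for i
      using wedge_dihedral_angle [OF sf, of "i - 1"] that by simp
    ultimately obtain z :: int where z: "(\<Sum>i=1..l. \<Theta> i - \<Theta> (i - 1)) + (\<gamma> - \<Theta> l) - (\<eta> - \<Theta> 0) = of_int z * pi"
      using chase [OF sector_chase_edge_chase [OF ch], of "\<eta> - \<Theta> 0" "\<lambda>i. \<Theta> i - \<Theta> (i - 1)" l "\<gamma> - \<Theta> l"]
        False by (auto simp: f0 l)
    \<comment> \<open>The dihedral angles cancel against the reference rays \<Theta> 0 and \<Theta>
      l, leaving \<gamma> - \<eta> as a multiple of \<pi>.\<close>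
    have "(\<Sum>i=1..m. \<Theta> i - \<Theta> (i - 1)) = \<Theta> m - \<Theta> 0" for m
      by (induction m) auto
    then have "\<gamma> = \<eta> + of_int z * pi" using z by simp
    then show ?thesis using \<gamma> \<eta> hplane_n_add_of_int by simp
  qed
qed

lemma half_transversal:
  assumes s: "sector m \<psi>1 (\<psi>1 + pi)" and \<eta>: "sin (\<eta> - \<psi>1) \<noteq> 0"
    and A: "A \<subseteq> G" "\<And>q. q \<in> hplane (n \<eta>) \<Longrightarrow> \<exists>j\<in>A. q \<in> j ` P"
  shows "m \<in> A"
proof -
  have eq: "sin (\<psi>1 + pi - \<omega>) = sin (\<omega> - \<psi>1)" for \<omega>
    using sin_periodic_pi [of "\<psi>1 - \<omega>"] sin_minus [of "\<omega> - \<psi>1"] by (simp add: algebra_simps)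
  have "\<exists>\<omega>. 0 < sin (\<omega> - \<psi>1) \<and> hplane (n \<omega>) = (hplane (n \<eta>) :: 'n hyp set)"
  proof (cases "0 < sin (\<eta> - \<psi>1)")
    case False
    then have "0 < sin (\<eta> + pi - \<psi>1)"
      using \<eta> sin_periodic_pi [of "\<eta> - \<psi>1"] by (simp add: algebra_simps)
    then show ?thesis by (intro exI [of _ "\<eta> + pi"]) (simp only: n_add_pi hplane_uminus simp_thms)
  qed blast
  then obtain \<omega> where \<omega>: "0 < sin (\<omega> - \<psi>1)" "hplane (n \<omega>) = (hplane (n \<eta>) :: 'n hyp set)" by blast
  have "\<forall>\<^sub>F t in at_right 0. shift y (e \<omega>) t \<in> interior (m ` P) \<and> shift y (e \<omega>) t \<in> hplane (n \<eta>)"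
    using sector_shift [OF s, of \<omega>] eventually_shift_hplane [of \<omega>]
    by eventually_elim (use \<omega> eq [of \<omega>] in simp)
  then obtain t where t: "shift y (e \<omega>) t \<in> interior (m ` P) \<and> shift y (e \<omega>) t \<in> hplane (n \<eta>)"
    by (rule eventually_at_right_ex)
  then obtain j where "j \<in> A" "shift y (e \<omega>) t \<in> j ` P" using A(2) by blast
  then show ?thesis using tile_eqI [of m j] t A(1) sector_mem [OF s] by blast
qed

text \<open>Two half-spaces exhaust the directions at \<open>y\<close>, so \<open>k\<close> is
  \<open>h\<close> or its neighbour. The common wall can coincide with at most one of the two
  hyperplanes; the other runs through the interior of both tiles.\<close>

lemma half_case:
  assumes s: "sector h \<phi> (\<phi> + pi)" and k: "k \<in> G" "y \<in> k ` P" and hk: "h \<in> A" "k \<in> B"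
    and A: "A \<subseteq> G" "\<And>q. q \<in> hplane (n \<eta>) \<Longrightarrow> \<exists>j\<in>A. q \<in> j ` P"
    and B: "B \<subseteq> G" "\<And>q. q \<in> hplane (n \<gamma>) \<Longrightarrow> \<exists>j\<in>B. q \<in> j ` P"
    and ne: "hplane (n \<eta>) \<noteq> (hplane (n \<gamma>) :: 'n hyp set)"
  shows "A \<inter> B \<noteq> {}"
proof (cases "k = h")
  case True
  then show ?thesis using hk by blast
next
  case False
  let ?h' = "neighbour h (n (\<phi> + pi))"
  have hG: "h \<in> G" "y \<in> h ` P" using sector_mem [OF s] by auto
  obtain \<phi>3 where "sector ?h' (\<phi> + pi) \<phi>3" "\<phi>3 = \<phi> + pi + pi" using sector_step [OF s] by blast
  then have s': "sector ?h' (\<phi> + pi) (\<phi> + pi + pi)" by simp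
  have "y \<notin> interior (k ` P)" using tile_eqI [OF k(1) hG(1) _ hG(2)] False by blast
  then obtain \<psi>1 \<psi>2 where sk: "sector k \<psi>1 \<psi>2" using sector_exists [OF k] by blast
  define \<mu> where "\<mu> = (\<psi>1 + \<psi>2) / 2"
  have mid: "0 < sin (\<mu> - \<psi>1)" "0 < sin (\<psi>2 - \<mu>)" using sector_middle [OF sk] by (simp_all add: \<mu>_def)
  have e1: "sin (\<phi> + pi - \<mu>) = sin (\<mu> - \<phi>)"
    using sin_periodic_pi [of "\<phi> - \<mu>"] sin_minus [of "\<mu> - \<phi>"] by (simp add: algebra_simps)
  have e2: "sin (\<mu> - (\<phi> + pi)) = - sin (\<mu> - \<phi>)"
    using e1 sin_minus [of "\<phi> + pi - \<mu>"] by simp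
  have e3: "sin (\<phi> + pi + pi - \<mu>) = - sin (\<mu> - \<phi>)"
    using sin_periodic_pi [of "\<phi> + pi - \<mu>"] e1 by (simp add: algebra_simps)
  \<comment> \<open>The middle direction of \<open>k\<close> lies in one of the two closed
    half-planes; the first would give \<open>k = h\<close>.\<close>
  have "\<not> 0 \<le> sin (\<mu> - \<phi>)" using sector_unique [OF sk s mid] e1 False by auto
  then have k': "k = ?h'" by (intro sector_unique [OF sk s' mid]) (simp_all only: e2 e3)
  show ?thesis
  proof (cases "sin (\<eta> - \<phi>) = 0")
    case False
    have "sin (\<eta> - (\<phi> + pi)) = - sin (\<eta> - \<phi>)"
      using sin_periodic_pi [of "\<eta> - \<phi> - pi"] by (simp add: algebra_simps)
    then have "sin (\<eta> - (\<phi> + pi)) \<noteq> 0" using False by simp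
    then have "k \<in> A" unfolding k' by (rule half_transversal [OF s' _ A(1)]) (rule A(2))
    then show ?thesis using hk by blast
  next
    case True
    have "sin (\<gamma> - \<phi>) \<noteq> 0"
    proof
      assume "sin (\<gamma> - \<phi>) = 0"
      then obtain z1 z2 :: int where "\<gamma> - \<phi> = of_int z1 * pi" "\<eta> - \<phi> = of_int z2 * pi"
        using True sin_zero_iff_int2 by metis
      then have "\<gamma> = \<eta> + of_int (z1 - z2) * pi" by (simp add: algebra_simps)
      then show False using ne hplane_n_add_of_int by metis
    qed
    then have "h \<in> B" by (rule half_transversal [OF s _ B(1)]) (rule B(2))
    then show ?thesis using hk by blast
  qed
qed

end

section \<open>Choice of the frame and conclusion\<close>

text \<open>Gram-Schmidt on the two unit normals. Both are orthogonal to the common point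
  \<open>x\<close>, where the form is positive definite, so the second step fails only if the
  hyperplanes coincide.\<close>

lemma frame_of_hyperplanes:
  fixes v w :: "(real ^ 'n::finite) \<times> real"
  assumes v: "0 < lor v v" and w: "0 < lor w w" and x: "x \<in> hplane v \<inter> hplane w" and ne: "hplane w \<noteq> hplane v"
  obtains a c \<eta> \<gamma> where "frame a c" "hplane v = hplane (dir a c (\<eta> + pi / 2))"
    "hplane w = hplane (dir a c (\<gamma> + pi / 2))" "x \<in> hplane a \<inter> hplane c"
proof -
  define a where "a = (1 / sqrt (lor v v)) *\<^sub>R v"
  define w' where "w' = (1 / sqrt (lor w w)) *\<^sub>R w"
  have aa: "lor a a = 1" and ww: "lor w' w' = 1"
    using v w by (simp_all add: a_def w'_def)
  have ha: "hplane a = hplane v" and hw: "hplane w' = hplane w"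
    using v w by (simp_all add: a_def w'_def hplane_scaleR)
  define d where "d = lor w' a"
  define u where "u = w' - d *\<^sub>R a"
  have xa: "lor a (hvec x) = 0" "lor w' (hvec x) = 0" using x ha hw by (auto simp: hplane_def)
  then have xu: "lor u (hvec x) = 0" by (simp add: u_def)
  have au: "lor a u = 0" using lor_commute [of a w'] by (simp add: u_def d_def aa)
  have "lor u u = lor w' u - d * lor a u" by (subst (1) u_def) simp
  then have "lor u u = lor w' u" using au by simp
  also have "\<dots> = 1 - d\<^sup>2" by (simp add: u_def ww d_def power2_eq_square)
  finally have uu: "lor u u = 1 - d\<^sup>2" .
  have "lor u u \<noteq> 0"
  proof
    assume 0: "lor u u = 0"
    then have "u = 0" using lor_orthogonal_pos(2) [OF xu] by blast
    then have "w' = d *\<^sub>R a" by (simp add: u_def)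
    moreover have "d \<noteq> 0" using uu 0 by auto
    ultimately have "hplane w' = hplane a" by (simp add: hplane_scaleR)
    then show False using ha hw ne by simp
  qed
  then have upos: "0 < lor u u" using lor_orthogonal_pos(1) [OF xu] by simp
  define c where "c = (1 / sqrt (lor u u)) *\<^sub>R u"
  have cc: "lor c c = 1" "lor a c = 0" using upos au by (simp_all add: c_def)
  have "d\<^sup>2 + (sqrt (lor u u))\<^sup>2 = 1" using upos uu by simp
  then obtain \<omega> where "d = cos \<omega>" "sqrt (lor u u) = sin \<omega>" by (metis sincos_total_2pi)
  moreover have "w' = d *\<^sub>R a + sqrt (lor u u) *\<^sub>R c" using upos by (simp add: c_def u_def)
  ultimately have w'_dir: "w' = dir a c \<omega>" by (simp add: dir_def)
  show ?thesis
  proof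
    show "frame a c" using aa cc by (simp add: frame_def)
    \<comment> \<open>The normal \<open>a\<close> is \<open>dir a c 0\<close>, so the quarter turn
      between a line and its normal makes \<eta> equal to -\<pi>/2, and likewise \<gamma> = \<omega>
      - \<pi>/2.\<close>
    show "hplane v = hplane (dir a c (- (pi / 2) + pi / 2))" using ha by (simp add: dir_def)
    show "hplane w = hplane (dir a c (\<omega> - pi / 2 + pi / 2))" using hw w'_dir by simp
    show "x \<in> hplane a \<inter> hplane c" using xa xu by (simp add: hplane_def c_def)
  qed
qed

theorem theorem4p4:
  fixes P H :: "'n::finite hyp set"
    and G J :: "('n hyp \<Rightarrow> 'n hyp) set"
    and mate :: "'n hyp set \<Rightarrow> 'n hyp set"
    and pr :: "'n hyp set \<Rightarrow> 'n hyp \<Rightarrow> 'n hyp"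
  assumes "discrete_isom_group G"
    and "side_pairing P mate pr"
    and "G = side_pairing_group P pr"
    and "fundamental_polyhedron UNIV G P"
    and "hyperplane H"
    and "top_of_set H interior_of (H \<inter> P) \<noteq> {}"
    and "subgroup J (isom_group\<lparr>carrier := G\<rparr>)"
    and "\<And>j. j \<in> J \<Longrightarrow> j ` H = H"
    and "fundamental_polyhedron H J (H \<inter> P)"
    and "\<And>S. side P S \<Longrightarrow> S \<subseteq> H \<Longrightarrow> pr S ` H \<noteq> H"
    and "\<And>E S R g \<theta> \<alpha> \<beta> l.
      edge_chase P pr E S R g \<Longrightarrow> E 1 \<subseteq> H \<Longrightarrow>
      hyperplane_angle (E 1) (S 1) (R 1) H \<alpha> \<Longrightarrow>
      (\<And>i. 1 \<le> i \<Longrightarrow> dihedral_angle P (E i) (\<theta> i)) \<Longrightarrow>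
      1 \<le> l \<Longrightarrow> E (l + 1) \<subseteq> H \<Longrightarrow>
      hyperplane_angle (E (l + 1)) (S (l + 1)) (R (l + 1)) H \<beta> \<Longrightarrow>
      \<exists>k::int. (\<Sum>i=1..l. \<theta> i) + \<beta> - \<alpha> = of_int k * pi"
  shows "precisely_invariant G J H"
proof -
  have G: "subgroup G isom_group" using assms(1) by (simp add: discrete_isom_group_def)
  have J: "subgroup J isom_group"
    by (rule group.incl_subgroup [OF group_isom_group G assms(7)])
  have JG: "J \<subseteq> G" using subgroup.subset [OF assms(7)] by simp
  obtain N where N: "defining_normals UNIV P N" and int: "interior P \<noteq> {}"
    using assms(4) by (auto simp: fundamental_polyhedron_def polyhedron_in_def)
  interpret paired_tessellation P N G mate pr
  proof (intro paired_tessellation.intro tessellation.intro paired_tessellation_axioms.intro)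
    show "locally_finite_in euclidean ((\<lambda>g. g ` P) ` G)"
      using assms(4) by (simp add: fundamental_polyhedron_def)
    show "g = h" if gh: "g \<in> G" "h \<in> G" "interior (g ` P) \<inter> interior (h ` P) \<noteq> {}" for g h
    proof (rule ccontr)
      assume "g \<noteq> h"
      then have "\<exists>x\<in>UNIV. g x \<noteq> h x" by blast
      then have "top_of_set UNIV interior_of (g ` P) \<inter> top_of_set UNIV interior_of (h ` P) = {}"
        using assms(4) gh(1,2) unfolding fundamental_polyhedron_def by blast
      then show False using gh(3) by simp
    qed
    show "pr S \<in> G" if "side P S" for S
      unfolding assms(3) side_pairing_group_def by (rule generate.incl) (use that in blast)
  qed (fact G N int assms(2))+
  obtain v where v: "0 < lor v v" "H = hplane v" using assms(5) by (auto simp: hyperplane_def)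
  have cover: "\<exists>j\<in>J. q \<in> j ` P" if q: "q \<in> H" for q
  proof -
    have "q \<in> (\<Union>j\<in>J. j ` (H \<inter> P))" using assms(9) q by (simp add: fundamental_polyhedron_def)
    then show ?thesis by blast
  qed
  have "g ` H \<inter> H = {}" if g: "g \<in> G - J" for g
  proof (rule ccontr)
    assume "g ` H \<inter> H \<noteq> {}"
    then obtain x where x: "x \<in> g ` H" "x \<in> H" by blast
    \<comment> \<open>The tiles indexed by \<open>B\<close> cover \<open>g\<close>
      H\<open>. Disjointness from\<close>J\<open>is what every case below contradicts, directly or through\<close>k
      \<open>H = H\<close>.\<close>
    define B where "B = (\<circ>) g ` J"
    have BG: "B \<subseteq> G" using g JG comp_closed by (auto simp: B_def)
    have JB: "J \<inter> B = {}"
    proof (rule ccontr)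
      assume "J \<inter> B \<noteq> {}"
      then obtain j where j: "j \<in> J" "g \<circ> j \<in> J" by (auto simp: B_def)
      have "inv_into UNIV j \<in> J"
        using subgroup.m_inv_closed [OF J j(1)] inv_isom_group [OF subgroup.mem_carrier [OF J j(1)]] by simp
      then have "g \<circ> j \<circ> inv_into UNIV j \<in> J"
        using subgroup.m_closed [OF J j(2)] by (simp add: isom_group_def)
      moreover have "g \<circ> j \<circ> inv_into UNIV j = g"
        using inv_apply(1) [of j] j(1) JG by (auto simp: fun_eq_iff)
      ultimately show False using g by simp
    qed
    have B: "k ` H = g ` H" if k: "k \<in> B" for k
    proof -
      obtain j where j: "j \<in> J" "k = g \<circ> j" using k by (auto simp: B_def)
      then have "k ` H = g ` (j ` H)" by (simp add: image_comp)
      then show ?thesis by (simp add: assms(8) [OF j(1)])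
    qed
    have coverB: "\<exists>k\<in>B. q \<in> k ` P" if q: "q \<in> g ` H" for q
    proof -
      obtain p where p: "p \<in> H" "q = g p" using q by blast
      then obtain j where "j \<in> J" "p \<in> j ` P" using cover by blast
      then show ?thesis using p(2) by (intro bexI [of _ "g \<circ> j"]) (auto simp: B_def)
    qed
    have gG: "g \<in> G" using g by blast
    have gH: "g ` H = hplane (lin g v)" unfolding v(2) by (rule isom_image_hplane [OF isom [OF gG]])
    show False
    proof (cases "g ` H = H")
      case True
      obtain y where y: "generic (hplane v) y"
        using exists_generic [of x "{v}"] x(2) v(2) by (metis subspace_of_singleton)
      then have yH: "y \<in> H" "y \<in> g ` H" using v(2) True by (auto simp: generic_def)
      obtain h k where hk: "h \<in> J" "y \<in> h ` P" "k \<in> B" "y \<in> k ` P"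
        using cover [OF yH(1)] coverB [OF yH(2)] by blast
      have "h = k"
      proof (rule generic_hplane_unique [OF y v(1) _ hk(2) _ _ hk(4)])
        show "h \<in> G" "k \<in> G" using hk JG BG by blast+
        show "h ` hplane v = hplane v" using assms(8) [OF hk(1)] v(2) by simp
        show "k ` hplane v = hplane v" using B [OF hk(3)] True v(2) by simp
        show "\<And>S. side P S \<Longrightarrow> S \<subseteq> hplane v \<Longrightarrow> pr S ` hplane v \<noteq> hplane v"
          using assms(10) v(2) by simp
      qed
      then show False using hk JB by blast
    next
      case False
      have w: "0 < lor (lin g v) (lin g v)" using v(1) by (simp add: lor_lin gG)
      have xx: "x \<in> hplane v \<inter> hplane (lin g v)" using x gH v(2) by simp
      have ne: "hplane (lin g v) \<noteq> hplane v" using False gH v(2) by simp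
      obtain a c \<eta> \<gamma> where fr: "frame a c" and \<eta>: "hplane v = hplane (dir a c (\<eta> + pi / 2))"
        and \<gamma>: "hplane (lin g v) = hplane (dir a c (\<gamma> + pi / 2))" and xac: "x \<in> hplane a \<inter> hplane c"
        by (rule frame_of_hyperplanes [OF v(1) w xx ne])
      have "subspace_of {a, c} = hplane a \<inter> hplane c" by (auto simp: subspace_of_insert)
      then obtain y where y: "generic (hplane a \<inter> hplane c) y"
        using exists_generic [of x "{a, c}"] xac by metis
      interpret frame a c by (rule fr)
      interpret framed_pairing P N G a c y mate pr
        by unfold_locales (rule y)
      have yL: "y \<in> hplane (dir a c \<phi>)" for \<phi> by (simp add: hplane_def)
      obtain h where h: "h \<in> J" "y \<in> h ` P" using cover [of y] yL v(2) \<eta> by blast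
      obtain k where k: "k \<in> B" "y \<in> k ` P" using coverB [of y] yL gH \<gamma> by blast
      have hkG: "h \<in> G" "k \<in> G" using h k JG BG by blast+
      have "h \<noteq> k" using h k JB by blast
      \<comment> \<open>An interior point of one tile lies in no other, so two distinct tiles at
        \<open>y\<close> force a proper sector.\<close>
      then have "y \<notin> interior (h ` P)" using tile_eqI [OF hkG _ k(2)] by blast
      then obtain \<phi>1 \<phi>2 where s: "sector h \<phi>1 \<phi>2" using sector_exists [OF hkG(1) h(2)] by blast
      show False
      proof (cases "\<phi>2 = \<phi>1 + pi")
        case True
        have "J \<inter> B \<noteq> {}"
        proof (rule half_case [OF _ hkG(2) k(2) h(1) k(1) JG _ BG])
          show "sector h \<phi>1 (\<phi>1 + pi)" using s True by simp
          show "\<exists>j\<in>J. q \<in> j ` P" if "q \<in> hplane (dir a c (\<eta> + pi / 2))" for q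
            using that cover v(2) \<eta> by simp
          show "\<exists>j\<in>B. q \<in> j ` P" if "q \<in> hplane (dir a c (\<gamma> + pi / 2))" for q
            using that coverB gH \<gamma> by simp
          show "hplane (dir a c (\<eta> + pi / 2)) \<noteq> (hplane (dir a c (\<gamma> + pi / 2)) :: 'n hyp set)"
            using ne \<eta> \<gamma> by simp
        qed
        then show False using JB by blast
      next
        case wedge: False
        have "k ` H = H"
        proof (rule wedge_case [OF assms(11) s _ assms(8) [OF h(1)] _ hkG(2) k(2)])
          show "\<phi>2 < \<phi>1 + pi" using s wedge by (simp add: sector_def)
          show "H = hplane (dir a c (\<eta> + pi / 2))" using v(2) \<eta> by simp
          show "k ` H = hplane (dir a c (\<gamma> + pi / 2))" using B [OF k(1)] gH \<gamma> by simp
        qed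
        then show False using B [OF k(1)] False by simp
      qed
    qed
  qed
  then show ?thesis using assms(8) by (simp add: precisely_invariant_def)
qed

end
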